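(* Let $m\ge 1$, let $G$ be a finite subgroup of $\mathrm{GL}(m,\mathbb C)$ and let $N = G\cap \mathrm{SL}(m,\mathbb C)$. Suppose that every irreducible complex character of $N$ is extendible to $G$. Then the McKay quiver $Q_G$ of $G$ is a regular covering of the McKay quiver $Q_N$ of $N$ with the (automorphism) group $G/N$; that is, there is a regular covering map $\pi: Q_G\to Q_N$ with the group $G/N$.
   Context: McKay quiver: for a finite subgroup $H$ of $\mathrm{GL}(m,\mathbb C)=\mathrm{GL}(V)$, $V=\mathbb C^m$, let $S_1,\dots,S_n$ be a complete set of representatives of the isomorphism classes of irreducible complex representations of $H$, and write $V\otimes S_i\cong\bigoplus_j a_{i,j}S_j$, where $a_{i,j}S_j$ denotes a direct sum of $a_{i,j}$ copies of $S_j$. The McKay quiver $Q_H=(Q_{H,0},Q_{H,1})$ has as vertices the isomorphism classes of irreducible representations (indexed by $1,\dots,n$), and $a_{i,j}$ arrows from $i$ to $j$. Here both $Q_G$ and $Q_N$ are formed with $V=\mathbb C^m$, viewed by restriction as a representation of $N$. Extendible: an irreducible character $\chi$ of $N$ is extendible (to $G$) if there is an irreducible character $\chi'$ of $G$ with $\chi'|_N=\chi$. Regular covering: for a vertex $i$ of a quiver $Q$, $i^-$ denotes the set of arrows ending at $i$ and $i^+$ the set of arrows starting at $i$. For a group $\Gamma$, a map of quivers $\pi:Q\to Q'$ is a regular covering map with the group $\Gamma$ if for every vertex $j\in Q'_0$ the group $\Gamma$ acts transitively and freely on $\pi^{-1}(j)$, and for each vertex $i\in Q_0$ the induced maps $i^+\to\pi(i)^+$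 and $i^-\to\pi(i)^-$ are both bijective. (This is the usual notion of a regular covering map of oriented graphs with automorphism group $\Gamma$.) *)

theory Defs
  imports
    "HOL-Algebra.Group_Action"
    "Jordan_Normal_Form.Determinant"
    "Jordan_Normal_Form.VS_Connect"
    "Graph_Theory.Digraph"
begin

definition GL :: "nat \<Rightarrow> complex mat monoid" where
  "GL m = units_of (ring_mat TYPE(complex) m ())"

definition SL :: "nat \<Rightarrow> complex mat set" where
  "SL m = {A \<in> carrier_mat m m. det A = 1}"

abbreviation GL_sub :: "nat \<Rightarrow> complex mat set \<Rightarrow> complex mat monoid" where
  "GL_sub m H \<equiv> (GL m)\<lparr>carrier := H\<rparr>"

text \<open>
  A representation is a matrix representation: a pair of its degree \<open>d\<close> and a homomorphism
  into \<open>GL d\<close>. Values outside the carrier of the group are irrelevant throughout.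
\<close>

type_synonym 'g rep = "nat \<times> ('g \<Rightarrow> complex mat)"

definition representation :: "('g, 'x) monoid_scheme \<Rightarrow> 'g rep \<Rightarrow> bool" where
  "representation G \<rho> \<longleftrightarrow> snd \<rho> \<in> hom G (GL (fst \<rho>))"

definition irreducible_rep :: "('g, 'x) monoid_scheme \<Rightarrow> 'g rep \<Rightarrow> bool" where
  "irreducible_rep G \<rho> \<longleftrightarrow>
     representation G \<rho> \<and> fst \<rho> > 0 \<and>
     (\<forall>W. VectorSpace.subspace class_ring W (module_vec TYPE(complex) (fst \<rho>)) \<longrightarrow>
        (\<forall>g\<in>carrier G. \<forall>w\<in>W. snd \<rho> g *\<^sub>v w \<in> W) \<longrightarrow>
        W = {0\<^sub>v (fst \<rho>)} \<or> W = carrier_vec (fst \<rho>))"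

definition rep_iso :: "('g, 'x) monoid_scheme \<Rightarrow> 'g rep \<Rightarrow> 'g rep \<Rightarrow> bool" where
  "rep_iso G \<rho> \<sigma> \<longleftrightarrow>
     fst \<rho> = fst \<sigma> \<and>
     (\<exists>P\<in>carrier (GL (fst \<rho>)). \<forall>g\<in>carrier G. P * snd \<rho> g = snd \<sigma> g * P)"

definition kronecker :: "complex mat \<Rightarrow> complex mat \<Rightarrow> complex mat" where
  "kronecker A B =
     mat (dim_row A * dim_row B) (dim_col A * dim_col B)
       (\<lambda>(i, j). A $$ (i div dim_row B, j div dim_col B) * B $$ (i mod dim_row B, j mod dim_col B))"

definition rep_tensor :: "'g rep \<Rightarrow> 'g rep \<Rightarrow> 'g rep" where
  "rep_tensor \<rho> \<sigma> = (fst \<rho> * fst \<sigma>, \<lambda>g. kronecker (snd \<rho> g) (snd \<sigma> g))"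

definition rep_sum :: "'g rep list \<Rightarrow> 'g rep" where
  "rep_sum \<rho>s = (sum_list (map fst \<rho>s), \<lambda>g. diag_block_mat (map (\<lambda>\<rho>. snd \<rho> g) \<rho>s))"

definition complete_irreps :: "('g, 'x) monoid_scheme \<Rightarrow> 'g rep list \<Rightarrow> bool" where
  "complete_irreps G S \<longleftrightarrow>
     (\<forall>\<rho>\<in>set S. irreducible_rep G \<rho>) \<and>
     (\<forall>i<length S. \<forall>j<length S. i \<noteq> j \<longrightarrow> \<not> rep_iso G (S ! i) (S ! j)) \<and>
     (\<forall>\<rho>. irreducible_rep G \<rho> \<longrightarrow> (\<exists>i<length S. rep_iso G \<rho> (S ! i)))"

definition rep_char :: "('g, 'x) monoid_scheme \<Rightarrow> 'g rep \<Rightarrow> 'g \<Rightarrow> complex" where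
  "rep_char G \<rho> = (\<lambda>g\<in>carrier G. \<Sum>i<fst \<rho>. snd \<rho> g $$ (i, i))"

definition irreducible_char :: "('g, 'x) monoid_scheme \<Rightarrow> ('g \<Rightarrow> complex) \<Rightarrow> bool" where
  "irreducible_char G \<chi> \<longleftrightarrow> (\<exists>\<rho>. irreducible_rep G \<rho> \<and> \<chi> = rep_char G \<rho>)"

definition extendible :: "('g, 'x) monoid_scheme \<Rightarrow> 'g set \<Rightarrow> ('g \<Rightarrow> complex) \<Rightarrow> bool" where
  "extendible G N \<chi> \<longleftrightarrow> (\<exists>\<chi>'. irreducible_char G \<chi>' \<and> restrict \<chi>' N = \<chi>)"

text \<open>
  The matrix of multiplicities $a_{i,j}$ in $V \otimes S_i \cong \bigoplus_j a_{i,j} S_j$.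
  If \<open>S\<close> is a complete set of irreducible representations of a finite group, its entries
  below \<open>length S\<close> exist and are unique by Maschke and Krull-Schmidt.
\<close>

definition mckay_mult ::
  "('g, 'x) monoid_scheme \<Rightarrow> 'g rep \<Rightarrow> 'g rep list \<Rightarrow> nat \<Rightarrow> nat \<Rightarrow> nat" where
  "mckay_mult G V S =
     (SOME a. \<forall>i<length S. rep_iso G (rep_tensor V (S ! i))
        (rep_sum (concat (map (\<lambda>j. replicate (a i j) (S ! j)) [0..<length S]))))"

text \<open>
  The isomorphism classes of irreducible representations are represented by the positions in
  the list \<open>S\<close>; the triple \<open>(i, j, k)\<close> is the \<open>k\<close>-th arrow from \<open>i\<close> to \<open>j\<close>. The natural
  representation of \<open>H\<close> on \<open>V\<close> is \<open>(m, \<lambda>h. h)\<close>.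
\<close>

definition mckay_quiver ::
  "nat \<Rightarrow> complex mat set \<Rightarrow> complex mat rep list \<Rightarrow> (nat, nat \<times> nat \<times> nat) pre_digraph" where
  "mckay_quiver m H S =
     \<lparr>verts = {..<length S},
      arcs = {(i, j, k). i < length S \<and> j < length S \<and>
                k < mckay_mult (GL_sub m H) (m, \<lambda>h. h) S i j},
      tail = (\<lambda>(i, j, k). i),
      head = (\<lambda>(i, j, k). j)\<rparr>"

definition quiver_map ::
  "('v, 'a) pre_digraph \<Rightarrow> ('w, 'b) pre_digraph \<Rightarrow> ('v \<Rightarrow> 'w) \<Rightarrow> ('a \<Rightarrow> 'b) \<Rightarrow> bool" where
  "quiver_map Q Q' fv fa \<longleftrightarrow>
     fv \<in> verts Q \<rightarrow> verts Q' \<and> fa \<in> arcs Q \<rightarrow> arcs Q' \<and>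
     (\<forall>e\<in>arcs Q. tail Q' (fa e) = fv (tail Q e) \<and> head Q' (fa e) = fv (head Q e))"

text \<open>
  The group acts on the whole quiver \<open>Q\<close> by automorphisms over \<open>Q'\<close>, and freely and
  transitively on every vertex fibre. Fibres are nonempty, as usual for coverings.
\<close>

definition regular_covering ::
  "('c, 'x) monoid_scheme \<Rightarrow> ('v, 'a) pre_digraph \<Rightarrow> ('w, 'b) pre_digraph \<Rightarrow>
   ('v \<Rightarrow> 'w) \<Rightarrow> ('a \<Rightarrow> 'b) \<Rightarrow> bool" where
  "regular_covering \<Gamma> Q Q' \<pi>v \<pi>a \<longleftrightarrow>
     quiver_map Q Q' \<pi>v \<pi>a \<and> \<pi>v ` verts Q = verts Q' \<and>
     (\<forall>i\<in>verts Q.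
        bij_betw \<pi>a (out_arcs Q i) (out_arcs Q' (\<pi>v i)) \<and>
        bij_betw \<pi>a (in_arcs Q i) (in_arcs Q' (\<pi>v i))) \<and>
     (\<exists>\<phi>v \<phi>a.
        group_action \<Gamma> (verts Q) \<phi>v \<and> group_action \<Gamma> (arcs Q) \<phi>a \<and>
        (\<forall>\<gamma>\<in>carrier \<Gamma>.
           quiver_map Q Q (\<phi>v \<gamma>) (\<phi>a \<gamma>) \<and>
           (\<forall>i\<in>verts Q. \<pi>v (\<phi>v \<gamma> i) = \<pi>v i) \<and>
           (\<forall>e\<in>arcs Q. \<pi>a (\<phi>a \<gamma> e) = \<pi>a e)) \<and>
        (\<forall>j\<in>verts Q'. \<forall>i\<in>{i \<in> verts Q. \<pi>v i = j}.
           orbit \<Gamma> \<phi>v i = {i \<in> verts Q. \<pi>v i = j} \<and>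
           stabilizer \<Gamma> \<phi>v i = {\<one>\<^bsub>\<Gamma>\<^esub>}))"

end

theory Submission
  imports Defs "Jordan_Normal_Form.Spectral_Radius"
begin

text \<open>
  Everything happens at the level of characters. The group \<open>G/N\<close> is cyclic, since the determinant
  identifies it with the \<open>r\<close>-th roots of unity, and its characters are the powers of the
  determinant. For characters \<open>\<chi>\<close>, \<open>\<psi>\<close> of \<open>G\<close> one has
  \<open>(\<Sum>k<r. \<langle>\<chi>, det ^ k \<psi>\<rangle>\<^sub>G) = r \<langle>\<chi>, \<psi>\<rangle>\<^sub>N\<close> for the unnormalised inner products. So, if an irreducible
  constituent of the restriction of \<open>\<chi>\<close> to \<open>N\<close> extends to \<open>\<psi>\<close>, then \<open>\<chi>\<close> is a twist \<open>det ^ k \<psi>\<close>. Hence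
  irreducible characters of \<open>G\<close> restrict irreducibly to \<open>N\<close>, and the fibres of restriction are the
  free orbits under twisting. Twisting preserves the numbers of arrows, and restricting
  \<open>V \<otimes> S\<^sub>i \<cong> \<Oplus>\<^sub>j a\<^sub>i\<^sub>j S\<^sub>j\<close> to \<open>N\<close> shows that the multiplicities for \<open>N\<close> are the fibre sums of those
  for \<open>G\<close>; the covering map on arrows is then the quotient by the free action of \<open>G/N\<close>.
\<close>

section \<open>Linear algebra over the complex numbers\<close>

text \<open>What acts naturally on the fibres is the group of characters of \<open>G/N\<close>,
  whereas the theorem asks for an action of \<open>G/N\<close> itself. The two groups are isomorphic
  only after the choice of a generator. The constant \<open>\<zeta>\<close> and the discrete
  logarithm \<open>dlog\<close> fix this choice, and the symmetric pairing
  \<open>det g ^ dlog h\<close> carries out the identification. Freeness is a counting argument: the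
  unnormalised products of \<open>\<chi>\<close> with its \<open>r\<close> twists are each 0 or
  \<open>card G\<close>, while their sum is \<open>r * card N = card G\<close>, so only the trivial
  twist can fix \<open>\<chi>\<close>. \<open>mckay_mult\<close> is a choice, known only through
  isomorphisms. Multiplicities are therefore compared by expanding one class function in irreducible
  characters in two ways. Equal numbers of arrows give bijections at each vertex separately, but a
  single arrow map has to be bijective on outgoing and on incoming arrows and constant along orbits.
  So only the arrows that start at chosen representatives are numbered, and the numbering is
  transported by the action; freeness makes the transport unique and recovers the tail of an arrow
  from its head.\<close>

lemma subspace_module_vec:
  "VectorSpace.subspace class_ring W (module_vec TYPE(complex) n) \<longleftrightarrow>
   W \<subseteq> carrier_vec n \<and> 0\<^sub>v n \<in> W \<and> (\<forall>v\<in>W. \<forall>w\<in>W. v + w \<in> W) \<and> (\<forall>c. \<forall>w\<in>W. c \<cdot>\<^sub>v w \<in> W)"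
  unfolding VectorSpace.subspace_def submodule_def
  using vec_vs[of n, where 'a=complex] vec_module[of n, where 'a=complex]
  by (auto simp: module_vec_simps class_ring_simps)

lemma carrier_GL: "P \<in> carrier (GL n) \<longleftrightarrow> P \<in> carrier_mat n n \<and> det P \<noteq> 0"
  using unit_imp_det_non_zero[of P n "()"] det_non_zero_imp_unit[of P n "()"]
  by (auto simp: GL_def units_of_def Units_def ring_mat_def)

lemma GL_simps: "monoid.mult (GL n) = (*)" "one (GL n) = 1\<^sub>m n"
  by (auto simp: GL_def units_of_def ring_mat_def)

lemma group_GL: "group (GL n)"
  unfolding GL_def by (intro monoid.units_group ring.is_monoid ring_mat)

lemma GL_inverseE:
  assumes "P \<in> carrier (GL n)"
  obtains Q where "Q \<in> carrier (GL n)" "Q \<in> carrier_mat n n" "P * Q = 1\<^sub>m n" "Q * P = 1\<^sub>m n"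
proof -
  interpret group "GL n" by (rule group_GL)
  have "inv\<^bsub>GL n\<^esub> P \<in> carrier (GL n)" "P * inv\<^bsub>GL n\<^esub> P = 1\<^sub>m n" "inv\<^bsub>GL n\<^esub> P * P = 1\<^sub>m n"
    using assms r_inv[of P] l_inv[of P] by (auto simp: GL_simps)
  then show thesis using that carrier_GL by blast
qed

lemma GL_I:
  assumes "P \<in> carrier_mat n n" "Q \<in> carrier_mat n n" "P * Q = 1\<^sub>m n"
  shows "P \<in> carrier (GL n)"
  using det_mult[OF assms(1,2)] assms by (auto simp: carrier_GL)

lemma GL_injective_iff:
  assumes "P \<in> carrier_mat n n"
  shows "P \<in> carrier (GL n) \<longleftrightarrow> (\<forall>v\<in>carrier_vec n. P *\<^sub>v v = 0\<^sub>v n \<longrightarrow> v = 0\<^sub>v n)"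
  using det_0_iff_vec_prod_zero[OF assms] assms by (auto simp: carrier_GL)

text \<open>Padding with zero rows gives a square matrix of determinant zero with the same kernel.
  This takes the place of a dimension count.\<close>

lemma exists_kernel_vector:
  fixes A :: "complex mat"
  assumes A: "A \<in> carrier_mat n k" and "n < k"
  shows "\<exists>v\<in>carrier_vec k. v \<noteq> 0\<^sub>v k \<and> A *\<^sub>v v = 0\<^sub>v n"
proof -
  define B where "B = mat k k (\<lambda>(i, j). if i < n then A $$ (i, j) else 0)"
  have B: "B \<in> carrier_mat k k" by (auto simp: B_def)
  \<comment> \<open>Row \<open>n\<close> exists because \<open>n < k\<close>, and it is a padding
    row; the equation puts \<open>B\<close> into the shape that \<open>det_row_0\<close>
    expects.\<close>
  have "B = mat\<^sub>r k k (\<lambda>i. if i = n then 0\<^sub>v k else row B i)"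
    using assms by (intro eq_matI) (auto simp: B_def mat_of_row_def)
  also have "det \<dots> = 0"
    by (rule det_row_0[OF assms(2)]) (use B in auto)
  finally obtain v where v: "v \<in> carrier_vec k" "v \<noteq> 0\<^sub>v k" "B *\<^sub>v v = 0\<^sub>v k"
    using det_0_iff_vec_prod_zero[OF B] by auto
  have "A *\<^sub>v v = 0\<^sub>v n"
  proof (rule eq_vecI)
    fix i assume "i < dim_vec (0\<^sub>v n :: complex vec)"
    then have i: "i < n" by simp
    have "row B i = row A i" using i assms by (intro eq_vecI) (auto simp: B_def)
    moreover have "(B *\<^sub>v v) $ i = 0" using v i assms(2) by simp
    ultimately show "(A *\<^sub>v v) $ i = 0\<^sub>v n $ i" using i A B assms(2) by simp
  qed (use A in auto)
  with v show ?thesis by blast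
qed

text \<open>That the matrix is square comes from applying the kernel argument twice. A wide matrix
  is not injective; for a tall one the transpose has a kernel vector, which is orthogonal to the
  image and hence, by surjectivity, to everything.\<close>

lemma GL_of_bijective:
  fixes A :: "complex mat"
  assumes A: "A \<in> carrier_mat n k"
    and inj: "\<And>v. v \<in> carrier_vec k \<Longrightarrow> A *\<^sub>v v = 0\<^sub>v n \<Longrightarrow> v = 0\<^sub>v k"
    and surj: "\<And>w. w \<in> carrier_vec n \<Longrightarrow> \<exists>v\<in>carrier_vec k. A *\<^sub>v v = w"
  shows "n = k" "A \<in> carrier (GL k)"
proof -
  have "k \<le> n" using exists_kernel_vector[OF A] inj by (meson not_le)
  moreover have "n \<le> k"
  proof (rule ccontr)
    assume "\<not> n \<le> k"
    then obtain y where y: "y \<in> carrier_vec n" "y \<noteq> 0\<^sub>v n" "transpose_mat A *\<^sub>v y = 0\<^sub>v k"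
      using exists_kernel_vector[of "transpose_mat A" k n] A by auto
    have "y \<bullet> w = 0" if w: "w \<in> carrier_vec n" for w
    proof -
      obtain v where v: "v \<in> carrier_vec k" "A *\<^sub>v v = w" using surj[OF w] by blast
      have "y \<bullet> w = (transpose_mat A *\<^sub>v y) \<bullet> v"
        using transpose_vec_mult_scalar[OF A v(1) y(1)] v y by simp
      then show ?thesis using y v by simp
    qed
    then have "y $ i = 0" if "i < n" for i
      using that y scalar_prod_right_unit[of i n y] unit_vec_carrier by metis
    then have "y = 0\<^sub>v n" using y by (intro eq_vecI) auto
    with y show False by simp
  qed
  ultimately show nk: "n = k" by simp
  show "A \<in> carrier (GL k)"
    using GL_injective_iff[of A k] A inj unfolding nk by blast
qed

text \<open>Steinitz exchange in matrix form: the vector with coordinates \<open>y\<close> enters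
  the basis \<open>P\<close> at position \<open>k\<close>, while the first \<open>k\<close> basis
  vectors stay in place.\<close>

lemma adapted_basis_step:
  fixes P :: "complex mat"
  assumes P: "P \<in> carrier (GL n)" and y: "y \<in> carrier_vec n" and i: "k \<le> i" "i < n" "y $ i \<noteq> 0"
  shows "\<exists>P'\<in>carrier (GL n). \<forall>x\<in>carrier_vec n. (\<forall>j. Suc k \<le> j \<longrightarrow> j < n \<longrightarrow> x $ j = 0) \<longrightarrow>
    P' *\<^sub>v x = P *\<^sub>v vec n (\<lambda>j. if j < k then x $ j else 0) + x $ k \<cdot>\<^sub>v (P *\<^sub>v y)"
proof -
  \<comment> \<open>Column \<open>k\<close> is \<open>y\<close>, the displaced unit vector
    \<open>k\<close> moves to column \<open>i\<close>, and all other columns are those of the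
    identity. The pivot \<open>y $ i \<noteq> 0\<close> makes this invertible.\<close>
  define M where "M = mat n n (\<lambda>(l, j). if j = k then y $ l
    else if j = i then (if l = k then 1 else 0) else if l = j then 1 else 0)"
  have M: "M \<in> carrier_mat n n" by (simp add: M_def)
  have Pc: "P \<in> carrier_mat n n" using P carrier_GL by auto
  have Mx: "(M *\<^sub>v x) $ l = x $ k * y $ l +
      (if l = k then (if i = k then 0 else x $ i) else if l = i then 0 else x $ l)"
    if x: "x \<in> carrier_vec n" and l: "l < n" for x l
  proof -
    have "(M *\<^sub>v x) $ l = (\<Sum>j<n. M $$ (l, j) * x $ j)"
      using x l M by (simp add: scalar_prod_def lessThan_atLeast0)
    also have "\<dots> = (\<Sum>j<n. (if j = k then y $ l * x $ k else 0)
       + (if j = i then (if i \<noteq> k \<and> l = k then x $ i else 0) else 0)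
       + (if j = l then (if l \<noteq> k \<and> l \<noteq> i then x $ l else 0) else 0))"
      using l by (intro sum.cong) (auto simp: M_def)
    also have "\<dots> = x $ k * y $ l +
      (if l = k then (if i = k then 0 else x $ i) else if l = i then 0 else x $ l)"
      using l i by (simp add: sum.distrib)
    finally show ?thesis .
  qed
  have "x = 0\<^sub>v n" if x: "x \<in> carrier_vec n" "M *\<^sub>v x = 0\<^sub>v n" for x
  proof -
    have z: "x $ k * y $ l +
      (if l = k then (if i = k then 0 else x $ i) else if l = i then 0 else x $ l) = 0"
      if "l < n" for l using Mx[OF x(1) that] x(2) that by simp
    have xk: "x $ k = 0" using z[of i] i by (auto split: if_splits)
    have "x $ l = 0" if "l < n" for l
      using z[OF that] z[of k] xk i that by (auto split: if_splits)
    then show ?thesis using x by (intro eq_vecI) auto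
  qed
  then have "M \<in> carrier (GL n)" using GL_injective_iff[OF M] by blast
  then have "P * M \<in> carrier (GL n)" using P M Pc by (simp add: carrier_GL det_mult)
  moreover have "(P * M) *\<^sub>v x = P *\<^sub>v vec n (\<lambda>j. if j < k then x $ j else 0) + x $ k \<cdot>\<^sub>v (P *\<^sub>v y)"
    if x: "x \<in> carrier_vec n" "\<forall>j. Suc k \<le> j \<longrightarrow> j < n \<longrightarrow> x $ j = 0" for x
  proof -
    have "M *\<^sub>v x = vec n (\<lambda>j. if j < k then x $ j else 0) + x $ k \<cdot>\<^sub>v y"
    proof (rule eq_vecI)
      fix l assume "l < dim_vec (vec n (\<lambda>j. if j < k then x $ j else 0) + x $ k \<cdot>\<^sub>v y)"
      then have l: "l < n" using y by simp
      show "(M *\<^sub>v x) $ l = (vec n (\<lambda>j. if j < k then x $ j else 0) + x $ k \<cdot>\<^sub>v y) $ l"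
        using Mx[OF x(1) l] x(2) i l y by (auto simp: not_less)
    qed (use M y in auto)
    moreover have "(P * M) *\<^sub>v x = P *\<^sub>v (M *\<^sub>v x)"
      using Pc M x by (intro assoc_mult_mat_vec) auto
    ultimately show ?thesis
      using Pc y by (simp add: mult_add_distrib_mat_vec[of _ n n] mult_mat_vec)
  qed
  ultimately show ?thesis by blast
qed

text \<open>Choose \<open>k\<close> maximal such that some invertible \<open>P\<close> sends all
  vectors supported on the first \<open>k\<close> coordinates into \<open>W\<close>. A vector of
  \<open>W\<close> with a nonzero coordinate from position \<open>k\<close> on could be exchanged
  into the basis, against maximality.\<close>

lemma adapted_basis:
  assumes W: "VectorSpace.subspace class_ring W (module_vec TYPE(complex) n)"
  obtains k P where "k \<le> n" "P \<in> carrier (GL n)"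
    "W = {P *\<^sub>v x | x. x \<in> carrier_vec n \<and> (\<forall>j. k \<le> j \<longrightarrow> j < n \<longrightarrow> x $ j = 0)}"
proof -
  note W' = W[unfolded subspace_module_vec]
  define adapted where "adapted k P \<longleftrightarrow> P \<in> carrier (GL n) \<and>
    (\<forall>x\<in>carrier_vec n. (\<forall>j. k \<le> j \<longrightarrow> j < n \<longrightarrow> x $ j = 0) \<longrightarrow> P *\<^sub>v x \<in> W)" for k P
  have "adapted 0 (1\<^sub>m n)"
  proof -
    have "x = 0\<^sub>v n" if "x \<in> carrier_vec n" "\<forall>j<n. x $ j = 0" for x :: "complex vec"
      using that by (intro eq_vecI) auto
    then have "1\<^sub>m n *\<^sub>v x \<in> W" if "x \<in> carrier_vec n" "\<forall>j. 0 \<le> j \<longrightarrow> j < n \<longrightarrow> x $ j = 0" for x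
      using W' that by fastforce
    then show ?thesis by (auto simp: adapted_def carrier_GL)
  qed
  then have "\<exists>k. (k \<le> n \<and> (\<exists>P. adapted k P)) \<and> (\<forall>k'. (k' \<le> n \<and> (\<exists>P. adapted k' P)) \<longrightarrow> k' \<le> k)"
    by (intro Nat.ex_has_greatest_nat[of _ 0 n]) auto
  then obtain k P where k: "k \<le> n" and P: "adapted k P"
    and max: "\<And>k' P'. k' \<le> n \<Longrightarrow> adapted k' P' \<Longrightarrow> k' \<le> k" by blast
  have PG: "P \<in> carrier (GL n)" using P by (simp add: adapted_def)
  have "w \<in> {P *\<^sub>v x | x. x \<in> carrier_vec n \<and> (\<forall>j. k \<le> j \<longrightarrow> j < n \<longrightarrow> x $ j = 0)}"
    if w: "w \<in> W" for w
  proof -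
    obtain Q where Q: "Q \<in> carrier_mat n n" "P * Q = 1\<^sub>m n" using PG by (rule GL_inverseE)
    have wc: "w \<in> carrier_vec n" using w W' by auto
    have Pc: "P \<in> carrier_mat n n" using PG carrier_GL by auto
    define y where "y = Q *\<^sub>v w"
    have y: "y \<in> carrier_vec n" "P *\<^sub>v y = w"
      using Q wc assoc_mult_mat_vec[OF Pc Q(1) wc] by (simp_all add: y_def)
    have "y $ i = 0" if i: "k \<le> i" "i < n" for i
    proof (rule ccontr)
      assume "y $ i \<noteq> 0"
      from adapted_basis_step[OF PG y(1) i this] obtain P' where P': "P' \<in> carrier (GL n)"
        "\<forall>x\<in>carrier_vec n. (\<forall>j. Suc k \<le> j \<longrightarrow> j < n \<longrightarrow> x $ j = 0) \<longrightarrow>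
          P' *\<^sub>v x = P *\<^sub>v vec n (\<lambda>j. if j < k then x $ j else 0) + x $ k \<cdot>\<^sub>v w"
        unfolding y(2) by blast
      have "P *\<^sub>v vec n (\<lambda>j. if j < k then x $ j else 0) \<in> W" for x
        using P by (auto simp: adapted_def)
      moreover have "c \<cdot>\<^sub>v w \<in> W" for c using W' w by simp
      ultimately have "P *\<^sub>v vec n (\<lambda>j. if j < k then x $ j else 0) + x $ k \<cdot>\<^sub>v w \<in> W" for x
        using W' by simp
      then have "adapted (Suc k) P'" unfolding adapted_def using P' by simp
      from max[OF _ this] i show False by simp
    qed
    with y show ?thesis by blast
  qed
  moreover have "{P *\<^sub>v x | x. x \<in> carrier_vec n \<and> (\<forall>j. k \<le> j \<longrightarrow> j < n \<longrightarrow> x $ j = 0)} \<subseteq> W"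
    using P by (auto simp: adapted_def)
  ultimately show thesis using that[OF k PG] by blast
qed

section \<open>Matrix representations\<close>

text \<open>Invertibility of the matrices is automatic, with the value at \<open>inv g\<close> as
  the inverse, so representations can be checked without determinants.\<close>

lemma representation_iff:
  assumes "group H"
  shows "representation H \<rho> \<longleftrightarrow>
    (\<forall>g\<in>carrier H. snd \<rho> g \<in> carrier_mat (fst \<rho>) (fst \<rho>)) \<and>
    (\<forall>g\<in>carrier H. \<forall>h\<in>carrier H. snd \<rho> (g \<otimes>\<^bsub>H\<^esub> h) = snd \<rho> g * snd \<rho> h) \<and>
    snd \<rho> \<one>\<^bsub>H\<^esub> = 1\<^sub>m (fst \<rho>)" (is "_ \<longleftrightarrow> ?R")
proof
  assume "representation H \<rho>"
  then interpret group_hom H "GL (fst \<rho>)" "snd \<rho>"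
    using assms group_GL by (simp add: representation_def group_hom_def group_hom_axioms_def)
  show ?R using hom_closed hom_mult hom_one by (simp add: carrier_GL GL_simps)
next
  interpret group H by fact
  assume R: ?R
  have "snd \<rho> g \<in> carrier (GL (fst \<rho>))" if "g \<in> carrier H" for g
    using that R r_inv[OF that] inv_closed[OF that]
    by (intro GL_I[of _ _ "snd \<rho> (inv\<^bsub>H\<^esub> g)"]) metis+
  then show "representation H \<rho>"
    using R by (auto simp: representation_def hom_def GL_simps)
qed

lemma
  assumes "group H" "representation H \<rho>"
  shows representation_closed: "\<And>g. g \<in> carrier H \<Longrightarrow> snd \<rho> g \<in> carrier_mat (fst \<rho>) (fst \<rho>)"
    and representation_mult: "\<And>g h. g \<in> carrier H \<Longrightarrow> h \<in> carrier H \<Longrightarrow>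
      snd \<rho> (g \<otimes>\<^bsub>H\<^esub> h) = snd \<rho> g * snd \<rho> h"
    and representation_one: "snd \<rho> \<one>\<^bsub>H\<^esub> = 1\<^sub>m (fst \<rho>)"
  using assms representation_iff by blast+

lemma representation_inv:
  assumes "group H" "representation H \<rho>" "g \<in> carrier H"
  shows "snd \<rho> g * snd \<rho> (inv\<^bsub>H\<^esub> g) = 1\<^sub>m (fst \<rho>)" "snd \<rho> (inv\<^bsub>H\<^esub> g) * snd \<rho> g = 1\<^sub>m (fst \<rho>)"
  using representation_mult[OF assms(1,2)] representation_one[OF assms(1,2)] assms
  by (metis group.inv_closed group.r_inv, metis group.inv_closed group.l_inv)

lemma rep_iso_refl:
  assumes "group H" "representation H \<rho>"
  shows "rep_iso H \<rho> \<rho>"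
  unfolding rep_iso_def
  using representation_closed[OF assms]
  by (intro conjI refl bexI[of _ "1\<^sub>m (fst \<rho>)"] ballI)
    (fastforce simp: carrier_GL)+

lemma rep_iso_sym:
  assumes "group H" "representation H \<rho>" "representation H \<sigma>" "rep_iso H \<rho> \<sigma>"
  shows "rep_iso H \<sigma> \<rho>"
proof -
  obtain P where d: "fst \<rho> = fst \<sigma>" and P: "P \<in> carrier (GL (fst \<rho>))"
    "\<And>g. g \<in> carrier H \<Longrightarrow> P * snd \<rho> g = snd \<sigma> g * P"
    using assms(4) by (auto simp: rep_iso_def)
  let ?d = "fst \<sigma>"
  obtain Q where Q: "Q \<in> carrier (GL (fst \<rho>))" "P * Q = 1\<^sub>m (fst \<rho>)" "Q * P = 1\<^sub>m (fst \<rho>)"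
    using P(1) by (rule GL_inverseE)
  have c: "P \<in> carrier_mat ?d ?d" "Q \<in> carrier_mat ?d ?d" using P Q d by (auto simp: carrier_GL)
  have "Q * snd \<sigma> g = snd \<rho> g * Q" if g: "g \<in> carrier H" for g
  proof -
    have s: "snd \<sigma> g \<in> carrier_mat ?d ?d" "snd \<rho> g \<in> carrier_mat ?d ?d"
      using representation_closed[OF assms(1,2) g] representation_closed[OF assms(1,3) g] d by auto
    have "Q * snd \<sigma> g = Q * snd \<sigma> g * (P * Q)" using Q s c d by simp
    also have "\<dots> = Q * (snd \<sigma> g * P) * Q"
      using s c by (simp add: assoc_mult_mat[of _ ?d ?d _ ?d _ ?d])
    also have "\<dots> = (Q * P) * snd \<rho> g * Q"
      using s c P(2)[OF g, symmetric] by (simp add: assoc_mult_mat[of _ ?d ?d _ ?d _ ?d])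
    finally show ?thesis using Q s c d by simp
  qed
  then show ?thesis using d Q by (auto simp: rep_iso_def)
qed

lemma rep_iso_trans:
  assumes "group H" "representation H \<rho>" "representation H \<sigma>" "representation H \<tau>"
    "rep_iso H \<rho> \<sigma>" "rep_iso H \<sigma> \<tau>"
  shows "rep_iso H \<rho> \<tau>"
proof -
  let ?d = "fst \<rho>"
  obtain P where d: "fst \<sigma> = ?d" and P: "P \<in> carrier (GL ?d)"
    "\<And>g. g \<in> carrier H \<Longrightarrow> P * snd \<rho> g = snd \<sigma> g * P"
    using assms(5) by (auto simp: rep_iso_def)
  obtain Q where d': "fst \<tau> = ?d" and Q: "Q \<in> carrier (GL ?d)"
    "\<And>g. g \<in> carrier H \<Longrightarrow> Q * snd \<sigma> g = snd \<tau> g * Q"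
    using assms(6) d by (auto simp: rep_iso_def)
  have c: "P \<in> carrier_mat ?d ?d" "Q \<in> carrier_mat ?d ?d" using P Q by (auto simp: carrier_GL)
  have "Q * P * snd \<rho> g = snd \<tau> g * (Q * P)" if g: "g \<in> carrier H" for g
  proof -
    have s: "snd \<sigma> g \<in> carrier_mat ?d ?d" "snd \<rho> g \<in> carrier_mat ?d ?d" "snd \<tau> g \<in> carrier_mat ?d ?d"
      using representation_closed[OF assms(1,2) g] representation_closed[OF assms(1,3) g]
        representation_closed[OF assms(1,4) g] d d' by auto
    have "Q * P * snd \<rho> g = (Q * snd \<sigma> g) * P"
      using s c P(2)[OF g] by (simp add: assoc_mult_mat[of _ ?d ?d _ ?d _ ?d])
    also have "\<dots> = snd \<tau> g * (Q * P)"
      unfolding Q(2)[OF g] using s c by (simp add: assoc_mult_mat[of _ ?d ?d _ ?d _ ?d])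
    finally show ?thesis .
  qed
  moreover have "Q * P \<in> carrier (GL ?d)" using P Q by (auto simp: carrier_GL det_mult)
  ultimately show ?thesis using d' by (auto simp: rep_iso_def)
qed

text \<open>The zero blocks take their sizes from the matrices and not from the degrees, as in
  \<open>diag_block_mat\<close>. Hence \<open>rep_sum_Cons\<close> is an equation between functions,
  valid outside the carrier as well.\<close>

definition rep_dsum :: "'g rep \<Rightarrow> 'g rep \<Rightarrow> 'g rep" where
  "rep_dsum \<rho> \<sigma> = (fst \<rho> + fst \<sigma>, \<lambda>g. four_block_mat
     (snd \<rho> g) (0\<^sub>m (dim_row (snd \<rho> g)) (dim_col (snd \<sigma> g)))
     (0\<^sub>m (dim_row (snd \<sigma> g)) (dim_col (snd \<rho> g))) (snd \<sigma> g))"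

lemma rep_sum_Nil: "rep_sum [] = (0, \<lambda>g. 0\<^sub>m 0 0)"
  by (simp add: rep_sum_def)

lemma rep_sum_Cons: "rep_sum (\<rho> # \<rho>s) = rep_dsum \<rho> (rep_sum \<rho>s)"
  by (simp add: rep_sum_def rep_dsum_def Let_def)

lemma rep_sum_append: "rep_sum (\<rho>s @ \<sigma>s) = rep_dsum (rep_sum \<rho>s) (rep_sum \<sigma>s)"
  by (simp add: rep_sum_def rep_dsum_def diag_block_mat_append Let_def)

lemma fst_rep_dsum [simp]: "fst (rep_dsum \<rho> \<sigma>) = fst \<rho> + fst \<sigma>"
  by (simp add: rep_dsum_def)

lemma snd_rep_dsum:
  assumes "group H" "representation H \<rho>" "representation H \<sigma>" "g \<in> carrier H"
  shows "snd (rep_dsum \<rho> \<sigma>) g = four_block_mat (snd \<rho> g) (0\<^sub>m (fst \<rho>) (fst \<sigma>))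
     (0\<^sub>m (fst \<sigma>) (fst \<rho>)) (snd \<sigma> g)"
  using representation_closed[OF assms(1,2,4)] representation_closed[OF assms(1,3,4)]
  by (simp add: rep_dsum_def)

lemma representation_dsum:
  assumes "group H" "representation H \<rho>" "representation H \<sigma>"
  shows "representation H (rep_dsum \<rho> \<sigma>)"
proof -
  interpret group H by fact
  note c = representation_closed[OF assms(1,2)] representation_closed[OF assms(1,3)]
  note m = representation_mult[OF assms(1,2)] representation_mult[OF assms(1,3)]
  note o = representation_one[OF assms(1,2)] representation_one[OF assms(1,3)]
  show ?thesis unfolding representation_iff[OF assms(1)]
  proof (intro conjI ballI)
    fix g h assume gh: "g \<in> carrier H" "h \<in> carrier H"
    show "snd (rep_dsum \<rho> \<sigma>) g \<in> carrier_mat (fst (rep_dsum \<rho> \<sigma>)) (fst (rep_dsum \<rho> \<sigma>))"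
      unfolding snd_rep_dsum[OF assms gh(1)] using c[OF gh(1)] by simp
    show "snd (rep_dsum \<rho> \<sigma>) (g \<otimes>\<^bsub>H\<^esub> h) = snd (rep_dsum \<rho> \<sigma>) g * snd (rep_dsum \<rho> \<sigma>) h"
      using gh c[OF gh(1)] c[OF gh(2)]
      by (simp add: snd_rep_dsum[OF assms] m mult_four_block_mat[of _ "fst \<rho>" "fst \<rho>" _ "fst \<sigma>" _ "fst \<sigma>" _ _ "fst \<rho>" _ "fst \<sigma>"])
  next
    show "snd (rep_dsum \<rho> \<sigma>) \<one>\<^bsub>H\<^esub> = 1\<^sub>m (fst (rep_dsum \<rho> \<sigma>))"
      by (simp add: snd_rep_dsum[OF assms] o)
  qed
qed

lemma representation_sum:
  assumes "group H" "\<And>\<rho>. \<rho> \<in> set \<rho>s \<Longrightarrow> representation H \<rho>"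
  shows "representation H (rep_sum \<rho>s)"
  using assms(2)
proof (induction \<rho>s)
  case Nil
  show ?case unfolding representation_iff[OF assms(1)] by (auto simp: rep_sum_Nil)
next
  case (Cons \<rho> \<rho>s)
  then show ?case by (simp add: rep_sum_Cons representation_dsum assms(1))
qed

lemma rep_iso_dsum:
  assumes "group H" "representation H \<rho>" "representation H \<sigma>" "representation H \<rho>'" "representation H \<sigma>'"
    "rep_iso H \<rho> \<rho>'" "rep_iso H \<sigma> \<sigma>'"
  shows "rep_iso H (rep_dsum \<rho> \<sigma>) (rep_dsum \<rho>' \<sigma>')"
proof -
  let ?a = "fst \<rho>" and ?b = "fst \<sigma>"
  obtain P where d: "fst \<rho>' = ?a" and P: "P \<in> carrier (GL ?a)"
    "\<And>g. g \<in> carrier H \<Longrightarrow> P * snd \<rho> g = snd \<rho>' g * P"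
    using assms(6) by (auto simp: rep_iso_def)
  obtain Q where d': "fst \<sigma>' = ?b" and Q: "Q \<in> carrier (GL ?b)"
    "\<And>g. g \<in> carrier H \<Longrightarrow> Q * snd \<sigma> g = snd \<sigma>' g * Q"
    using assms(7) by (auto simp: rep_iso_def)
  obtain P' where P': "P' \<in> carrier_mat ?a ?a" "P * P' = 1\<^sub>m ?a" using P(1) by (rule GL_inverseE)
  obtain Q' where Q': "Q' \<in> carrier_mat ?b ?b" "Q * Q' = 1\<^sub>m ?b" using Q(1) by (rule GL_inverseE)
  have c: "P \<in> carrier_mat ?a ?a" "Q \<in> carrier_mat ?b ?b" using P Q by (auto simp: carrier_GL)
  define R where "R = four_block_mat P (0\<^sub>m ?a ?b) (0\<^sub>m ?b ?a) Q"
  note mult = mult_four_block_mat[of _ ?a ?a _ ?b _ ?b _ _ ?a _ ?b]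
  have "R \<in> carrier (GL (?a + ?b))"
  proof (rule GL_I)
    show "R * four_block_mat P' (0\<^sub>m ?a ?b) (0\<^sub>m ?b ?a) Q' = 1\<^sub>m (?a + ?b)"
      unfolding R_def using c P' Q' by (simp add: mult)
  qed (use c P' Q' in \<open>auto simp: R_def\<close>)
  moreover have "R * snd (rep_dsum \<rho> \<sigma>) g = snd (rep_dsum \<rho>' \<sigma>') g * R" if g: "g \<in> carrier H" for g
    using c d d' P(2)[OF g] Q(2)[OF g] representation_closed[OF assms(1,2) g] representation_closed[OF assms(1,3) g]
      representation_closed[OF assms(1,4) g] representation_closed[OF assms(1,5) g]
    by (simp add: snd_rep_dsum[OF assms(1,2,3) g] snd_rep_dsum[OF assms(1,4,5) g] R_def mult)
  ultimately show ?thesis using d d' by (auto simp: rep_iso_def)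
qed

lemma rep_iso_dsum_commute:
  assumes "group H" "representation H \<rho>" "representation H \<sigma>"
  shows "rep_iso H (rep_dsum \<rho> \<sigma>) (rep_dsum \<sigma> \<rho>)"
proof -
  let ?a = "fst \<rho>" and ?b = "fst \<sigma>"
  \<comment> \<open>\<open>R b a\<close> is the block permutation that sends a pair of vectors of
    sizes \<open>a\<close> and \<open>b\<close> to the swapped pair; \<open>R a b\<close> undoes
    it.\<close>
  define R :: "nat \<Rightarrow> nat \<Rightarrow> complex mat"
    where "R = (\<lambda>a b. four_block_mat (0\<^sub>m a b) (1\<^sub>m a) (1\<^sub>m b) (0\<^sub>m b a))"
  have R: "R a b \<in> carrier_mat (a + b) (a + b)" for a b
    by (auto simp: R_def)
  have "R ?b ?a * R ?a ?b = 1\<^sub>m (?a + ?b)"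
    unfolding R_def by (subst mult_four_block_mat[of _ ?b ?a _ ?b _ ?a _ _ ?b _ ?a]) (auto simp: add.commute)
  then have "R ?b ?a \<in> carrier (GL (?a + ?b))"
    using R[of ?b ?a] R[of ?a ?b] by (intro GL_I[of _ _ "R ?a ?b"]) (auto simp: add.commute)
  moreover have "R ?b ?a * snd (rep_dsum \<rho> \<sigma>) g = snd (rep_dsum \<sigma> \<rho>) g * R ?b ?a"
    if g: "g \<in> carrier H" for g
  proof -
    note c = representation_closed[OF assms(1,2) g] representation_closed[OF assms(1,3) g]
    show ?thesis
      unfolding snd_rep_dsum[OF assms(1,2,3) g] snd_rep_dsum[OF assms(1,3,2) g] R_def
      using c by (subst (1 2) mult_four_block_mat) auto
  qed
  ultimately show ?thesis by (auto simp: rep_iso_def add.commute)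
qed

text \<open>Matrices of all sizes share one type, so a sum, in particular an empty one, has no size
  of its own; the dimensions are therefore arguments.\<close>

definition mat_sum :: "nat \<Rightarrow> nat \<Rightarrow> ('a \<Rightarrow> complex mat) \<Rightarrow> 'a set \<Rightarrow> complex mat" where
  "mat_sum n k f A = mat n k (\<lambda>ij. \<Sum>a\<in>A. f a $$ ij)"

lemma mat_sum_carrier [simp]: "mat_sum n k f A \<in> carrier_mat n k"
  by (simp add: mat_sum_def)

lemma mat_sum_index: "i < n \<Longrightarrow> j < k \<Longrightarrow> mat_sum n k f A $$ (i, j) = (\<Sum>a\<in>A. f a $$ (i, j))"
  by (simp add: mat_sum_def)

lemma mat_sum_cong: "(\<And>a. a \<in> A \<Longrightarrow> f a = g a) \<Longrightarrow> mat_sum n k f A = mat_sum n k g A"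
  by (simp add: mat_sum_def cong: sum.cong)

lemma mult_mat_sum:
  assumes X: "X \<in> carrier_mat l n" and f: "\<And>a. a \<in> A \<Longrightarrow> f a \<in> carrier_mat n k"
  shows "X * mat_sum n k f A = mat_sum l k (\<lambda>a. X * f a) A"
proof (rule eq_matI)
  fix i j assume "i < dim_row (mat_sum l k (\<lambda>a. X * f a) A)" "j < dim_col (mat_sum l k (\<lambda>a. X * f a) A)"
  then have ij: "i < l" "j < k" by (simp_all add: mat_sum_def)
  have "(X * mat_sum n k f A) $$ (i, j) = (\<Sum>r<n. X $$ (i, r) * (\<Sum>a\<in>A. f a $$ (r, j)))"
    using ij X by (simp add: scalar_prod_def mat_sum_def lessThan_atLeast0)
  also have "\<dots> = (\<Sum>a\<in>A. \<Sum>r<n. X $$ (i, r) * f a $$ (r, j))"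
    unfolding sum_distrib_left by (rule sum.swap)
  also have "\<dots> = (\<Sum>a\<in>A. (X * f a) $$ (i, j))"
    using ij X f by (intro sum.cong) (fastforce simp: scalar_prod_def lessThan_atLeast0)+
  finally show "(X * mat_sum n k f A) $$ (i, j) = mat_sum l k (\<lambda>a. X * f a) A $$ (i, j)"
    using ij by (simp add: mat_sum_index)
qed (use X in \<open>auto simp: mat_sum_def\<close>)

lemma mat_sum_mult:
  assumes X: "X \<in> carrier_mat k l" and f: "\<And>a. a \<in> A \<Longrightarrow> f a \<in> carrier_mat n k"
  shows "mat_sum n k f A * X = mat_sum n l (\<lambda>a. f a * X) A"
proof (rule eq_matI)
  fix i j assume "i < dim_row (mat_sum n l (\<lambda>a. f a * X) A)" "j < dim_col (mat_sum n l (\<lambda>a. f a * X) A)"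
  then have ij: "i < n" "j < l" by (simp_all add: mat_sum_def)
  have "(mat_sum n k f A * X) $$ (i, j) = (\<Sum>r<k. (\<Sum>a\<in>A. f a $$ (i, r)) * X $$ (r, j))"
    using ij X by (simp add: scalar_prod_def mat_sum_def lessThan_atLeast0)
  also have "\<dots> = (\<Sum>a\<in>A. \<Sum>r<k. f a $$ (i, r) * X $$ (r, j))"
    unfolding sum_distrib_right by (rule sum.swap)
  also have "\<dots> = (\<Sum>a\<in>A. (f a * X) $$ (i, j))"
    using ij X f by (intro sum.cong) (fastforce simp: scalar_prod_def lessThan_atLeast0)+
  finally show "(mat_sum n k f A * X) $$ (i, j) = mat_sum n l (\<lambda>a. f a * X) A $$ (i, j)"
    using ij by (simp add: mat_sum_index)
qed (use X in \<open>auto simp: mat_sum_def\<close>)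

lemma mat_sum_reindex:
  assumes "bij_betw \<pi> B A"
  shows "mat_sum n k f A = mat_sum n k (\<lambda>b. f (\<pi> b)) B"
  unfolding mat_sum_def
  using sum.reindex_bij_betw[OF assms, of "\<lambda>a. f a $$ _"] by (intro cong_mat) auto

section \<open>Schur's lemma and orthogonality of characters\<close>

definition intertwiner :: "('g, 'x) monoid_scheme \<Rightarrow> 'g rep \<Rightarrow> 'g rep \<Rightarrow> complex mat \<Rightarrow> bool" where
  "intertwiner H \<rho> \<sigma> X \<longleftrightarrow> X \<in> carrier_mat (fst \<sigma>) (fst \<rho>) \<and>
     (\<forall>g\<in>carrier H. X * snd \<rho> g = snd \<sigma> g * X)"

lemma irreducible_repD:
  assumes "irreducible_rep H \<rho>"
  shows "representation H \<rho>" "fst \<rho> > 0"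
    and "\<lbrakk>W \<subseteq> carrier_vec (fst \<rho>); 0\<^sub>v (fst \<rho>) \<in> W; \<And>v w. v \<in> W \<Longrightarrow> w \<in> W \<Longrightarrow> v + w \<in> W;
      \<And>c w. w \<in> W \<Longrightarrow> c \<cdot>\<^sub>v w \<in> W; \<And>g w. g \<in> carrier H \<Longrightarrow> w \<in> W \<Longrightarrow> snd \<rho> g *\<^sub>v w \<in> W\<rbrakk>
      \<Longrightarrow> W = {0\<^sub>v (fst \<rho>)} \<or> W = carrier_vec (fst \<rho>)"
proof -
  show "representation H \<rho>" "fst \<rho> > 0" using assms by (simp_all add: irreducible_rep_def)
  assume "W \<subseteq> carrier_vec (fst \<rho>)" "0\<^sub>v (fst \<rho>) \<in> W" "\<And>v w. v \<in> W \<Longrightarrow> w \<in> W \<Longrightarrow> v + w \<in> W"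
    "\<And>c w. w \<in> W \<Longrightarrow> c \<cdot>\<^sub>v w \<in> W" and inv: "\<And>g w. g \<in> carrier H \<Longrightarrow> w \<in> W \<Longrightarrow> snd \<rho> g *\<^sub>v w \<in> W"
  then have "VectorSpace.subspace class_ring W (module_vec TYPE(complex) (fst \<rho>))"
    by (simp add: subspace_module_vec)
  with inv assms show "W = {0\<^sub>v (fst \<rho>)} \<or> W = carrier_vec (fst \<rho>)"
    by (simp add: irreducible_rep_def)
qed

text \<open>The kernel of \<open>X\<close> is an invariant subspace of the irreducible source, and
  it is proper because \<open>X\<close> does not vanish on all unit vectors.\<close>

lemma intertwiner_injective:
  assumes H: "group H" and \<rho>: "irreducible_rep H \<rho>" and \<sigma>: "representation H \<sigma>"
    and X: "intertwiner H \<rho> \<sigma> X" "X \<noteq> 0\<^sub>m (fst \<sigma>) (fst \<rho>)"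
    and v: "v \<in> carrier_vec (fst \<rho>)" "X *\<^sub>v v = 0\<^sub>v (fst \<sigma>)"
  shows "v = 0\<^sub>v (fst \<rho>)"
proof -
  let ?K = "{w \<in> carrier_vec (fst \<rho>). X *\<^sub>v w = 0\<^sub>v (fst \<sigma>)}"
  have Xc: "X \<in> carrier_mat (fst \<sigma>) (fst \<rho>)" using X by (simp add: intertwiner_def)
  have "?K = {0\<^sub>v (fst \<rho>)} \<or> ?K = carrier_vec (fst \<rho>)"
  proof (rule irreducible_repD(3)[OF \<rho>])
    fix g w assume gw: "g \<in> carrier H" "w \<in> ?K"
    have c: "snd \<rho> g \<in> carrier_mat (fst \<rho>) (fst \<rho>)" "snd \<sigma> g \<in> carrier_mat (fst \<sigma>) (fst \<sigma>)"
      using representation_closed[OF H irreducible_repD(1)[OF \<rho>] gw(1)] representation_closed[OF H \<sigma> gw(1)] by auto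
    have "X *\<^sub>v (snd \<rho> g *\<^sub>v w) = (X * snd \<rho> g) *\<^sub>v w"
      using Xc c gw by (simp add: assoc_mult_mat_vec[of _ _ "fst \<rho>" _ "fst \<rho>"])
    also have "\<dots> = snd \<sigma> g *\<^sub>v (X *\<^sub>v w)"
      using X gw Xc c by (simp add: intertwiner_def assoc_mult_mat_vec[of _ _ "fst \<sigma>" _ "fst \<rho>"])
    finally show "snd \<rho> g *\<^sub>v w \<in> ?K" using gw c by auto
  qed (use Xc in \<open>auto simp: mult_add_distrib_mat_vec[of _ "fst \<sigma>" "fst \<rho>"] mult_mat_vec[of _ "fst \<sigma>" "fst \<rho>"]\<close>)
  moreover have "?K \<noteq> carrier_vec (fst \<rho>)"
  proof
    assume K: "?K = carrier_vec (fst \<rho>)"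
    have "X = 0\<^sub>m (fst \<sigma>) (fst \<rho>)"
    proof (rule eq_matI)
      fix i j assume ij: "i < dim_row (0\<^sub>m (fst \<sigma>) (fst \<rho>) :: complex mat)" "j < dim_col (0\<^sub>m (fst \<sigma>) (fst \<rho>) :: complex mat)"
      have "unit_vec (fst \<rho>) j \<in> ?K" using K by (metis unit_vec_carrier)
      then have "(X *\<^sub>v unit_vec (fst \<rho>) j) $ i = 0" using ij by simp
      then show "X $$ (i, j) = 0\<^sub>m (fst \<sigma>) (fst \<rho>) $$ (i, j)" using ij Xc
        by (simp add: scalar_prod_right_unit)
    qed (use Xc in auto)
    with X show False by simp
  qed
  ultimately show ?thesis using v by blast
qed

text \<open>Dual to the previous argument: the image of \<open>X\<close> is a nonzero invariant
  subspace of the irreducible target.\<close>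

lemma intertwiner_surjective:
  assumes H: "group H" and \<rho>: "representation H \<rho>" and \<sigma>: "irreducible_rep H \<sigma>"
    and X: "intertwiner H \<rho> \<sigma> X" "X \<noteq> 0\<^sub>m (fst \<sigma>) (fst \<rho>)"
    and w: "w \<in> carrier_vec (fst \<sigma>)"
  shows "\<exists>v\<in>carrier_vec (fst \<rho>). X *\<^sub>v v = w"
proof -
  let ?I = "{X *\<^sub>v v | v. v \<in> carrier_vec (fst \<rho>)}"
  have Xc: "X \<in> carrier_mat (fst \<sigma>) (fst \<rho>)" using X by (simp add: intertwiner_def)
  have "?I = {0\<^sub>v (fst \<sigma>)} \<or> ?I = carrier_vec (fst \<sigma>)"
  proof (rule irreducible_repD(3)[OF \<sigma>])
    show "?I \<subseteq> carrier_vec (fst \<sigma>)" using Xc by auto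
    have "X *\<^sub>v 0\<^sub>v (fst \<rho>) = 0\<^sub>v (fst \<sigma>)" using Xc by (intro eq_vecI) auto
    then show "0\<^sub>v (fst \<sigma>) \<in> ?I" using zero_carrier_vec by (metis (mono_tags, lifting) mem_Collect_eq)
  next
    fix v w assume "v \<in> ?I" "w \<in> ?I"
    then obtain v' w' where "v = X *\<^sub>v v'" "v' \<in> carrier_vec (fst \<rho>)" "w = X *\<^sub>v w'" "w' \<in> carrier_vec (fst \<rho>)" by blast
    then show "v + w \<in> ?I" using Xc mult_add_distrib_mat_vec[of X "fst \<sigma>" "fst \<rho>" v' w'] 
      by (auto intro!: exI[of _ "v' + w'"])
  next
    fix c w assume "w \<in> ?I"
    then obtain w' where "w = X *\<^sub>v w'" "w' \<in> carrier_vec (fst \<rho>)" by blast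
    then show "c \<cdot>\<^sub>v w \<in> ?I" using Xc mult_mat_vec[of X "fst \<sigma>" "fst \<rho>" w' c]
      by (auto intro!: exI[of _ "c \<cdot>\<^sub>v w'"])
  next
    fix g w assume gw: "g \<in> carrier H" "w \<in> ?I"
    then obtain w' where w': "w = X *\<^sub>v w'" "w' \<in> carrier_vec (fst \<rho>)" by blast
    have c: "snd \<rho> g \<in> carrier_mat (fst \<rho>) (fst \<rho>)" "snd \<sigma> g \<in> carrier_mat (fst \<sigma>) (fst \<sigma>)"
      using representation_closed[OF H irreducible_repD(1)[OF \<sigma>] gw(1)] representation_closed[OF H \<rho> gw(1)] by auto
    have "X *\<^sub>v (snd \<rho> g *\<^sub>v w') = (X * snd \<rho> g) *\<^sub>v w'"
      using Xc c w' by (simp add: assoc_mult_mat_vec[of _ _ "fst \<rho>" _ "fst \<rho>"])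
    also have "\<dots> = snd \<sigma> g *\<^sub>v w"
      using X gw Xc c w' by (simp add: intertwiner_def assoc_mult_mat_vec[of _ _ "fst \<sigma>" _ "fst \<rho>"])
    finally show "snd \<sigma> g *\<^sub>v w \<in> ?I" using c w' by (auto intro!: exI[of _ "snd \<rho> g *\<^sub>v w'"])
  qed
  moreover have "?I \<noteq> {0\<^sub>v (fst \<sigma>)}"
  proof
    assume K: "?I = {0\<^sub>v (fst \<sigma>)}"
    have "X = 0\<^sub>m (fst \<sigma>) (fst \<rho>)"
    proof (rule eq_matI)
      fix i j assume ij: "i < dim_row (0\<^sub>m (fst \<sigma>) (fst \<rho>) :: complex mat)" "j < dim_col (0\<^sub>m (fst \<sigma>) (fst \<rho>) :: complex mat)"
      have "X *\<^sub>v unit_vec (fst \<rho>) j \<in> ?I" using unit_vec_carrier by blast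
      then have "(X *\<^sub>v unit_vec (fst \<rho>) j) $ i = 0" using ij K by simp
      then show "X $$ (i, j) = 0\<^sub>m (fst \<sigma>) (fst \<rho>) $$ (i, j)" using ij Xc
        by (simp add: scalar_prod_right_unit)
    qed (use Xc in auto)
    with X show False by simp
  qed
  ultimately have "w \<in> ?I" using w by blast
  then show ?thesis by blast
qed

lemma schur_iso:
  assumes H: "group H" and \<rho>: "irreducible_rep H \<rho>" and \<sigma>: "irreducible_rep H \<sigma>"
    and X: "intertwiner H \<rho> \<sigma> X" "X \<noteq> 0\<^sub>m (fst \<sigma>) (fst \<rho>)"
  shows "rep_iso H \<rho> \<sigma>"
proof -
  have "X \<in> carrier_mat (fst \<sigma>) (fst \<rho>)" using X by (simp add: intertwiner_def)
  note bij = GL_of_bijective[OF this intertwiner_injective[OF H \<rho> irreducible_repD(1)[OF \<sigma>] X]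
      intertwiner_surjective[OF H irreducible_repD(1)[OF \<rho>] \<sigma> X]]
  then show ?thesis using X by (auto simp: rep_iso_def intertwiner_def)
qed

text \<open>Over the complex numbers \<open>X\<close> has an eigenvalue \<open>c\<close>. The
  intertwiner \<open>X - c\<close> then has a nonzero kernel, so it is not injective and must
  vanish.\<close>

lemma schur_scalar:
  assumes H: "group H" and \<rho>: "irreducible_rep H \<rho>" and X: "intertwiner H \<rho> \<rho> X"
  shows "\<exists>c. X = c \<cdot>\<^sub>m 1\<^sub>m (fst \<rho>)"
proof -
  let ?d = "fst \<rho>"
  have Xc: "X \<in> carrier_mat ?d ?d" using X by (simp add: intertwiner_def)
  obtain c v where cv: "v \<in> carrier_vec ?d" "v \<noteq> 0\<^sub>v ?d" "X *\<^sub>v v = c \<cdot>\<^sub>v v"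
    using spectrum_non_empty[OF Xc irreducible_repD(2)[OF \<rho>]] Xc
    unfolding spectrum_def eigenvalue_def eigenvector_def by auto
  define Y where "Y = X - c \<cdot>\<^sub>m 1\<^sub>m ?d"
  have Yc: "Y \<in> carrier_mat ?d ?d"
    unfolding Y_def by (intro minus_carrier_mat smult_carrier_mat one_carrier_mat)
  have "intertwiner H \<rho> \<rho> Y"
    unfolding intertwiner_def
  proof (intro conjI ballI Yc)
    fix g assume g: "g \<in> carrier H"
    note c = representation_closed[OF H irreducible_repD(1)[OF \<rho>] g]
    have "Y * snd \<rho> g = X * snd \<rho> g - c \<cdot>\<^sub>m snd \<rho> g"
      unfolding Y_def using Xc c
      by (simp add: minus_mult_distrib_mat[of _ ?d ?d] mult_smult_assoc_mat[of _ ?d ?d _ ?d])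
    also have "\<dots> = snd \<rho> g * Y"
      unfolding Y_def using X g Xc c
      by (simp add: mult_minus_distrib_mat[of _ ?d ?d] intertwiner_def mult_smult_distrib[of _ ?d ?d _ ?d])
    finally show "Y * snd \<rho> g = snd \<rho> g * Y" .
  qed
  moreover have "Y *\<^sub>v v = 0\<^sub>v ?d"
  proof -
    have "(c \<cdot>\<^sub>m 1\<^sub>m ?d) *\<^sub>v v = c \<cdot>\<^sub>v v"
      using cv(1) by (intro eq_vecI) simp_all
    then show ?thesis
      unfolding Y_def using Xc cv by (subst minus_mult_distrib_mat_vec[of _ ?d ?d]) auto
  qed
  ultimately have Y0: "Y = 0\<^sub>m ?d ?d"
    using intertwiner_injective[OF H \<rho> irreducible_repD(1)[OF \<rho>]] cv by blast
  have "X = c \<cdot>\<^sub>m 1\<^sub>m ?d"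
  proof (rule eq_matI)
    fix i j assume ij: "i < dim_row (c \<cdot>\<^sub>m 1\<^sub>m ?d)" "j < dim_col (c \<cdot>\<^sub>m 1\<^sub>m ?d)"
    have "Y $$ (i, j) = 0" using Y0 ij by simp
    then show "X $$ (i, j) = (c \<cdot>\<^sub>m 1\<^sub>m ?d) $$ (i, j)" using ij Xc by (simp add: Y_def)
  qed (use Xc in auto)
  then show ?thesis ..
qed

text \<open>Substituting \<open>g h\<close> for \<open>h\<close> in the sum brings out a factor
  \<open>\<sigma> g\<close> on the left and a factor \<open>\<rho> (inv g)\<close> on the right; the
  latter cancels against \<open>\<rho> g\<close>.\<close>

lemma intertwiner_average:
  assumes H: "group H" and \<rho>: "representation H \<rho>" and \<sigma>: "representation H \<sigma>"
    and X: "X \<in> carrier_mat (fst \<sigma>) (fst \<rho>)"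
  shows "intertwiner H \<rho> \<sigma>
    (mat_sum (fst \<sigma>) (fst \<rho>) (\<lambda>h. snd \<sigma> h * X * snd \<rho> (inv\<^bsub>H\<^esub> h)) (carrier H))"
    (is "intertwiner H \<rho> \<sigma> ?A")
  unfolding intertwiner_def
proof (intro conjI ballI)
  interpret group H by fact
  let ?a = "fst \<rho>" and ?b = "fst \<sigma>"
  fix g assume g: "g \<in> carrier H"
  note c = representation_closed[OF H \<rho>] representation_closed[OF H \<sigma>]
  let ?f = "\<lambda>h. snd \<sigma> h * X * snd \<rho> (inv\<^bsub>H\<^esub> h)"
  have f: "?f h \<in> carrier_mat ?b ?a" if "h \<in> carrier H" for h
    using c(2)[OF that] c(1)[OF inv_closed[OF that]] X by (meson mult_carrier_mat)
  have "?A * snd \<rho> g = mat_sum ?b ?a (\<lambda>h. ?f h * snd \<rho> g) (carrier H)"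
    using c(1)[OF g] f by (rule mat_sum_mult)
  also have "\<dots> = mat_sum ?b ?a (\<lambda>h. ?f (g \<otimes>\<^bsub>H\<^esub> h) * snd \<rho> g) (carrier H)"
    by (rule mat_sum_reindex[OF bij_betwI[of _ _ _ "\<lambda>h. inv\<^bsub>H\<^esub> g \<otimes>\<^bsub>H\<^esub> h"]]) (use g in \<open>auto simp: m_assoc[symmetric]\<close>)
  also have "\<dots> = mat_sum ?b ?a (\<lambda>h. snd \<sigma> g * ?f h) (carrier H)"
  proof (rule mat_sum_cong)
    fix h assume h: "h \<in> carrier H"
    have i: "inv\<^bsub>H\<^esub> g \<in> carrier H" "inv\<^bsub>H\<^esub> h \<in> carrier H" using g h by auto
    note cs = c(1)[OF g] c(2)[OF g] c(1)[OF h] c(2)[OF h] c(1)[OF i(1)] c(1)[OF i(2)]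
    have "?f (g \<otimes>\<^bsub>H\<^esub> h) * snd \<rho> g = snd \<sigma> g * snd \<sigma> h * X * (snd \<rho> (inv\<^bsub>H\<^esub> h) * snd \<rho> (inv\<^bsub>H\<^esub> g)) * snd \<rho> g"
      using g h i by (simp add: representation_mult[OF H \<rho>] representation_mult[OF H \<sigma>] inv_mult_group)
    also have "\<dots> = snd \<sigma> g * snd \<sigma> h * X * snd \<rho> (inv\<^bsub>H\<^esub> h) * (snd \<rho> (inv\<^bsub>H\<^esub> g) * snd \<rho> g)"
      using cs X by (simp add: assoc_mult_mat[of _ ?b ?a _ ?a _ ?a] assoc_mult_mat[of _ ?a ?a _ ?a _ ?a])
    also have "\<dots> = snd \<sigma> g * snd \<sigma> h * X * snd \<rho> (inv\<^bsub>H\<^esub> h)"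
      using cs X by (simp add: representation_inv[OF H \<rho> g])
    also have "\<dots> = snd \<sigma> g * ?f h"
      using cs X by (simp add: assoc_mult_mat[of _ ?b ?b _ ?b _ ?a] assoc_mult_mat[of _ ?b ?b _ ?a _ ?a])
    finally show "?f (g \<otimes>\<^bsub>H\<^esub> h) * snd \<rho> g = snd \<sigma> g * ?f h" .
  qed
  also have "\<dots> = snd \<sigma> g * ?A"
    using c(2)[OF g] f by (rule mult_mat_sum[symmetric])
  finally show "?A * snd \<rho> g = snd \<sigma> g * ?A" .
qed simp

text \<open>For a character of a finite group, \<open>\<psi> (inv h)\<close> is the complex
  conjugate of \<open>\<psi> h\<close>. This bilinear form is what averaging in Schur's lemma
  produces directly. The factor 1/|H| is left out, so that irreducible characters have norm
  \<open>card (carrier H)\<close> and passing between \<open>G\<close> and \<open>N\<close> is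
  integer arithmetic.\<close>

definition char_inner :: "('g, 'x) monoid_scheme \<Rightarrow> ('g \<Rightarrow> complex) \<Rightarrow> ('g \<Rightarrow> complex) \<Rightarrow> complex" where
  "char_inner H \<chi> \<psi> = (\<Sum>h\<in>carrier H. \<chi> h * \<psi> (inv\<^bsub>H\<^esub> h))"

lemma char_inner_cong:
  assumes "group H" "\<And>h. h \<in> carrier H \<Longrightarrow> \<chi> h = \<chi>' h" "\<And>h. h \<in> carrier H \<Longrightarrow> \<psi> h = \<psi>' h"
  shows "char_inner H \<chi> \<psi> = char_inner H \<chi>' \<psi>'"
  unfolding char_inner_def by (intro sum.cong refl arg_cong2[where f = "(*)"] assms group.inv_closed)

definition elementary_mat :: "nat \<Rightarrow> nat \<Rightarrow> nat \<Rightarrow> nat \<Rightarrow> complex mat" where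
  "elementary_mat n k p q = mat n k (\<lambda>ij. if ij = (p, q) then 1 else 0)"

lemma mult_mat_index:
  assumes "A \<in> carrier_mat n k" "B \<in> carrier_mat k m" "i < n" "j < m"
  shows "(A * B) $$ (i, j) = (\<Sum>s<k. A $$ (i, s) * B $$ (s, j))"
  using assms by (simp add: scalar_prod_def lessThan_atLeast0)

lemma mult_elementary_mult_index:
  assumes "A \<in> carrier_mat l n" "B \<in> carrier_mat k r" "i < l" "j < r" "p < n" "q < k"
  shows "(A * elementary_mat n k p q * B) $$ (i, j) = A $$ (i, p) * B $$ (q, j)"
proof -
  have AE: "(A * elementary_mat n k p q) $$ (i, s) = (if s = q then A $$ (i, p) else 0)" if "s < k" for s
  proof -
    have "(A * elementary_mat n k p q) $$ (i, s) = (\<Sum>t<n. A $$ (i, t) * (if t = p \<and> s = q then 1 else 0))"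
      using assms that by (simp add: scalar_prod_def elementary_mat_def lessThan_atLeast0)
    also have "\<dots> = (\<Sum>t<n. if t = p then (if s = q then A $$ (i, p) else 0) else 0)"
      by (intro sum.cong) auto
    finally have "(A * elementary_mat n k p q) $$ (i, s) = \<dots>" .
    then show ?thesis using assms by simp
  qed
  have E: "A * elementary_mat n k p q \<in> carrier_mat l k" using assms by (simp add: elementary_mat_def)
  then have "(A * elementary_mat n k p q * B) $$ (i, j) = (\<Sum>s<k. (A * elementary_mat n k p q) $$ (i, s) * B $$ (s, j))"
    using assms(2-4) by (intro mult_mat_index)
  also have "\<dots> = (\<Sum>s<k. if s = q then A $$ (i, p) * B $$ (q, j) else 0)"
    by (intro sum.cong) (auto simp: AE)
  finally show ?thesis using assms by simp
qed

text \<open>Conjugating the matrix unit at \<open>(i, j)\<close> and reading off its entry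
  \<open>(i, j)\<close> gives a product of two diagonal entries; summed over \<open>i\<close> and
  \<open>j\<close> this is the product of the traces. Thus the form is expressed through
  intertwiners, to which Schur's lemma applies.\<close>

lemma char_inner_conv:
  assumes H: "group H" and \<rho>: "representation H \<rho>" and \<sigma>: "representation H \<sigma>"
  shows "char_inner H (rep_char H \<sigma>) (rep_char H \<rho>) = (\<Sum>i<fst \<sigma>. \<Sum>j<fst \<rho>.
    mat_sum (fst \<sigma>) (fst \<rho>) (\<lambda>h. snd \<sigma> h * elementary_mat (fst \<sigma>) (fst \<rho>) i j * snd \<rho> (inv\<^bsub>H\<^esub> h)) (carrier H) $$ (i, j))"
proof -
  interpret group H by fact
  note c = representation_closed[OF H \<rho>] representation_closed[OF H \<sigma>]
  have "char_inner H (rep_char H \<sigma>) (rep_char H \<rho>) =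
    (\<Sum>h\<in>carrier H. \<Sum>i<fst \<sigma>. \<Sum>j<fst \<rho>. snd \<sigma> h $$ (i, i) * snd \<rho> (inv\<^bsub>H\<^esub> h) $$ (j, j))"
    by (simp add: char_inner_def rep_char_def sum_product)
  also have "\<dots> = (\<Sum>i<fst \<sigma>. \<Sum>j<fst \<rho>. \<Sum>h\<in>carrier H. snd \<sigma> h $$ (i, i) * snd \<rho> (inv\<^bsub>H\<^esub> h) $$ (j, j))"
    by (subst sum.swap, intro sum.cong refl, rule sum.swap)
  also have "\<dots> = (\<Sum>i<fst \<sigma>. \<Sum>j<fst \<rho>.
    mat_sum (fst \<sigma>) (fst \<rho>) (\<lambda>h. snd \<sigma> h * elementary_mat (fst \<sigma>) (fst \<rho>) i j * snd \<rho> (inv\<^bsub>H\<^esub> h)) (carrier H) $$ (i, j))"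
    by (intro sum.cong refl) (simp add: mat_sum_index mult_elementary_mult_index[OF c(2) c(1)])
  finally show ?thesis .
qed

text \<open>Each averaged matrix unit is an intertwiner between non-isomorphic irreducible
  representations, hence zero.\<close>

lemma char_orthogonal:
  assumes H: "group H" and \<rho>: "irreducible_rep H \<rho>" and \<sigma>: "irreducible_rep H \<sigma>"
    and "\<not> rep_iso H \<rho> \<sigma>"
  shows "char_inner H (rep_char H \<sigma>) (rep_char H \<rho>) = 0"
proof -
  note r = irreducible_repD(1)[OF \<rho>] irreducible_repD(1)[OF \<sigma>]
  have "mat_sum (fst \<sigma>) (fst \<rho>) (\<lambda>h. snd \<sigma> h * elementary_mat (fst \<sigma>) (fst \<rho>) i j * snd \<rho> (inv\<^bsub>H\<^esub> h)) (carrier H)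
    = 0\<^sub>m (fst \<sigma>) (fst \<rho>)" for i j
    using intertwiner_average[OF H r, of "elementary_mat (fst \<sigma>) (fst \<rho>) i j"] schur_iso[OF H \<rho> \<sigma>] assms(4)
    by (auto simp: elementary_mat_def)
  then show ?thesis unfolding char_inner_conv[OF H r] by simp
qed

lemma trace_mult_commute:
  fixes A B :: "complex mat"
  assumes "A \<in> carrier_mat n k" "B \<in> carrier_mat k n"
  shows "(\<Sum>i<n. (A * B) $$ (i, i)) = (\<Sum>j<k. (B * A) $$ (j, j))"
proof -
  have "(\<Sum>i<n. (A * B) $$ (i, i)) = (\<Sum>i<n. \<Sum>j<k. A $$ (i, j) * B $$ (j, i))"
    using assms by (intro sum.cong) (simp_all add: scalar_prod_def lessThan_atLeast0)
  also have "\<dots> = (\<Sum>j<k. \<Sum>i<n. B $$ (j, i) * A $$ (i, j))"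
    by (subst sum.swap) (simp add: mult.commute)
  also have "\<dots> = (\<Sum>j<k. (B * A) $$ (j, j))"
    using assms by (intro sum.cong) (simp_all add: scalar_prod_def lessThan_atLeast0)
  finally show ?thesis .
qed

text \<open>Each averaged matrix unit is a scalar matrix, and its trace determines the scalar:
  \<open>card (carrier H)\<close> divided by the degree on the diagonal, zero off it.\<close>

lemma char_norm:
  assumes H: "group H" and \<rho>: "irreducible_rep H \<rho>"
  shows "char_inner H (rep_char H \<rho>) (rep_char H \<rho>) = of_nat (card (carrier H))"
proof -
  interpret group H by fact
  let ?d = "fst \<rho>"
  note r = irreducible_repD(1)[OF \<rho>]
  note c = representation_closed[OF H r]
  let ?E = "elementary_mat ?d ?d"
  let ?A = "\<lambda>i j. mat_sum ?d ?d (\<lambda>h. snd \<rho> h * ?E i j * snd \<rho> (inv\<^bsub>H\<^esub> h)) (carrier H)"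
  have A: "?A i j $$ (i, j) = (if i = j then of_nat (card (carrier H)) / of_nat ?d else 0)"
    if ij: "i < ?d" "j < ?d" for i j
  proof -
    have E: "?E i j \<in> carrier_mat ?d ?d" by (simp add: elementary_mat_def)
    obtain z where z: "?A i j = z \<cdot>\<^sub>m 1\<^sub>m ?d"
      using schur_scalar[OF H \<rho> intertwiner_average[OF H r r E]] by blast
    \<comment> \<open>Conjugation preserves the trace, so every group element contributes the trace
      of the matrix unit, which is 1 if \<open>i = j\<close> and 0 otherwise.\<close>
    have "of_nat ?d * z = (\<Sum>l<?d. ?A i j $$ (l, l))" unfolding z by simp
    also have "\<dots> = (\<Sum>h\<in>carrier H. \<Sum>l<?d. (snd \<rho> h * ?E i j * snd \<rho> (inv\<^bsub>H\<^esub> h)) $$ (l, l))"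
      by (subst sum.swap) (simp add: mat_sum_index)
    also have "\<dots> = (\<Sum>h\<in>carrier H. \<Sum>l<?d. ?E i j $$ (l, l))"
    proof (rule sum.cong[OF refl])
      fix h assume h: "h \<in> carrier H"
      have hi: "inv\<^bsub>H\<^esub> h \<in> carrier H" using h by simp
      have "(\<Sum>l<?d. (snd \<rho> h * ?E i j * snd \<rho> (inv\<^bsub>H\<^esub> h)) $$ (l, l))
        = (\<Sum>l<?d. (snd \<rho> (inv\<^bsub>H\<^esub> h) * (snd \<rho> h * ?E i j)) $$ (l, l))"
        using c[OF h] c[OF hi] E by (intro trace_mult_commute) auto
      also have "snd \<rho> (inv\<^bsub>H\<^esub> h) * (snd \<rho> h * ?E i j) = ?E i j"
        using c[OF h] c[OF hi] E representation_inv[OF H r h]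
        by (simp add: assoc_mult_mat[of _ ?d ?d _ ?d _ ?d, symmetric])
      finally show "(\<Sum>l<?d. (snd \<rho> h * ?E i j * snd \<rho> (inv\<^bsub>H\<^esub> h)) $$ (l, l)) = (\<Sum>l<?d. ?E i j $$ (l, l))" .
    qed
    also have "(\<Sum>l<?d. ?E i j $$ (l, l)) = (\<Sum>l<?d. if l = i then (if i = j then 1 else 0) else 0)"
      by (intro sum.cong) (auto simp: elementary_mat_def)
    finally have "of_nat ?d * z = (if i = j then of_nat (card (carrier H)) else 0)"
      using ij by simp
    then have "z = (if i = j then of_nat (card (carrier H)) / of_nat ?d else 0)"
      using irreducible_repD(2)[OF \<rho>] by (auto simp: field_simps)
    then show ?thesis unfolding z using ij by simp
  qed
  have "char_inner H (rep_char H \<rho>) (rep_char H \<rho>) = (\<Sum>i<?d. \<Sum>j<?d. ?A i j $$ (i, j))"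
    by (rule char_inner_conv[OF H r r])
  also have "\<dots> = (\<Sum>i<?d. \<Sum>j<?d. if i = j then of_nat (card (carrier H)) / of_nat ?d else 0)"
    by (intro sum.cong refl) (simp add: A)
  also have "\<dots> = of_nat (card (carrier H))"
    using irreducible_repD(2)[OF \<rho>] by simp
  finally show ?thesis .
qed

lemma rep_char_iso:
  assumes H: "group H" and \<rho>: "representation H \<rho>" and \<sigma>: "representation H \<sigma>" and iso: "rep_iso H \<rho> \<sigma>"
  shows "rep_char H \<rho> = rep_char H \<sigma>"
proof
  fix g
  show "rep_char H \<rho> g = rep_char H \<sigma> g"
  proof (cases "g \<in> carrier H")
    case g: True
    let ?d = "fst \<rho>"
    obtain P where d: "fst \<sigma> = ?d" and P: "P \<in> carrier (GL ?d)" "P * snd \<rho> g = snd \<sigma> g * P"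
      using iso g by (auto simp: rep_iso_def)
    obtain Q where Q: "Q \<in> carrier_mat ?d ?d" "P * Q = 1\<^sub>m ?d" "Q * P = 1\<^sub>m ?d"
      using P(1) by (rule GL_inverseE)
    have c: "P \<in> carrier_mat ?d ?d" "snd \<rho> g \<in> carrier_mat ?d ?d" "snd \<sigma> g \<in> carrier_mat ?d ?d"
      using P representation_closed[OF H \<rho> g] representation_closed[OF H \<sigma> g] d by (auto simp: carrier_GL)
    have "snd \<sigma> g = snd \<sigma> g * (P * Q)" using c Q by simp
    also have "\<dots> = P * snd \<rho> g * Q" using c Q P(2) by (simp add: assoc_mult_mat[of _ ?d ?d _ ?d _ ?d])
    finally have "(\<Sum>i<?d. snd \<sigma> g $$ (i, i)) = (\<Sum>i<?d. (P * snd \<rho> g * Q) $$ (i, i))" by simp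
    also have "\<dots> = (\<Sum>i<?d. (Q * (P * snd \<rho> g)) $$ (i, i))"
      using c Q by (intro trace_mult_commute) auto
    also have "Q * (P * snd \<rho> g) = snd \<rho> g"
      using c Q by (simp add: assoc_mult_mat[of _ ?d ?d _ ?d _ ?d, symmetric])
    finally show ?thesis using g d by (simp add: rep_char_def)
  qed (simp add: rep_char_def)
qed

lemma rep_char_dsum:
  assumes "group H" "representation H \<rho>" "representation H \<sigma>" "g \<in> carrier H"
  shows "rep_char H (rep_dsum \<rho> \<sigma>) g = rep_char H \<rho> g + rep_char H \<sigma> g"
proof -
  note c = representation_closed[OF assms(1,2,4)] representation_closed[OF assms(1,3,4)]
  have "(\<Sum>i<a + b. f i) = (\<Sum>i<a. f i) + (\<Sum>i<b. f (a + i))" for a b and f :: "nat \<Rightarrow> complex"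
    by (induction b) (simp_all add: add.assoc)
  then show ?thesis
    using assms(4) c by (simp add: rep_char_def snd_rep_dsum[OF assms])
qed

lemma rep_char_sum:
  assumes "group H" "\<And>\<rho>. \<rho> \<in> set \<rho>s \<Longrightarrow> representation H \<rho>" "g \<in> carrier H"
  shows "rep_char H (rep_sum \<rho>s) g = (\<Sum>\<rho>\<leftarrow>\<rho>s. rep_char H \<rho> g)"
  using assms(2)
proof (induction \<rho>s)
  case Nil
  then show ?case by (simp add: rep_sum_Nil rep_char_def assms(3))
next
  case (Cons \<rho> \<rho>s)
  then show ?case
    using rep_char_dsum[OF assms(1) _ representation_sum[OF assms(1)] assms(3), of \<rho> \<rho>s] by (simp add: rep_sum_Cons)
qed

section \<open>Complete reducibility\<close>

lemma four_block_mat_inject: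
  assumes "A \<in> carrier_mat a b" "B \<in> carrier_mat a d" "C \<in> carrier_mat c b" "D \<in> carrier_mat c d"
    "A' \<in> carrier_mat a b" "B' \<in> carrier_mat a d" "C' \<in> carrier_mat c b" "D' \<in> carrier_mat c d"
    and "four_block_mat A B C D = four_block_mat A' B' C' D'"
  shows "A = A'" "B = B'" "C = C'" "D = D'"
proof -
  have eq: "four_block_mat A B C D $$ (i, j) = four_block_mat A' B' C' D' $$ (i, j)" for i j
    using assms(9) by simp
  note c = assms(1-8)
  show "A = A'"
  proof (rule eq_matI)
    fix i j assume "i < dim_row A'" "j < dim_col A'"
    then show "A $$ (i, j) = A' $$ (i, j)" using eq[of i j] c by auto
  qed (use c in auto)
  show "B = B'"
  proof (rule eq_matI)
    fix i j assume "i < dim_row B'" "j < dim_col B'"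
    then show "B $$ (i, j) = B' $$ (i, j)" using eq[of i "j + b"] c by auto
  qed (use c in auto)
  show "C = C'"
  proof (rule eq_matI)
    fix i j assume "i < dim_row C'" "j < dim_col C'"
    then show "C $$ (i, j) = C' $$ (i, j)" using eq[of "i + a" j] c by auto
  qed (use c in auto)
  show "D = D'"
  proof (rule eq_matI)
    fix i j assume "i < dim_row D'" "j < dim_col D'"
    then show "D $$ (i, j) = D' $$ (i, j)" using eq[of "i + a" "j + b"] c by auto
  qed (use c in auto)
qed

lemma mat_sum_add:
  assumes "\<And>a. a \<in> A \<Longrightarrow> f a \<in> carrier_mat n k" "\<And>a. a \<in> A \<Longrightarrow> g a \<in> carrier_mat n k"
  shows "mat_sum n k f A + mat_sum n k g A = mat_sum n k (\<lambda>a. f a + g a) A"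
proof (rule eq_matI)
  fix i j assume "i < dim_row (mat_sum n k (\<lambda>a. f a + g a) A)" "j < dim_col (mat_sum n k (\<lambda>a. f a + g a) A)"
  then have ij: "i < n" "j < k" by (simp_all add: mat_sum_def)
  have "(f a + g a) $$ (i, j) = f a $$ (i, j) + g a $$ (i, j)" if "a \<in> A" for a
    using assms[OF that] ij by simp
  then show "(mat_sum n k f A + mat_sum n k g A) $$ (i, j) = mat_sum n k (\<lambda>a. f a + g a) A $$ (i, j)"
    using ij by (simp add: mat_sum_def sum.distrib)
qed (simp_all add: mat_sum_def)

text \<open>Averaging \<open>B h D(h)\<inverse>\<close> over the group makes the extension cocycle \<open>B\<close> a coboundary.\<close>

lemma block_triangular_splits:
  assumes H: "group H" and fin: "finite (carrier H)"
    and \<tau>: "representation H (k + l, \<lambda>g. four_block_mat (A g) (B g) (0\<^sub>m l k) (D g))"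
    and c: "\<And>g. g \<in> carrier H \<Longrightarrow> A g \<in> carrier_mat k k" "\<And>g. g \<in> carrier H \<Longrightarrow> B g \<in> carrier_mat k l"
      "\<And>g. g \<in> carrier H \<Longrightarrow> D g \<in> carrier_mat l l"
  shows "representation H (k, A)" "representation H (l, D)"
    "rep_iso H (rep_dsum (k, A) (l, D)) (k + l, \<lambda>g. four_block_mat (A g) (B g) (0\<^sub>m l k) (D g))"
proof -
  interpret group H by fact
  let ?\<tau> = "\<lambda>g. four_block_mat (A g) (B g) (0\<^sub>m l k) (D g)"
  \<comment> \<open>The homomorphism property read off blockwise: the diagonal blocks are
    multiplicative, and the corner block satisfies the cocycle identity.\<close>
  have mult: "A (g \<otimes>\<^bsub>H\<^esub> h) = A g * A h" "B (g \<otimes>\<^bsub>H\<^esub> h) = A g * B h + B g * D h"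
    "D (g \<otimes>\<^bsub>H\<^esub> h) = D g * D h"
    if gh: "g \<in> carrier H" "h \<in> carrier H" for g h
  proof -
    note cg = c[OF gh(1)] and ch = c[OF gh(2)] and cgh = c[OF m_closed[OF gh]]
    have "?\<tau> (g \<otimes>\<^bsub>H\<^esub> h) = ?\<tau> g * ?\<tau> h"
      using representation_mult[OF H \<tau> gh] by simp
    also have "\<dots> = four_block_mat (A g * A h) (A g * B h + B g * D h) (0\<^sub>m l k) (D g * D h)"
      using cg ch by (simp add: mult_four_block_mat[of _ k k _ l _ l _ _ k _ l])
    finally have "?\<tau> (g \<otimes>\<^bsub>H\<^esub> h) = \<dots>" .
    note inj = four_block_mat_inject[OF cgh(1,2) zero_carrier_mat cgh(3) _ _ zero_carrier_mat _ this]
    show "A (g \<otimes>\<^bsub>H\<^esub> h) = A g * A h" "B (g \<otimes>\<^bsub>H\<^esub> h) = A g * B h + B g * D h" "D (g \<otimes>\<^bsub>H\<^esub> h) = D g * D h"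
      using cg ch by (auto intro!: inj)
  qed
  have one: "A \<one>\<^bsub>H\<^esub> = 1\<^sub>m k" "D \<one>\<^bsub>H\<^esub> = 1\<^sub>m l"
  proof -
    have "?\<tau> \<one>\<^bsub>H\<^esub> = four_block_mat (1\<^sub>m k) (0\<^sub>m k l) (0\<^sub>m l k) (1\<^sub>m l)"
      using representation_one[OF H \<tau>] by simp
    note inj = four_block_mat_inject[OF c(1,2)[OF one_closed] zero_carrier_mat c(3)[OF one_closed]
      one_carrier_mat zero_carrier_mat zero_carrier_mat one_carrier_mat this]
    show "A \<one>\<^bsub>H\<^esub> = 1\<^sub>m k" "D \<one>\<^bsub>H\<^esub> = 1\<^sub>m l" by (fact inj)+
  qed
  show A: "representation H (k, A)" and D: "representation H (l, D)"
    unfolding representation_iff[OF H] using c mult one by simp_all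
  define X where "X = mat_sum k l (\<lambda>h. B h * D (inv\<^bsub>H\<^esub> h)) (carrier H)"
  have Xc: "X \<in> carrier_mat k l" by (simp add: X_def)
  let ?r = "of_nat (card (carrier H)) :: complex"
  have r: "?r \<noteq> 0" using fin by (simp add: card_eq_0_iff) blast
  \<comment> \<open>After multiplication by \<open>D (inv h)\<close> the cocycle identity reads
    \<open>A g B(h) D(h)^-1 + B g = B(gh) D(gh)^-1 D(g)\<close>. Summing over \<open>h\<close> and
    reindexing by \<open>g h\<close> turns the right side into \<open>X * D g\<close>.\<close>
  have X: "A g * X + ?r \<cdot>\<^sub>m B g = X * D g" if g: "g \<in> carrier H" for g
  proof -
    have f: "B h * D (inv\<^bsub>H\<^esub> h) \<in> carrier_mat k l" if "h \<in> carrier H" for h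
      using c(2)[OF that] c(3)[OF inv_closed[OF that]] by (rule mult_carrier_mat)
    have "?r \<cdot>\<^sub>m B g = mat_sum k l (\<lambda>h. B g) (carrier H)"
      using c(2)[OF g] by (intro eq_matI) (simp_all add: mat_sum_def)
    then have "A g * X + ?r \<cdot>\<^sub>m B g = mat_sum k l (\<lambda>h. A g * (B h * D (inv\<^bsub>H\<^esub> h))) (carrier H) + mat_sum k l (\<lambda>h. B g) (carrier H)"
      unfolding X_def
      using mult_mat_sum[where A = "carrier H" and f = "\<lambda>h. B h * D (inv\<^bsub>H\<^esub> h)", OF c(1)[OF g] f] by simp
    also have "\<dots> = mat_sum k l (\<lambda>h. A g * (B h * D (inv\<^bsub>H\<^esub> h)) + B g) (carrier H)"
      using f c(1,2)[OF g] by (intro mat_sum_add) auto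
    also have "\<dots> = mat_sum k l (\<lambda>h. B (g \<otimes>\<^bsub>H\<^esub> h) * D (inv\<^bsub>H\<^esub> (g \<otimes>\<^bsub>H\<^esub> h)) * D g) (carrier H)"
    proof (rule mat_sum_cong)
      fix h assume h: "h \<in> carrier H"
      have i: "inv\<^bsub>H\<^esub> h \<in> carrier H" "inv\<^bsub>H\<^esub> g \<in> carrier H" using g h by auto
      note cs = c[OF g] c[OF h] c[OF i(1)] c[OF i(2)]
      have "B (g \<otimes>\<^bsub>H\<^esub> h) * D (inv\<^bsub>H\<^esub> (g \<otimes>\<^bsub>H\<^esub> h)) * D g = B (g \<otimes>\<^bsub>H\<^esub> h) * D (inv\<^bsub>H\<^esub> (g \<otimes>\<^bsub>H\<^esub> h) \<otimes>\<^bsub>H\<^esub> g)"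
        using assoc_mult_mat[OF c(2)[OF m_closed[OF g h]] c(3)[OF inv_closed[OF m_closed[OF g h]]] c(3)[OF g]] g h
        by (simp add: mult(3))
      also have "inv\<^bsub>H\<^esub> (g \<otimes>\<^bsub>H\<^esub> h) \<otimes>\<^bsub>H\<^esub> g = inv\<^bsub>H\<^esub> h"
        using g h by (simp add: inv_mult_group m_assoc)
      also have "B (g \<otimes>\<^bsub>H\<^esub> h) * D (inv\<^bsub>H\<^esub> h) = A g * B h * D (inv\<^bsub>H\<^esub> h) + B g * D h * D (inv\<^bsub>H\<^esub> h)"
        using cs g h by (simp add: mult add_mult_distrib_mat[of _ k l _ _ l])
      also have "B g * D h * D (inv\<^bsub>H\<^esub> h) = B g"
        using cs g h representation_inv(1)[OF H D h] by (simp add: assoc_mult_mat[of _ k l _ l _ l])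
      also have "A g * B h * D (inv\<^bsub>H\<^esub> h) = A g * (B h * D (inv\<^bsub>H\<^esub> h))"
        using cs by (simp add: assoc_mult_mat[of _ k k _ l _ l])
      finally show "A g * (B h * D (inv\<^bsub>H\<^esub> h)) + B g = B (g \<otimes>\<^bsub>H\<^esub> h) * D (inv\<^bsub>H\<^esub> (g \<otimes>\<^bsub>H\<^esub> h)) * D g" ..
    qed
    also have "\<dots> = mat_sum k l (\<lambda>h. B h * D (inv\<^bsub>H\<^esub> h) * D g) (carrier H)"
      by (rule mat_sum_reindex[symmetric, where \<pi> = "\<lambda>h. g \<otimes>\<^bsub>H\<^esub> h", OF bij_betwI[of _ _ _ "\<lambda>h. inv\<^bsub>H\<^esub> g \<otimes>\<^bsub>H\<^esub> h"]])
        (use g in \<open>auto simp: m_assoc[symmetric]\<close>)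
    also have "\<dots> = X * D g" unfolding X_def using c(3)[OF g] f by (rule mat_sum_mult[symmetric])
    finally show ?thesis .
  qed
  define Y where "Y = inverse ?r \<cdot>\<^sub>m X"
  have Yc: "Y \<in> carrier_mat k l" using Xc by (simp add: Y_def)
  have Y: "A g * Y + B g = Y * D g" if g: "g \<in> carrier H" for g
  proof -
    have "A g * Y + B g = inverse ?r \<cdot>\<^sub>m (A g * X + ?r \<cdot>\<^sub>m B g)"
      unfolding Y_def mult_smult_distrib[OF c(1)[OF g] Xc]
      using c(1,2)[OF g] Xc r by (intro eq_matI) (auto simp: algebra_simps)
    also have "\<dots> = Y * D g"
      unfolding X[OF g] Y_def using c(3)[OF g] Xc by (simp add: mult_smult_assoc_mat[of _ k l _ l])
    finally show ?thesis .
  qed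
  \<comment> \<open>The equation for \<open>Y\<close> says exactly that this unipotent matrix
    intertwines the block diagonal with the block triangular form.\<close>
  define R where "R = four_block_mat (1\<^sub>m k) Y (0\<^sub>m l k) (1\<^sub>m l)"
  have Rc: "R \<in> carrier_mat (k + l) (k + l)" by (simp add: R_def)
  have "R \<in> carrier (GL (k + l))"
  proof (rule GL_I[OF Rc])
    show "four_block_mat (1\<^sub>m k) (- Y) (0\<^sub>m l k) (1\<^sub>m l) \<in> carrier_mat (k + l) (k + l)" by simp
    have z: "- 0\<^sub>m l l + 1\<^sub>m l = (1\<^sub>m l :: complex mat)" by (intro eq_matI) auto
    show "R * four_block_mat (1\<^sub>m k) (- Y) (0\<^sub>m l k) (1\<^sub>m l) = 1\<^sub>m (k + l)"
      unfolding R_def using Yc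
      by (subst mult_four_block_mat[of _ k k _ l _ l _ _ k _ l]) (auto simp: uminus_l_inv_mat[of _ k l] z)
  qed
  moreover have "R * snd (rep_dsum (k, A) (l, D)) g = ?\<tau> g * R" if g: "g \<in> carrier H" for g
    using c[OF g] Yc Y[OF g] unfolding R_def snd_rep_dsum[OF H A D g]
    by (simp add: mult_four_block_mat[of _ k k _ l _ l _ _ k _ l])
  ultimately show "rep_iso H (rep_dsum (k, A) (l, D)) (k + l, ?\<tau>)"
    by (auto simp: rep_iso_def)
qed

text \<open>Maschke's theorem: in a basis adapted to \<open>W\<close> all matrices are block upper
  triangular, and the corner block can be conjugated away. Properness of \<open>W\<close> gives
  \<open>0 < k < n\<close>, so both summands have smaller degree and an induction on the degree can
  proceed.\<close>

lemma invariant_subspace_splits: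
  assumes H: "group H" and fin: "finite (carrier H)" and \<sigma>: "representation H \<sigma>"
    and W: "VectorSpace.subspace class_ring W (module_vec TYPE(complex) (fst \<sigma>))"
    and inv: "\<And>g w. g \<in> carrier H \<Longrightarrow> w \<in> W \<Longrightarrow> snd \<sigma> g *\<^sub>v w \<in> W"
    and ne: "W \<noteq> {0\<^sub>v (fst \<sigma>)}" "W \<noteq> carrier_vec (fst \<sigma>)"
  obtains \<rho> \<tau> where "representation H \<rho>" "representation H \<tau>" "fst \<rho> < fst \<sigma>" "fst \<tau> < fst \<sigma>"
    "rep_iso H \<sigma> (rep_dsum \<rho> \<tau>)"
proof -
  interpret group H by fact
  define n where "n = fst \<sigma>"
  note c = representation_closed[OF H \<sigma>, folded n_def]
  obtain k P where k: "k \<le> n" and P: "P \<in> carrier (GL n)" and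
    Weq: "W = {P *\<^sub>v x | x. x \<in> carrier_vec n \<and> (\<forall>j. k \<le> j \<longrightarrow> j < n \<longrightarrow> x $ j = 0)}"
    by (rule adapted_basis[OF W[folded n_def]])
  obtain Q where Q: "Q \<in> carrier_mat n n" "P * Q = 1\<^sub>m n" "Q * P = 1\<^sub>m n" using P by (rule GL_inverseE)
  have Pc: "P \<in> carrier_mat n n" using P by (simp add: carrier_GL)
  have PQ: "P *\<^sub>v (Q *\<^sub>v w) = w" "Q *\<^sub>v (P *\<^sub>v w) = w" if "w \<in> carrier_vec n" for w
    using assoc_mult_mat_vec[OF Pc Q(1) that] assoc_mult_mat_vec[OF Q(1) Pc that] Q that by simp_all
  have "k \<noteq> 0"
  proof
    assume "k = 0"
    have z: "x = 0\<^sub>v n" if "x \<in> carrier_vec n" "\<forall>j<n. x $ j = 0" for x :: "complex vec"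
      using that by (intro eq_vecI) auto
    have P0: "P *\<^sub>v 0\<^sub>v n = 0\<^sub>v n" using Pc by (intro eq_vecI) auto
    have "W = {0\<^sub>v n}"
    proof (intro equalityI subsetI)
      fix w assume "w \<in> W"
      then obtain x where "w = P *\<^sub>v x" "x \<in> carrier_vec n" "\<forall>j<n. x $ j = 0"
        unfolding Weq \<open>k = 0\<close> by auto
      then show "w \<in> {0\<^sub>v n}" using z[of x] P0 by simp
    next
      fix w assume "w \<in> {0\<^sub>v n :: complex vec}"
      then show "w \<in> W" using W by (simp add: subspace_module_vec n_def)
    qed
    with ne show False by (simp add: n_def)
  qed
  moreover have "k \<noteq> n"
  proof
    assume "k = n"
    have "W = carrier_vec n"
    proof (intro equalityI subsetI)
      fix w :: "complex vec" assume w: "w \<in> carrier_vec n"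
      then have "w = P *\<^sub>v (Q *\<^sub>v w)" "Q *\<^sub>v w \<in> carrier_vec n" using PQ Q by auto
      then show "w \<in> W" unfolding Weq \<open>k = n\<close> by auto
    qed (use W in \<open>auto simp: subspace_module_vec n_def\<close>)
    with ne show False by (simp add: n_def)
  qed
  ultimately have kn: "0 < k" "k < n" using k by auto
  define l where "l = n - k"
  have n: "n = k + l" and l: "0 < l" using kn by (auto simp: l_def)
  define \<tau> where "\<tau> = (\<lambda>g. Q * snd \<sigma> g * P)"
  have \<tau>c: "\<tau> g \<in> carrier_mat n n" if "g \<in> carrier H" for g
    using c[OF that] Q Pc by (simp add: \<tau>_def)
  have P\<tau>: "P * \<tau> g = snd \<sigma> g * P" if "g \<in> carrier H" for g
  proof -
    have "P * \<tau> g = P * (Q * snd \<sigma> g) * P"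
      unfolding \<tau>_def using c[OF that] Q(1) Pc by (intro assoc_mult_mat[symmetric]) auto
    also have "P * (Q * snd \<sigma> g) = snd \<sigma> g"
      using assoc_mult_mat[OF Pc Q(1) c[OF that]] Q(2) c[OF that] by simp
    finally show ?thesis .
  qed
  have \<tau>rep: "representation H (n, \<tau>)"
    unfolding representation_iff[OF H] fst_conv snd_conv
  proof (intro conjI ballI)
    fix g h assume gh: "g \<in> carrier H" "h \<in> carrier H"
    have "\<tau> (g \<otimes>\<^bsub>H\<^esub> h) = Q * snd \<sigma> g * (snd \<sigma> h * P)"
      using c[OF gh(1)] c[OF gh(2)] Q Pc gh
      by (simp add: \<tau>_def representation_mult[OF H \<sigma>] assoc_mult_mat[of _ n n _ n _ n])
    also have "\<dots> = \<tau> g * \<tau> h"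
      unfolding P\<tau>[OF gh(2), symmetric] using c[OF gh(1)] \<tau>c[OF gh(2)] Q Pc
      by (simp add: \<tau>_def assoc_mult_mat[of _ n n _ n _ n])
    finally show "\<tau> (g \<otimes>\<^bsub>H\<^esub> h) = \<tau> g * \<tau> h" .
  qed (use \<tau>c Q Pc representation_one[OF H \<sigma>] in \<open>simp_all add: \<tau>_def n_def\<close>)
  \<comment> \<open>Column \<open>j < k\<close> of \<open>\<tau> g\<close> is the coordinate vector
    of an element of \<open>W\<close>, so it is supported on the first \<open>k\<close>
    positions.\<close>
  have zero: "\<tau> g $$ (i, j) = 0" if g: "g \<in> carrier H" and ij: "k \<le> i" "i < n" "j < k" for g i j
  proof -
    have e: "unit_vec n j \<in> (carrier_vec n :: complex vec set)" by simp
    have "P *\<^sub>v unit_vec n j \<in> W" unfolding Weq using ij by auto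
    then have "snd \<sigma> g *\<^sub>v (P *\<^sub>v unit_vec n j) \<in> W" by (rule inv[OF g])
    then obtain x where x: "snd \<sigma> g *\<^sub>v (P *\<^sub>v unit_vec n j) = P *\<^sub>v x" "x \<in> carrier_vec n" "x $ i = 0"
      unfolding Weq using ij by auto
    have "\<tau> g *\<^sub>v unit_vec n j = Q *\<^sub>v (snd \<sigma> g *\<^sub>v (P *\<^sub>v unit_vec n j))"
      using c[OF g] Q Pc unfolding \<tau>_def by (simp add: assoc_mult_mat_vec[of _ n n _ n])
    also have "\<dots> = x" using x PQ by simp
    finally have "(\<tau> g *\<^sub>v unit_vec n j) $ i = 0" using x by simp
    then show ?thesis using \<tau>c[OF g] ij by (simp add: scalar_prod_right_unit)
  qed
  define A where "A = (\<lambda>g. mat k k (\<lambda>(i, j). \<tau> g $$ (i, j)))"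
  define B where "B = (\<lambda>g. mat k l (\<lambda>(i, j). \<tau> g $$ (i, j + k)))"
  define D where "D = (\<lambda>g. mat l l (\<lambda>(i, j). \<tau> g $$ (i + k, j + k)))"
  let ?b = "\<lambda>g. four_block_mat (A g) (B g) (0\<^sub>m l k) (D g)"
  have block: "\<tau> g = ?b g" if "g \<in> carrier H" for g
    using \<tau>c[OF that] zero[OF that] unfolding A_def B_def D_def
    by (intro eq_matI) (auto simp: n)
  have "representation H (k + l, ?b)"
    using \<tau>rep block group.is_monoid[OF H] unfolding representation_iff[OF H] n by auto
  note split = block_triangular_splits[OF H fin this]
  have AD: "representation H (k, A)" "representation H (l, D)"
    "rep_iso H (rep_dsum (k, A) (l, D)) (k + l, ?b)"
    by (rule split; simp add: A_def B_def D_def)+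
  have "rep_iso H (n, \<tau>) \<sigma>"
    unfolding rep_iso_def fst_conv snd_conv using P P\<tau> n_def by blast
  moreover have "rep_iso H (rep_dsum (k, A) (l, D)) (n, \<tau>)"
    using AD(3) block by (simp add: rep_iso_def n)
  ultimately have "rep_iso H (rep_dsum (k, A) (l, D)) \<sigma>"
    using rep_iso_trans[OF H representation_dsum[OF H AD(1,2)] \<tau>rep \<sigma>] by blast
  then have "rep_iso H \<sigma> (rep_dsum (k, A) (l, D))"
    using rep_iso_sym[OF H representation_dsum[OF H AD(1,2)] \<sigma>] by blast
  then show thesis using that[OF AD(1,2)] kn l by (simp add: n flip: n_def)
qed

text \<open>Strong induction on the degree. Degree 0 is a case of its own, since irreducible
  representations have positive degree; it is the empty sum.\<close>

theorem complete_reducibility: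
  assumes H: "group H" and fin: "finite (carrier H)" and "representation H \<sigma>"
  shows "\<exists>\<rho>s. (\<forall>\<rho>\<in>set \<rho>s. irreducible_rep H \<rho>) \<and> rep_iso H \<sigma> (rep_sum \<rho>s)"
  using assms(3)
proof (induction "fst \<sigma>" arbitrary: \<sigma> rule: less_induct)
  case (less \<sigma>)
  note \<sigma> = \<open>representation H \<sigma>\<close>
  consider "fst \<sigma> = 0" | "irreducible_rep H \<sigma>" | "fst \<sigma> \<noteq> 0" "\<not> irreducible_rep H \<sigma>" by blast
  then show ?case
  proof cases
    case 1
    have "rep_iso H \<sigma> (rep_sum [])"
      unfolding rep_iso_def rep_sum_Nil fst_conv snd_conv 1
    proof (intro conjI refl bexI[of _ "1\<^sub>m 0"] ballI)
      fix g assume "g \<in> carrier H"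
      then have "snd \<sigma> g \<in> carrier_mat 0 0" using representation_closed[OF H \<sigma>] 1 by simp
      then show "1\<^sub>m 0 * snd \<sigma> g = 0\<^sub>m 0 0 * 1\<^sub>m 0" by (intro eq_matI) auto
    qed (simp add: carrier_GL)
    then show ?thesis by (intro exI[of _ "[]"]) simp
  next
    case 2
    have "rep_sum [\<sigma>] = \<sigma>" by (simp add: rep_sum_def del: diag_block_mat.simps)
    then have "rep_iso H \<sigma> (rep_sum [\<sigma>])" using rep_iso_refl[OF H \<sigma>] by simp
    then show ?thesis using 2 by (intro exI[of _ "[\<sigma>]"]) simp
  next
    case 3
    then obtain W where W: "VectorSpace.subspace class_ring W (module_vec TYPE(complex) (fst \<sigma>))"
      and inv: "\<And>g w. g \<in> carrier H \<Longrightarrow> w \<in> W \<Longrightarrow> snd \<sigma> g *\<^sub>v w \<in> W"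
      and ne: "W \<noteq> {0\<^sub>v (fst \<sigma>)}" "W \<noteq> carrier_vec (fst \<sigma>)"
      using \<sigma> unfolding irreducible_rep_def by blast
    obtain \<rho> \<tau> where r: "representation H \<rho>" "representation H \<tau>" "fst \<rho> < fst \<sigma>" "fst \<tau> < fst \<sigma>"
      "rep_iso H \<sigma> (rep_dsum \<rho> \<tau>)"
      using invariant_subspace_splits[OF H fin \<sigma> W inv ne] by blast
    obtain xs ys where xs: "\<forall>\<rho>\<in>set xs. irreducible_rep H \<rho>" "rep_iso H \<rho> (rep_sum xs)"
      and ys: "\<forall>\<rho>\<in>set ys. irreducible_rep H \<rho>" "rep_iso H \<tau> (rep_sum ys)"
      using less.hyps r by metis
    have reps: "representation H (rep_sum xs)" "representation H (rep_sum ys)"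
      by (rule representation_sum[OF H]; use xs ys irreducible_repD(1) in blast)+
    have "rep_iso H \<sigma> (rep_sum (xs @ ys))"
      unfolding rep_sum_append
      using rep_iso_trans[OF H \<sigma> representation_dsum[OF H r(1,2)] representation_dsum[OF H reps] r(5)
        rep_iso_dsum[OF H r(1,2) reps xs(2) ys(2)]] .
    then show ?thesis using xs ys by (intro exI[of _ "xs @ ys"]) auto
  qed
qed

section \<open>Multiplicities of irreducible constituents\<close>

lemma rep_sum_mset_cong:
  assumes H: "group H" and "mset \<rho>s = mset \<sigma>s" and "\<And>\<rho>. \<rho> \<in> set \<rho>s \<Longrightarrow> representation H \<rho>"
  shows "rep_iso H (rep_sum \<rho>s) (rep_sum \<sigma>s)"
  using assms(2,3)
proof (induction \<rho>s arbitrary: \<sigma>s)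
  case Nil
  then show ?case using rep_iso_refl[OF H representation_sum[OF H, of "[]"]] by simp
next
  case (Cons \<rho> \<rho>s)
  then have "\<rho> \<in> set \<sigma>s" by (metis list.set_intros(1) mset_eq_setD)
  then obtain as bs where \<sigma>s: "\<sigma>s = as @ \<rho> # bs" by (meson split_list)
  with Cons.prems have m: "mset \<rho>s = mset (as @ bs)" by simp
  have set: "\<forall>\<tau>\<in>set as \<union> set bs \<union> set \<rho>s \<union> {\<rho>}. representation H \<tau>"
    using Cons.prems(2) mset_eq_setD[OF m] by simp
  note rs = representation_sum[OF H]
  have R: "representation H \<rho>" "representation H (rep_sum \<rho>s)" "representation H (rep_sum (as @ bs))"
     "representation H (rep_sum as)" "representation H (rep_sum bs)" "representation H (rep_sum [\<rho>])"
    using set by (auto intro!: rs)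
  have a: "rep_iso H (rep_sum (\<rho> # \<rho>s)) (rep_sum (([\<rho>] @ as) @ bs))"
    using rep_iso_dsum[OF H R(1,2) R(1) R(3) rep_iso_refl[OF H R(1)] Cons.IH[OF m]] set
    by (simp add: rep_sum_Cons)
  \<comment> \<open>Only one block has to move: \<open>\<rho>\<close> passes across the prefix
    \<open>as\<close>, by commutativity of the direct sum up to isomorphism.\<close>
  have b: "rep_iso H (rep_sum (([\<rho>] @ as) @ bs)) (rep_sum ((as @ [\<rho>]) @ bs))"
    unfolding rep_sum_append[of _ bs] rep_sum_append[of "[\<rho>]" as] rep_sum_append[of as "[\<rho>]"]
    by (intro rep_iso_dsum H representation_dsum R rep_iso_dsum_commute rep_iso_refl)
  have "rep_iso H (rep_sum (\<rho> # \<rho>s)) (rep_sum ((as @ [\<rho>]) @ bs))"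
    by (rule rep_iso_trans[OF H _ _ _ a b]; rule rs) (use set in auto)
  then show ?case by (simp add: \<sigma>s)
qed

lemma rep_sum_map_cong:
  assumes H: "group H" and "\<And>\<rho>. \<rho> \<in> set \<rho>s \<Longrightarrow> representation H \<rho> \<and> representation H (f \<rho>) \<and> rep_iso H \<rho> (f \<rho>)"
  shows "rep_iso H (rep_sum \<rho>s) (rep_sum (map f \<rho>s))"
  using assms(2)
proof (induction \<rho>s)
  case Nil
  then show ?case using rep_iso_refl[OF H representation_sum[OF H, of "[]"]] by simp
next
  case (Cons \<rho> \<rho>s)
  then have "representation H (rep_sum \<rho>s)" "representation H (rep_sum (map f \<rho>s))"
    by (auto intro!: representation_sum[OF H])
  then show ?case using Cons.IH Cons.prems Cons.prems[of \<rho>] by (simp add: rep_sum_Cons rep_iso_dsum[OF H])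
qed

text \<open>The sum in \<open>mckay_mult\<close> lists its blocks by increasing index. As a multiset
  it is the image of the multiset \<open>M\<close> of indices, so multiplicities become
  counts.\<close>

lemma mset_concat_replicate:
  assumes "set_mset M \<subseteq> {..<n}"
  shows "mset (concat (map (\<lambda>j. replicate (count M j) (f j)) [0..<n])) = image_mset f M"
proof -
  have "mset (concat (map (\<lambda>j. replicate (count M j) j) [0..<n])) = filter_mset (\<lambda>j. j < n) M"
    by (induction n) (auto intro!: multiset_eqI simp: less_Suc_eq)
  also have "\<dots> = M" using assms by (auto simp: filter_mset_eq_conv)
  finally have "image_mset f (mset (concat (map (\<lambda>j. replicate (count M j) j) [0..<n]))) = image_mset f M"
    by simp
  then show ?thesis by (simp flip: mset_map add: map_concat comp_def)
qed

text \<open>Every constituent is replaced by the listed representation isomorphic to it, and the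
  multiplicity of \<open>j\<close> is the number of constituents sent to \<open>j\<close>. This
  makes the choice in \<open>mckay_mult\<close> meaningful.\<close>

lemma exists_multiplicities:
  assumes H: "group H" and fin: "finite (carrier H)" and \<sigma>: "representation H \<sigma>" and S: "complete_irreps H S"
  shows "\<exists>a. rep_iso H \<sigma> (rep_sum (concat (map (\<lambda>j. replicate (a j) (S ! j)) [0..<length S])))"
proof -
  obtain \<rho>s where \<rho>s: "\<forall>\<rho>\<in>set \<rho>s. irreducible_rep H \<rho>" "rep_iso H \<sigma> (rep_sum \<rho>s)"
    using complete_reducibility[OF H fin \<sigma>] by blast
  have "\<forall>\<rho>\<in>set \<rho>s. \<exists>i<length S. rep_iso H \<rho> (S ! i)"
    using \<rho>s S unfolding complete_irreps_def by blast
  then obtain ix where ix: "\<And>\<rho>. \<rho> \<in> set \<rho>s \<Longrightarrow> ix \<rho> < length S \<and> rep_iso H \<rho> (S ! ix \<rho>)"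
    by metis
  let ?f = "\<lambda>\<rho>. S ! ix \<rho>"
  define M where "M = mset (map ix \<rho>s)"
  let ?xs = "concat (map (\<lambda>j. replicate (count M j) (S ! j)) [0..<length S])"
  have "mset ?xs = image_mset ((!) S) M"
    by (rule mset_concat_replicate) (use ix in \<open>auto simp: M_def\<close>)
  then have m: "mset (map ?f \<rho>s) = mset ?xs" by (simp add: M_def multiset.map_comp comp_def)
  have irr: "\<forall>j<length S. representation H (S ! j)" "\<forall>\<rho>\<in>set \<rho>s. representation H \<rho>"
    using S \<rho>s irreducible_repD(1) nth_mem unfolding complete_irreps_def by blast+
  have R: "representation H (rep_sum \<rho>s)" "representation H (rep_sum (map ?f \<rho>s))" "representation H (rep_sum ?xs)"
    by (rule representation_sum[OF H]; use irr ix in auto)+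
  have "rep_iso H (rep_sum \<rho>s) (rep_sum (map ?f \<rho>s))"
    by (rule rep_sum_map_cong[OF H]) (use irr ix in blast)
  moreover have "rep_iso H (rep_sum (map ?f \<rho>s)) (rep_sum ?xs)"
    by (rule rep_sum_mset_cong[OF H m]) (use irr ix in auto)
  ultimately have "rep_iso H \<sigma> (rep_sum ?xs)"
    using rep_iso_trans[OF H] \<rho>s(2) \<sigma> R by blast
  then show ?thesis by blast
qed

section \<open>Tensor products and their characters\<close>

lemma sum_div_mod:
  fixes f :: "nat \<Rightarrow> nat \<Rightarrow> 'a :: comm_monoid_add"
  shows "(\<Sum>i<a * b. f (i div b) (i mod b)) = (\<Sum>p<a. \<Sum>q<b. f p q)"
proof (induction a)
  case (Suc a)
  have add: "(\<Sum>i<n + k. g i) = (\<Sum>i<n. g i) + (\<Sum>i<k. g (n + i))" for n k and g :: "nat \<Rightarrow> 'a"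
    by (induction k) (simp_all add: add.assoc)
  have "(\<Sum>i<Suc a * b. f (i div b) (i mod b)) =
    (\<Sum>i<a * b. f (i div b) (i mod b)) + (\<Sum>q<b. f ((a * b + q) div b) ((a * b + q) mod b))"
    using add[of "\<lambda>i. f (i div b) (i mod b)" "a * b" b] by (simp add: add.commute)
  also have "(\<Sum>q<b. f ((a * b + q) div b) ((a * b + q) mod b)) = (\<Sum>q<b. f a q)"
    by (intro sum.cong) auto
  finally show ?case by (simp add: Suc)
qed simp

lemma kronecker_carrier [simp]:
  "A \<in> carrier_mat a b \<Longrightarrow> B \<in> carrier_mat c d \<Longrightarrow> kronecker A B \<in> carrier_mat (a * c) (b * d)"
  by (simp add: kronecker_def)

lemma div_mod_less:
  fixes i a b :: nat
  assumes "i < a * b" shows "i div b < a" "i mod b < b"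
  using assms by (auto simp: less_mult_imp_div_less) (metis mod_less_divisor mult_0_right not_gr_zero not_less_zero)

lemma kronecker_mult:
  assumes "A \<in> carrier_mat a a" "B \<in> carrier_mat b b" "C \<in> carrier_mat a a" "D \<in> carrier_mat b b"
  shows "kronecker (A * C) (B * D) = kronecker A B * kronecker C D"
proof (rule eq_matI)
  fix i j assume "i < dim_row (kronecker A B * kronecker C D)" "j < dim_col (kronecker A B * kronecker C D)"
  then have ij: "i < a * b" "j < a * b" using assms by (simp_all add: kronecker_def)
  note d = div_mod_less[OF ij(1)] div_mod_less[OF ij(2)]
  have "(kronecker A B * kronecker C D) $$ (i, j) = (\<Sum>s<a * b. kronecker A B $$ (i, s) * kronecker C D $$ (s, j))"
    using assms ij by (intro mult_mat_index) auto
  also have "\<dots> = (\<Sum>s<a * b. A $$ (i div b, s div b) * B $$ (i mod b, s mod b) * (C $$ (s div b, j div b) * D $$ (s mod b, j mod b)))"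
    using assms ij by (intro sum.cong) (auto simp: kronecker_def)
  also have "\<dots> = (\<Sum>p<a. \<Sum>q<b. A $$ (i div b, p) * B $$ (i mod b, q) * (C $$ (p, j div b) * D $$ (q, j mod b)))"
    by (rule sum_div_mod)
  also have "\<dots> = (\<Sum>p<a. A $$ (i div b, p) * C $$ (p, j div b)) * (\<Sum>q<b. B $$ (i mod b, q) * D $$ (q, j mod b))"
    by (simp add: sum_product mult_ac)
  also have "\<dots> = (A * C) $$ (i div b, j div b) * (B * D) $$ (i mod b, j mod b)"
    using mult_mat_index[OF assms(1,3) d(1,3)] mult_mat_index[OF assms(2,4) d(2,4)] by simp
  finally show "kronecker (A * C) (B * D) $$ (i, j) = (kronecker A B * kronecker C D) $$ (i, j)"
    using assms ij by (simp add: kronecker_def)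
qed (use assms in \<open>auto simp: kronecker_def\<close>)

lemma representation_tensor:
  assumes H: "group H" and \<rho>: "representation H \<rho>" and \<sigma>: "representation H \<sigma>"
  shows "representation H (rep_tensor \<rho> \<sigma>)"
proof -
  note c = representation_closed[OF H \<rho>] representation_closed[OF H \<sigma>]
  have one: "kronecker (1\<^sub>m a) (1\<^sub>m b) = 1\<^sub>m (a * b)" for a b
  proof (rule eq_matI)
    fix i j :: nat assume "i < dim_row (1\<^sub>m (a * b) :: complex mat)" "j < dim_col (1\<^sub>m (a * b) :: complex mat)"
    then have ij: "i < a * b" "j < a * b" by simp_all
    have "i div b = j div b \<Longrightarrow> i mod b = j mod b \<Longrightarrow> i = j" by (metis div_mult_mod_eq)
    then show "kronecker (1\<^sub>m a) (1\<^sub>m b) $$ (i, j) = 1\<^sub>m (a * b) $$ (i, j)"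
      using ij div_mod_less[OF ij(1)] div_mod_less[OF ij(2)] by (auto simp: kronecker_def)
  qed (auto simp: kronecker_def)
  show ?thesis
    unfolding representation_iff[OF H] rep_tensor_def fst_conv snd_conv
    using c by (auto simp: kronecker_mult[of _ "fst \<rho>" _ "fst \<sigma>"] representation_mult[OF H \<rho>] representation_mult[OF H \<sigma>]
      representation_one[OF H \<rho>] representation_one[OF H \<sigma>] one)
qed

lemma rep_char_tensor:
  assumes H: "group H" and \<rho>: "representation H \<rho>" and \<sigma>: "representation H \<sigma>" and g: "g \<in> carrier H"
  shows "rep_char H (rep_tensor \<rho> \<sigma>) g = rep_char H \<rho> g * rep_char H \<sigma> g"
proof -
  note c = representation_closed[OF H \<rho> g] representation_closed[OF H \<sigma> g]
  let ?a = "fst \<rho>" and ?b = "fst \<sigma>"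
  have "(\<Sum>i<?a * ?b. kronecker (snd \<rho> g) (snd \<sigma> g) $$ (i, i)) =
    (\<Sum>i<?a * ?b. snd \<rho> g $$ (i div ?b, i div ?b) * snd \<sigma> g $$ (i mod ?b, i mod ?b))"
    using c by (intro sum.cong) (auto simp: kronecker_def)
  also have "\<dots> = (\<Sum>p<?a. \<Sum>q<?b. snd \<rho> g $$ (p, p) * snd \<sigma> g $$ (q, q))"
    by (rule sum_div_mod)
  finally show ?thesis using g by (simp add: rep_char_def rep_tensor_def sum_product)
qed

text \<open>Passing to characters turns the isomorphisms behind the choice of
  \<open>mckay_mult\<close> into a linear identity. Together with the uniqueness of coefficients, it
  is the only access to the multiplicities in the later arguments.\<close>

lemma mckay_mult_char:
  assumes H: "group H" and fin: "finite (carrier H)" and V: "representation H V" and S: "complete_irreps H S"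
    and i: "i < length S" and g: "g \<in> carrier H"
  shows "rep_char H V g * rep_char H (S ! i) g =
    (\<Sum>j<length S. of_nat (mckay_mult H V S i j) * rep_char H (S ! j) g)"
proof -
  have irr: "\<forall>j<length S. representation H (S ! j)"
    using S irreducible_repD(1) nth_mem unfolding complete_irreps_def by blast
  let ?P = "\<lambda>a. \<forall>i<length S. rep_iso H (rep_tensor V (S ! i))
        (rep_sum (concat (map (\<lambda>j. replicate (a i j) (S ! j)) [0..<length S])))"
  have "\<forall>i<length S. \<exists>a. rep_iso H (rep_tensor V (S ! i))
        (rep_sum (concat (map (\<lambda>j. replicate (a j) (S ! j)) [0..<length S])))"
    using irr V exists_multiplicities[OF H fin representation_tensor[OF H] S] by blast
  then have "\<exists>a. ?P a" by metis
  then have "?P (mckay_mult H V S)" unfolding mckay_mult_def by (rule someI_ex)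
  with i have iso: "rep_iso H (rep_tensor V (S ! i))
        (rep_sum (concat (map (\<lambda>j. replicate (mckay_mult H V S i j) (S ! j)) [0..<length S])))"
    (is "rep_iso H ?t (rep_sum ?xs)") by blast
  have xs: "\<And>\<rho>. \<rho> \<in> set ?xs \<Longrightarrow> representation H \<rho>" using irr by auto
  have Si: "representation H (S ! i)" using irr i by simp
  have "rep_char H V g * rep_char H (S ! i) g = rep_char H ?t g"
    using rep_char_tensor[OF H V Si g] by simp
  also have "\<dots> = rep_char H (rep_sum ?xs) g"
    using rep_char_iso[OF H representation_tensor[OF H V Si] representation_sum[OF H xs] iso] by simp
  also have "\<dots> = (\<Sum>\<rho>\<leftarrow>?xs. rep_char H \<rho> g)"
    using rep_char_sum[OF H xs g] .
  also have "\<dots> = (\<Sum>j\<leftarrow>[0..<length S]. of_nat (mckay_mult H V S i j) * rep_char H (S ! j) g)"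
  proof -
    have "(\<Sum>\<rho>\<leftarrow>concat (map (\<lambda>j. replicate (a j) (S ! j)) js). rep_char H \<rho> g) =
      (\<Sum>j\<leftarrow>js. of_nat (a j) * rep_char H (S ! j) g)" for a js
      by (induction js) (simp_all add: sum_list_replicate)
    then show ?thesis .
  qed
  also have "\<dots> = (\<Sum>j<length S. of_nat (mckay_mult H V S i j) * rep_char H (S ! j) g)"
    by (simp add: interv_sum_list_conv_sum_set_nat lessThan_atLeast0)
  finally show ?thesis .
qed

section \<open>Coverings of quivers by free group actions\<close>

text \<open>Bijectivity of \<open>\<phi> g\<close> follows from the inverse
  \<open>\<phi> (inv g)\<close>. The condition on extensionality reflects that
  \<open>BijGroup\<close> consists of functions that are undefined outside \<open>E\<close>.\<close>

lemma group_actionI: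
  assumes G: "group G"
    and ext: "\<And>g. g \<in> carrier G \<Longrightarrow> \<phi> g \<in> extensional E"
    and closed: "\<And>g x. g \<in> carrier G \<Longrightarrow> x \<in> E \<Longrightarrow> \<phi> g x \<in> E"
    and mult: "\<And>g h x. g \<in> carrier G \<Longrightarrow> h \<in> carrier G \<Longrightarrow> x \<in> E \<Longrightarrow> \<phi> (g \<otimes>\<^bsub>G\<^esub> h) x = \<phi> g (\<phi> h x)"
    and one: "\<And>x. x \<in> E \<Longrightarrow> \<phi> \<one>\<^bsub>G\<^esub> x = x"
  shows "group_action G E \<phi>"
proof -
  interpret group G by fact
  have Bij: "\<phi> g \<in> Bij E" if g: "g \<in> carrier G" for g
  proof -
    have "bij_betw (\<phi> g) E E"
      by (rule bij_betwI[of _ _ _ "\<phi> (inv\<^bsub>G\<^esub> g)"])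
        (use g closed one mult[of g "inv\<^bsub>G\<^esub> g"] mult[of "inv\<^bsub>G\<^esub> g" g] in auto)
    then show ?thesis using ext[OF g] by (simp add: Bij_def)
  qed
  have "\<phi> (g \<otimes>\<^bsub>G\<^esub> h) = compose E (\<phi> g) (\<phi> h)" if gh: "g \<in> carrier G" "h \<in> carrier G" for g h
    by (rule extensionalityI[of _ E]) (use gh ext mult in \<open>auto simp: compose_def\<close>)
  then have "\<phi> \<in> hom G (BijGroup E)"
    using Bij by (auto simp: hom_def BijGroup_def)
  then show ?thesis
    using G group_BijGroup by (simp add: group_action_def group_hom_def group_hom_axioms_def)
qed

text \<open>The shape of \<open>mckay_quiver\<close> with an arbitrary matrix of multiplicities, so
  that the covering can be built by pure combinatorics.\<close>

definition mult_quiver :: "nat \<Rightarrow> (nat \<Rightarrow> nat \<Rightarrow> nat) \<Rightarrow> (nat, nat \<times> nat \<times> nat) pre_digraph" where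
  "mult_quiver n a = \<lparr>verts = {..<n}, arcs = {(i, j, k). i < n \<and> j < n \<and> k < a i j},
     tail = (\<lambda>(i, j, k). i), head = (\<lambda>(i, j, k). j)\<rparr>"

text \<open>By freeness exactly one group element moves a given arrow to an arrow starting at the
  representative of its fibre. The arrows from a representative over \<open>r\<close> into the fibre
  over \<open>r'\<close> number \<open>b r r'\<close>, so they can be matched with the arrows from
  \<open>r\<close> to \<open>r'\<close>; every other arrow goes where its translate goes. The map is
  then constant on orbits by construction.\<close>

lemma regular_covering_of_free_action:
  assumes \<Gamma>: "group \<Gamma>" and act: "group_action \<Gamma> {..<n} \<phi>"
    and inv: "\<And>\<gamma> i j. \<gamma> \<in> carrier \<Gamma> \<Longrightarrow> i < n \<Longrightarrow> j < n \<Longrightarrow> a (\<phi> \<gamma> i) (\<phi> \<gamma> j) = a i j"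
    and \<pi>: "\<pi> ` {..<n} = {..<n'}"
    and orb: "\<And>i. i < n \<Longrightarrow> orbit \<Gamma> \<phi> i = {i'. i' < n \<and> \<pi> i' = \<pi> i}"
    and free: "\<And>\<gamma> i. \<gamma> \<in> carrier \<Gamma> \<Longrightarrow> i < n \<Longrightarrow> \<phi> \<gamma> i = i \<Longrightarrow> \<gamma> = \<one>\<^bsub>\<Gamma>\<^esub>"
    and b: "\<And>i j'. i < n \<Longrightarrow> j' < n' \<Longrightarrow> b (\<pi> i) j' = (\<Sum>j | j < n \<and> \<pi> j = j'. a i j)"
  shows "\<exists>\<pi>a. regular_covering \<Gamma> (mult_quiver n a) (mult_quiver n' b) \<pi> \<pi>a"
proof -
  interpret group \<Gamma> by fact
  interpret A: group_action \<Gamma> "{..<n}" \<phi> by fact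
  let ?Q = "mult_quiver n a" and ?Q' = "mult_quiver n' b"
  have \<phi>_closed: "\<phi> \<gamma> i < n" if "\<gamma> \<in> carrier \<Gamma>" "i < n" for \<gamma> i
    using A.element_image[OF that(1), of i] that(2) by auto
  have \<phi>_mult: "\<phi> (\<gamma> \<otimes>\<^bsub>\<Gamma>\<^esub> \<delta>) i = \<phi> \<gamma> (\<phi> \<delta> i)" if "\<gamma> \<in> carrier \<Gamma>" "\<delta> \<in> carrier \<Gamma>" "i < n" for \<gamma> \<delta> i
    using A.composition_rule[of i \<gamma> \<delta>] that by simp
  have \<phi>_one: "\<phi> \<one>\<^bsub>\<Gamma>\<^esub> i = i" if "i < n" for i
    using A.id_eq_one that by (metis lessThan_iff restrict_apply')
  have \<phi>_inv: "\<phi> (inv\<^bsub>\<Gamma>\<^esub> \<gamma>) (\<phi> \<gamma> i) = i" "\<phi> \<gamma> (\<phi> (inv\<^bsub>\<Gamma>\<^esub> \<gamma>) i) = i" if "\<gamma> \<in> carrier \<Gamma>" "i < n" for \<gamma> i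
    using \<phi>_mult[of "inv\<^bsub>\<Gamma>\<^esub> \<gamma>" \<gamma> i] \<phi>_mult[of \<gamma> "inv\<^bsub>\<Gamma>\<^esub> \<gamma>" i] \<phi>_one that by simp_all
  have \<phi>_\<pi>: "\<pi> (\<phi> \<gamma> i) = \<pi> i" if "\<gamma> \<in> carrier \<Gamma>" "i < n" for \<gamma> i
    using orb[OF that(2)] that by (auto simp: orbit_def)
  have \<phi>_eqD: "\<gamma> = \<delta>" if "\<gamma> \<in> carrier \<Gamma>" "\<delta> \<in> carrier \<Gamma>" "i < n" "\<phi> \<gamma> i = \<phi> \<delta> i" for \<gamma> \<delta> i
  proof -
    have "\<phi> (inv\<^bsub>\<Gamma>\<^esub> \<delta> \<otimes>\<^bsub>\<Gamma>\<^esub> \<gamma>) i = i" using that \<phi>_mult \<phi>_inv by simp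
    then have "inv\<^bsub>\<Gamma>\<^esub> \<delta> \<otimes>\<^bsub>\<Gamma>\<^esub> \<gamma> = \<one>\<^bsub>\<Gamma>\<^esub>" using free[of "inv\<^bsub>\<Gamma>\<^esub> \<delta> \<otimes>\<^bsub>\<Gamma>\<^esub> \<gamma>" i] that by simp
    then show ?thesis using that by (metis inv_closed inv_equality inv_inv)
  qed
  have transitive: "\<exists>\<gamma>\<in>carrier \<Gamma>. \<phi> \<gamma> i = j" if "i < n" "j < n" "\<pi> i = \<pi> j" for i j
  proof -
    have "j \<in> orbit \<Gamma> \<phi> i" using orb[of i] that by simp
    then show ?thesis by (auto simp: orbit_def)
  qed
  have \<pi>_less: "\<pi> i < n'" if "i < n" for i using \<pi> that by auto
  \<comment> \<open>A representative in each fibre.\<close>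
  define s where "s r = (SOME i. i < n \<and> \<pi> i = r)" for r
  have s: "s r < n" "\<pi> (s r) = r" if "r < n'" for r
  proof -
    have "\<exists>i. i < n \<and> \<pi> i = r" using \<pi> that by (metis imageE lessThan_iff)
    from someI_ex[OF this] show "s r < n" "\<pi> (s r) = r" by (simp_all add: s_def)
  qed
  \<comment> \<open>The group element that carries the representative of the fibre of
    \<open>i\<close> to \<open>i\<close>; freeness makes it unique, and hence equivariant in
    \<open>i\<close>.\<close>
  define t where "t i = (SOME \<gamma>. \<gamma> \<in> carrier \<Gamma> \<and> \<phi> \<gamma> (s (\<pi> i)) = i)" for i
  have t: "t i \<in> carrier \<Gamma>" "\<phi> (t i) (s (\<pi> i)) = i" if "i < n" for i
  proof -
    have "\<exists>\<gamma>. \<gamma> \<in> carrier \<Gamma> \<and> \<phi> \<gamma> (s (\<pi> i)) = i"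
      using transitive[of "s (\<pi> i)" i] s \<pi>_less that by blast
    from someI_ex[OF this] show "t i \<in> carrier \<Gamma>" "\<phi> (t i) (s (\<pi> i)) = i" by (simp_all add: t_def)
  qed
  have tI: "t i = \<gamma>" if "i < n" "\<gamma> \<in> carrier \<Gamma>" "\<phi> \<gamma> (s (\<pi> i)) = i" for i \<gamma>
    using \<phi>_eqD[of "t i" \<gamma> "s (\<pi> i)"] t[OF that(1)] s \<pi>_less that by simp
  have t_\<phi>: "t (\<phi> \<gamma> i) = \<gamma> \<otimes>\<^bsub>\<Gamma>\<^esub> t i" if "\<gamma> \<in> carrier \<Gamma>" "i < n" for \<gamma> i
    using that t[OF that(2)] s \<pi>_less \<phi>_\<pi> \<phi>_closed \<phi>_mult by (intro tI) simp_all
  have t_inv: "\<phi> (inv\<^bsub>\<Gamma>\<^esub> (t i)) i = s (\<pi> i)" if "i < n" for i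
    using \<phi>_inv(1)[OF t(1)[OF that], of "s (\<pi> i)"] t[OF that] s \<pi>_less that by simp
  \<comment> \<open>The arrows from the representative over \<open>r\<close> into the fibre over
    \<open>r'\<close>, recorded by head and index; the tail is understood.\<close>
  define out where "out r r' = {(j, k). j < n \<and> \<pi> j = r' \<and> k < a (s r) j}" for r r'
  have out: "finite (out r r')" "card (out r r') = b r r'" if "r < n'" "r' < n'" for r r'
  proof -
    have eq: "out r r' = (SIGMA j:{j. j < n \<and> \<pi> j = r'}. {..<a (s r) j})" by (auto simp: out_def)
    show "finite (out r r')" unfolding eq by auto
    have "card (out r r') = (\<Sum>j | j < n \<and> \<pi> j = r'. a (s r) j)" unfolding eq by (subst card_SigmaI) auto
    then show "card (out r r') = b r r'" using b[of "s r" r'] s that by simp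
  qed
  define \<beta> where "\<beta> r r' = (SOME f. bij_betw f (out r r') {..<b r r'})" for r r'
  have \<beta>: "bij_betw (\<beta> r r') (out r r') {..<b r r'}" if "r < n'" "r' < n'" for r r'
  proof -
    have "\<exists>f. bij_betw f (out r r') {..<b r r'}"
      using ex_bij_betw_finite_nat[OF out(1)[OF that]] unfolding out(2)[OF that] lessThan_atLeast0 .
    then show ?thesis unfolding \<beta>_def by (rule someI_ex)
  qed
  define \<pi>a where "\<pi>a = (\<lambda>(i, j, k). (\<pi> i, \<pi> j, \<beta> (\<pi> i) (\<pi> j) (\<phi> (inv\<^bsub>\<Gamma>\<^esub> (t i)) j, k)))"
  \<comment> \<open>Keeping the index \<open>k\<close> is legitimate because the multiplicities are
    invariant under the action.\<close>
  define \<phi>a where "\<phi>a \<gamma> = (\<lambda>(i, j, k)\<in>arcs ?Q. (\<phi> \<gamma> i, \<phi> \<gamma> j, k))" for \<gamma>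
  have base: "(\<phi> (inv\<^bsub>\<Gamma>\<^esub> (t i)) j, k) \<in> out (\<pi> i) (\<pi> j) \<longleftrightarrow> k < a i j" if "i < n" "j < n" for i j k
    using that t[OF that(1)] t_inv[OF that(1)] \<phi>_closed \<phi>_\<pi> inv[of "inv\<^bsub>\<Gamma>\<^esub> (t i)" i j]
    by (simp add: out_def)
  have base_arc: "\<beta> (\<pi> i) (\<pi> j) (\<phi> (inv\<^bsub>\<Gamma>\<^esub> (t i)) j, k) < b (\<pi> i) (\<pi> j)" if "i < n" "j < n" "k < a i j" for i j k
    using bij_betwE[OF \<beta>[OF \<pi>_less[OF that(1)] \<pi>_less[OF that(2)]]] base[OF that(1,2)] that(3) by blast
  have \<beta>_eqD: "x = y" if "\<beta> r r' x = \<beta> r r' y" "x \<in> out r r'" "y \<in> out r r'" "r < n'" "r' < n'" for r r' x y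
    using bij_betw_imp_inj_on[OF \<beta>[OF that(4,5)]] that by (meson inj_onD)
  have \<beta>_surj: "\<exists>j k. j < n \<and> \<pi> j = r' \<and> k < a (s r) j \<and> \<beta> r r' (j, k) = l" if "r < n'" "r' < n'" "l < b r r'" for r r' l
  proof -
    have "l \<in> \<beta> r r' ` out r r'" using bij_betw_imp_surj_on[OF \<beta>[OF that(1,2)]] that(3) by simp
    then show ?thesis by (auto simp: out_def)
  qed
  have out_bij: "bij_betw \<pi>a (out_arcs ?Q i) (out_arcs ?Q' (\<pi> i))" if i: "i < n" for i
  proof -
    have oi: "out_arcs ?Q i = {(i, j, k) | j k. j < n \<and> k < a i j}"
      using i by (auto simp: out_arcs_def mult_quiver_def)
    have oi': "out_arcs ?Q' (\<pi> i) = {(\<pi> i, j, k) | j k. j < n' \<and> k < b (\<pi> i) j}"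
      using \<pi>_less[OF i] by (auto simp: out_arcs_def mult_quiver_def)
    have "inj_on \<pi>a (out_arcs ?Q i)"
    proof (rule inj_onI)
      fix e f assume "e \<in> out_arcs ?Q i" "f \<in> out_arcs ?Q i" and eq: "\<pi>a e = \<pi>a f"
      then obtain j k j' k' where e: "e = (i, j, k)" "j < n" "k < a i j" and f: "f = (i, j', k')" "j' < n" "k' < a i j'"
        by (auto simp: oi)
      have pj: "\<pi> j' = \<pi> j" using eq by (simp add: \<pi>a_def e f)
      have "\<beta> (\<pi> i) (\<pi> j) (\<phi> (inv\<^bsub>\<Gamma>\<^esub> (t i)) j, k) = \<beta> (\<pi> i) (\<pi> j) (\<phi> (inv\<^bsub>\<Gamma>\<^esub> (t i)) j', k')"
        using eq pj by (simp add: \<pi>a_def e f)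
      then have *: "\<phi> (inv\<^bsub>\<Gamma>\<^esub> (t i)) j = \<phi> (inv\<^bsub>\<Gamma>\<^esub> (t i)) j'" "k = k'"
        using \<beta>_eqD base[OF i e(2)] base[OF i f(2)] e f pj \<pi>_less i by (metis prod.inject)+
      have "j = j'"
        using \<phi>_inv(2)[OF t(1)[OF i] e(2)] \<phi>_inv(2)[OF t(1)[OF i] f(2)] unfolding *(1) by (rule trans[OF sym])
      with * show "e = f" by (simp add: e f)
    qed
    moreover have "\<pi>a ` out_arcs ?Q i = out_arcs ?Q' (\<pi> i)"
    proof (intro equalityI subsetI)
      fix x assume "x \<in> \<pi>a ` out_arcs ?Q i"
      then show "x \<in> out_arcs ?Q' (\<pi> i)" using base_arc[OF i] \<pi>_less by (auto simp: oi oi' \<pi>a_def)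
    next
      fix x assume "x \<in> out_arcs ?Q' (\<pi> i)"
      then obtain j' l where x: "x = (\<pi> i, j', l)" "j' < n'" "l < b (\<pi> i) j'" by (auto simp: oi')
      obtain j k where j: "j < n" "\<pi> j = j'" "k < a (s (\<pi> i)) j" "\<beta> (\<pi> i) j' (j, k) = l"
        using \<beta>_surj[OF \<pi>_less[OF i] x(2,3)] by blast
      have "a i (\<phi> (t i) j) = a (s (\<pi> i)) j"
        using inv[OF t(1)[OF i], of "s (\<pi> i)" j] t[OF i] s \<pi>_less[OF i] j by simp
      then have "(i, \<phi> (t i) j, k) \<in> out_arcs ?Q i" using j t[OF i] \<phi>_closed by (simp add: oi)
      moreover have "\<pi>a (i, \<phi> (t i) j, k) = x"
        using j x t[OF i] \<phi>_\<pi> \<phi>_inv(1)[OF t(1)[OF i] j(1)] by (simp add: \<pi>a_def)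
      ultimately show "x \<in> \<pi>a ` out_arcs ?Q i" by force
    qed
    ultimately show ?thesis by (simp add: bij_betw_def)
  qed
  have in_bij: "bij_betw \<pi>a (in_arcs ?Q j) (in_arcs ?Q' (\<pi> j))" if j: "j < n" for j
  proof -
    have ij: "in_arcs ?Q j = {(i, j, k) | i k. i < n \<and> k < a i j}"
      using j by (auto simp: in_arcs_def mult_quiver_def)
    have ij': "in_arcs ?Q' (\<pi> j) = {(i, \<pi> j, k) | i k. i < n' \<and> k < b i (\<pi> j)}"
      using \<pi>_less[OF j] by (auto simp: in_arcs_def mult_quiver_def)
    have "inj_on \<pi>a (in_arcs ?Q j)"
    proof (rule inj_onI)
      fix e f assume "e \<in> in_arcs ?Q j" "f \<in> in_arcs ?Q j" and eq: "\<pi>a e = \<pi>a f"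
      then obtain i k i' k' where e: "e = (i, j, k)" "i < n" "k < a i j" and f: "f = (i', j, k')" "i' < n" "k' < a i' j"
        by (auto simp: ij)
      have pi: "\<pi> i' = \<pi> i" using eq by (simp add: \<pi>a_def e f)
      have "\<beta> (\<pi> i) (\<pi> j) (\<phi> (inv\<^bsub>\<Gamma>\<^esub> (t i)) j, k) = \<beta> (\<pi> i) (\<pi> j) (\<phi> (inv\<^bsub>\<Gamma>\<^esub> (t i')) j, k')"
        using eq pi by (simp add: \<pi>a_def e f)
      then have *: "\<phi> (inv\<^bsub>\<Gamma>\<^esub> (t i)) j = \<phi> (inv\<^bsub>\<Gamma>\<^esub> (t i')) j" "k = k'"
        using \<beta>_eqD base[OF e(2) j] base[OF f(2) j] e f pi \<pi>_less j by (metis prod.inject)+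
      \<comment> \<open>Here freeness enters at the head: two group elements that agree on
        \<open>j\<close> are equal, so the tails \<open>i\<close> and \<open>i'\<close> are the same
        translate of one representative.\<close>
      have "inv\<^bsub>\<Gamma>\<^esub> (t i) = inv\<^bsub>\<Gamma>\<^esub> (t i')"
        using *(1) t(1)[OF e(2)] t(1)[OF f(2)] j by (intro \<phi>_eqD[of _ _ j]) auto
      then have "t i = t i'" using t(1)[OF e(2)] t(1)[OF f(2)] inv_inv by metis
      then have "i = i'" using t(2)[OF e(2)] t(2)[OF f(2)] pi by metis
      with * show "e = f" by (simp add: e f)
    qed
    moreover have "\<pi>a ` in_arcs ?Q j = in_arcs ?Q' (\<pi> j)"
    proof (intro equalityI subsetI)
      fix x assume "x \<in> \<pi>a ` in_arcs ?Q j"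
      then show "x \<in> in_arcs ?Q' (\<pi> j)" using base_arc[OF _ j] \<pi>_less by (auto simp: ij ij' \<pi>a_def)
    next
      fix x assume "x \<in> in_arcs ?Q' (\<pi> j)"
      then obtain i' l where x: "x = (i', \<pi> j, l)" "i' < n'" "l < b i' (\<pi> j)" by (auto simp: ij')
      obtain j0 k where j0: "j0 < n" "\<pi> j0 = \<pi> j" "k < a (s i') j0" "\<beta> i' (\<pi> j) (j0, k) = l"
        using \<beta>_surj[OF x(2) \<pi>_less[OF j] x(3)] by blast
      \<comment> \<open>The base arrow ends at \<open>j0\<close> but has to end at \<open>j\<close>;
        moving \<open>j0\<close> to \<open>j\<close> also determines the tail of the
        preimage.\<close>
      obtain \<gamma> where \<gamma>: "\<gamma> \<in> carrier \<Gamma>" "\<phi> \<gamma> j0 = j" using transitive[OF j0(1) j j0(2)] by blast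
      define i where "i = \<phi> \<gamma> (s i')"
      have i: "i < n" "\<pi> i = i'" using \<gamma> s[OF x(2)] \<phi>_closed \<phi>_\<pi> by (simp_all add: i_def)
      have ti: "t i = \<gamma>" using i \<gamma> by (intro tI) (simp_all add: i_def)
      have "a i j = a (s i') j0" using inv[OF \<gamma>(1), of "s i'" j0] s[OF x(2)] j0 \<gamma> by (simp add: i_def)
      then have "(i, j, k) \<in> in_arcs ?Q j" using i j0 by (simp add: ij)
      moreover have "\<pi>a (i, j, k) = x"
        using \<phi>_inv(1)[OF \<gamma>(1) j0(1)] \<gamma>(2) i ti j0 x by (simp add: \<pi>a_def)
      ultimately show "x \<in> \<pi>a ` in_arcs ?Q j" by force
    qed
    ultimately show ?thesis by (simp add: bij_betw_def)
  qed
  have arcs: "arcs ?Q = {(i, j, k). i < n \<and> j < n \<and> k < a i j}" by (simp add: mult_quiver_def)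
  have act_a: "group_action \<Gamma> (arcs ?Q) \<phi>a"
  proof (rule group_actionI[OF \<Gamma>])
    fix \<gamma> e assume "\<gamma> \<in> carrier \<Gamma>" "e \<in> arcs ?Q"
    then show "\<phi>a \<gamma> e \<in> arcs ?Q" using \<phi>_closed inv by (auto simp: \<phi>a_def arcs)
  next
    fix \<gamma> \<delta> e assume "\<gamma> \<in> carrier \<Gamma>" "\<delta> \<in> carrier \<Gamma>" "e \<in> arcs ?Q"
    then show "\<phi>a (\<gamma> \<otimes>\<^bsub>\<Gamma>\<^esub> \<delta>) e = \<phi>a \<gamma> (\<phi>a \<delta> e)"
      using \<phi>_closed \<phi>_mult inv by (auto simp: \<phi>a_def arcs)
  next
    fix e assume "e \<in> arcs ?Q"
    then show "\<phi>a \<one>\<^bsub>\<Gamma>\<^esub> e = e" using \<phi>_one by (auto simp: \<phi>a_def arcs)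
  qed (simp add: \<phi>a_def)
  have quiver_\<phi>: "quiver_map ?Q ?Q (\<phi> \<gamma>) (\<phi>a \<gamma>)" if "\<gamma> \<in> carrier \<Gamma>" for \<gamma>
    using that \<phi>_closed inv by (auto simp: quiver_map_def mult_quiver_def \<phi>a_def)
  have inv_\<pi>a: "\<pi>a (\<phi>a \<gamma> e) = \<pi>a e" if \<gamma>: "\<gamma> \<in> carrier \<Gamma>" and e: "e \<in> arcs ?Q" for \<gamma> e
  proof -
    obtain i j k where ijk: "e = (i, j, k)" "i < n" "j < n" using e by (auto simp: arcs)
    \<comment> \<open>By equivariance \<open>t (\<phi> \<gamma> i)\<close> is the product of
      \<open>\<gamma>\<close> and \<open>t i\<close>, so \<open>\<gamma>\<close> cancels and both
      arrows have the same base arrow.\<close>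
    have "\<phi> (inv\<^bsub>\<Gamma>\<^esub> (t (\<phi> \<gamma> i))) (\<phi> \<gamma> j) = \<phi> (inv\<^bsub>\<Gamma>\<^esub> (t i)) j"
      using \<gamma> ijk t(1)[OF ijk(2)] \<phi>_inv \<phi>_closed \<phi>_mult
      by (simp add: t_\<phi> inv_mult_group)
    then show ?thesis using \<gamma> ijk e \<phi>_\<pi> by (simp add: \<pi>a_def \<phi>a_def)
  qed
  have "regular_covering \<Gamma> ?Q ?Q' \<pi> \<pi>a"
    unfolding regular_covering_def
  proof (intro conjI exI[of _ \<phi>] exI[of _ \<phi>a] ballI)
    show "quiver_map ?Q ?Q' \<pi> \<pi>a"
      using \<pi>_less base_arc by (auto simp: quiver_map_def mult_quiver_def \<pi>a_def)
    show "\<pi> ` verts ?Q = verts ?Q'" using \<pi> by (simp add: mult_quiver_def)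
    show "group_action \<Gamma> (verts ?Q) \<phi>" using act by (simp add: mult_quiver_def)
  next
    fix j i assume "j \<in> verts ?Q'" "i \<in> {i \<in> verts ?Q. \<pi> i = j}"
    then have i: "i < n" "\<pi> i = j" by (simp_all add: mult_quiver_def)
    show "orbit \<Gamma> \<phi> i = {i \<in> verts ?Q. \<pi> i = j}" using orb[OF i(1)] i by (simp add: mult_quiver_def)
    show "stabilizer \<Gamma> \<phi> i = {\<one>\<^bsub>\<Gamma>\<^esub>}" using free i \<phi>_one by (auto simp: stabilizer_def)
  qed (use out_bij in_bij act_a quiver_\<phi> inv_\<pi>a \<phi>_\<pi> in \<open>simp_all add: mult_quiver_def\<close>)
  then show ?thesis by blast
qed

section \<open>Complete sets of irreducible characters\<close>

lemma char_inner_irreps: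
  assumes H: "group H" and S: "complete_irreps H S" and ij: "i < length S" "j < length S"
  shows "char_inner H (rep_char H (S ! i)) (rep_char H (S ! j)) = (if i = j then of_nat (card (carrier H)) else 0)"
proof -
  have irr: "irreducible_rep H (S ! i)" "irreducible_rep H (S ! j)"
    and "i \<noteq> j \<Longrightarrow> \<not> rep_iso H (S ! j) (S ! i)"
    using S ij nth_mem unfolding complete_irreps_def by (blast, blast, metis)
  then show ?thesis using char_norm[OF H irr(1)] char_orthogonal[OF H irr(2,1)] by auto
qed

lemma irreducible_char_in_list:
  assumes H: "group H" and S: "complete_irreps H S" and \<rho>: "irreducible_rep H \<rho>"
  shows "\<exists>i<length S. rep_char H \<rho> = rep_char H (S ! i)"
proof -
  obtain i where "i < length S" "rep_iso H \<rho> (S ! i)"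
    using S \<rho> unfolding complete_irreps_def by blast
  moreover from this have "irreducible_rep H (S ! i)" using S nth_mem unfolding complete_irreps_def by blast
  ultimately show ?thesis using rep_char_iso[OF H] irreducible_repD(1) \<rho> by metis
qed

lemma irreps_char_inject:
  assumes H: "group H" and fin: "finite (carrier H)" and S: "complete_irreps H S"
    and ij: "i < length S" "j < length S" and eq: "\<And>g. g \<in> carrier H \<Longrightarrow> rep_char H (S ! i) g = rep_char H (S ! j) g"
  shows "i = j"
proof (rule ccontr)
  interpret group H by fact
  assume "i \<noteq> j"
  have "char_inner H (rep_char H (S ! i)) (rep_char H (S ! j)) = char_inner H (rep_char H (S ! j)) (rep_char H (S ! j))"
    by (simp add: char_inner_def eq)
  then have "card (carrier H) = 0"
    using char_inner_irreps[OF H S] ij \<open>i \<noteq> j\<close> by simp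
  then show False using fin by auto
qed

text \<open>Linear independence of the irreducible characters: the inner product with one of them
  isolates its coefficient. It serves to read off multiplicities from equations between
  functions.\<close>

lemma char_coeff_unique:
  assumes H: "group H" and fin: "finite (carrier H)" and S: "complete_irreps H S"
    and eq: "\<And>g. g \<in> carrier H \<Longrightarrow>
      (\<Sum>j<length S. c j * rep_char H (S ! j) g) = (\<Sum>j<length S. d j * rep_char H (S ! j) g)"
    and k: "k < length S"
  shows "c k = d k"
proof -
  interpret group H by fact
  have inner: "char_inner H (\<lambda>g. \<Sum>j<length S. e j * rep_char H (S ! j) g) (rep_char H (S ! k)) =
    e k * of_nat (card (carrier H))" for e
  proof -
    have "char_inner H (\<lambda>g. \<Sum>j<length S. e j * rep_char H (S ! j) g) (rep_char H (S ! k)) =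
      (\<Sum>j<length S. e j * char_inner H (rep_char H (S ! j)) (rep_char H (S ! k)))"
      unfolding char_inner_def sum_distrib_right sum_distrib_left by (subst sum.swap) (simp add: mult.assoc)
    also have "\<dots> = (\<Sum>j<length S. if j = k then e k * of_nat (card (carrier H)) else 0)"
      using char_inner_irreps[OF H S _ k] by (intro sum.cong) auto
    finally show ?thesis using k by simp
  qed
  have "char_inner H (\<lambda>g. \<Sum>j<length S. c j * rep_char H (S ! j) g) (rep_char H (S ! k)) =
    char_inner H (\<lambda>g. \<Sum>j<length S. d j * rep_char H (S ! j) g) (rep_char H (S ! k))"
    unfolding char_inner_def using eq by simp
  moreover have "card (carrier H) \<noteq> 0" using fin by auto
  ultimately show ?thesis unfolding inner by simp
qed

text \<open>The tensor product with the one-dimensional representation \<open>\<chi>\<close>,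
  written as a scalar multiple.\<close>

definition rep_twist :: "('g \<Rightarrow> complex) \<Rightarrow> 'g rep \<Rightarrow> 'g rep" where
  "rep_twist \<chi> \<rho> = (fst \<rho>, \<lambda>g. \<chi> g \<cdot>\<^sub>m snd \<rho> g)"

text \<open>Multiplying by the nonzero scalars \<open>\<chi> g\<close> leaves the invariant
  subspaces unchanged.\<close>

lemma
  assumes H: "group H" and \<rho>: "irreducible_rep H \<rho>"
    and mult: "\<And>g h. g \<in> carrier H \<Longrightarrow> h \<in> carrier H \<Longrightarrow> \<chi> (g \<otimes>\<^bsub>H\<^esub> h) = \<chi> g * \<chi> h"
    and nz: "\<And>g. g \<in> carrier H \<Longrightarrow> \<chi> g \<noteq> 0"
  shows irreducible_twist: "irreducible_rep H (rep_twist \<chi> \<rho>)"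
    and rep_char_twist: "\<And>g. g \<in> carrier H \<Longrightarrow> rep_char H (rep_twist \<chi> \<rho>) g = \<chi> g * rep_char H \<rho> g"
proof -
  interpret group H by fact
  let ?d = "fst \<rho>"
  note r = irreducible_repD(1)[OF \<rho>]
  note c = representation_closed[OF H r]
  have one: "\<chi> \<one>\<^bsub>H\<^esub> = 1" using mult[of "\<one>\<^bsub>H\<^esub>" "\<one>\<^bsub>H\<^esub>"] nz[of "\<one>\<^bsub>H\<^esub>"] by simp
  have rep: "representation H (rep_twist \<chi> \<rho>)"
    unfolding representation_iff[OF H] rep_twist_def fst_conv snd_conv
  proof (intro conjI ballI)
    fix g h assume gh: "g \<in> carrier H" "h \<in> carrier H"
    show "\<chi> (g \<otimes>\<^bsub>H\<^esub> h) \<cdot>\<^sub>m snd \<rho> (g \<otimes>\<^bsub>H\<^esub> h) = \<chi> g \<cdot>\<^sub>m snd \<rho> g * (\<chi> h \<cdot>\<^sub>m snd \<rho> h)"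
      using c[OF gh(1)] c[OF gh(2)] gh
      by (simp add: mult representation_mult[OF H r] mult_smult_assoc_mat[of _ ?d ?d _ ?d] mult_smult_distrib[of _ ?d ?d _ ?d])
        (intro eq_matI; simp)
  qed (use c one representation_one[OF H r] in \<open>auto intro!: eq_matI\<close>)
  have smult: "(a \<cdot>\<^sub>m A) *\<^sub>v w = a \<cdot>\<^sub>v (A *\<^sub>v w)" if "A \<in> carrier_mat ?d ?d" "w \<in> carrier_vec ?d"
    for a :: complex and A w
    using that by (intro eq_vecI) auto
  show "irreducible_rep H (rep_twist \<chi> \<rho>)"
    unfolding irreducible_rep_def
  proof (intro conjI allI impI)
    show "representation H (rep_twist \<chi> \<rho>)" by (rule rep)
    show "0 < fst (rep_twist \<chi> \<rho>)" using irreducible_repD(2)[OF \<rho>] by (simp add: rep_twist_def)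
    fix W assume W: "VectorSpace.subspace class_ring W (module_vec TYPE(complex) (fst (rep_twist \<chi> \<rho>)))"
      and inv: "\<forall>g\<in>carrier H. \<forall>w\<in>W. snd (rep_twist \<chi> \<rho>) g *\<^sub>v w \<in> W"
    have W': "VectorSpace.subspace class_ring W (module_vec TYPE(complex) ?d)"
      using W by (simp add: rep_twist_def)
    have "snd \<rho> g *\<^sub>v w \<in> W" if gw: "g \<in> carrier H" "w \<in> W" for g w
    proof -
      have w: "w \<in> carrier_vec ?d" using W' gw unfolding subspace_module_vec by blast
      have "\<chi> g \<cdot>\<^sub>v (snd \<rho> g *\<^sub>v w) \<in> W"
        using bspec[OF bspec[OF inv gw(1)] gw(2)] smult[OF c[OF gw(1)] w] by (simp add: rep_twist_def)
      then have "inverse (\<chi> g) \<cdot>\<^sub>v (\<chi> g \<cdot>\<^sub>v (snd \<rho> g *\<^sub>v w)) \<in> W"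
        using W' unfolding subspace_module_vec by blast
      then show ?thesis using nz[OF gw(1)] by (simp add: smult_smult_assoc)
    qed
    then show "W = {0\<^sub>v (fst (rep_twist \<chi> \<rho>))} \<or> W = carrier_vec (fst (rep_twist \<chi> \<rho>))"
      using \<rho> W' by (simp add: irreducible_rep_def rep_twist_def)
  qed
  show "rep_char H (rep_twist \<chi> \<rho>) g = \<chi> g * rep_char H \<rho> g" if "g \<in> carrier H" for g
    using that c[OF that] by (simp add: rep_char_def rep_twist_def sum_distrib_left)
qed

text \<open>Multiplication by \<open>z \<in> D\<close> permutes \<open>D\<close>. Comparing the
  products over \<open>D\<close> before and after shows that \<open>z\<close> is a root of unity of
  order dividing \<open>card D\<close>; there are exactly \<open>card D\<close> of those, so the
  inclusion is an equality.\<close>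

lemma finite_mult_closed_roots_of_unity:
  fixes D :: "complex set"
  assumes fin: "finite D" and "1 \<in> D" "0 \<notin> D" and mult: "\<And>x y. x \<in> D \<Longrightarrow> y \<in> D \<Longrightarrow> x * y \<in> D"
  shows "D = {z. z ^ card D = 1}"
proof (rule card_subset_eq)
  have r: "card D > 0" using assms by (auto simp: card_gt_0_iff)
  show "finite {z :: complex. z ^ card D = 1}" using r by (intro finite_roots_unity) simp
  show "D \<subseteq> {z. z ^ card D = 1}"
  proof
    fix z assume z: "z \<in> D"
    have inj: "inj_on ((*) z) D" using z assms by (auto simp: inj_on_def)
    have "(*) z ` D = D" using fin inj z mult by (intro endo_inj_surj) auto
    then have "prod id D = prod id ((*) z ` D)" by simp
    also have "\<dots> = z ^ card D * prod id D"
      by (subst prod.reindex[OF inj]) (simp add: prod.distrib)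
    finally have "z ^ card D * prod id D = prod id D" ..
    moreover have "prod id D \<noteq> 0" using assms by (simp add: prod_zero_iff)
    ultimately show "z \<in> {z. z ^ card D = 1}" by simp
  qed
  show "card D = card {z :: complex. z ^ card D = 1}" using card_roots_unity_eq[OF r] by simp
qed

section \<open>Subgroups of the general linear group and the normal subgroup
  \<open>G \<inter> SL m\<close>\<close>

lemma carrier_GL_sub: "carrier (GL_sub m H) = H"
  and mult_GL_sub: "monoid.mult (GL_sub m H) = (*)"
  and one_GL_sub: "one (GL_sub m H) = 1\<^sub>m m"
  by (simp_all add: GL_simps)

lemma group_GL_sub: "subgroup H (GL m) \<Longrightarrow> group (GL_sub m H)"
  by (rule subgroup.subgroup_is_group[OF _ group_GL])

lemma inv_GL_sub: "subgroup H (GL m) \<Longrightarrow> h \<in> H \<Longrightarrow> inv\<^bsub>GL_sub m H\<^esub> h = inv\<^bsub>GL m\<^esub> h"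
  by (rule group.m_inv_consistent[OF group_GL])

lemma det_GL_mult: "g \<in> carrier (GL m) \<Longrightarrow> h \<in> carrier (GL m) \<Longrightarrow> det (g * h) = det g * det h"
  by (auto simp: carrier_GL det_mult)

lemma det_GL_inv:
  assumes "g \<in> carrier (GL m)"
  shows "det (inv\<^bsub>GL m\<^esub> g) = inverse (det g)"
proof -
  interpret group "GL m" by (rule group_GL)
  have "det (inv\<^bsub>GL m\<^esub> g) * det g = det (inv\<^bsub>GL m\<^esub> g * g)"
    using assms det_GL_mult inv_closed by metis
  also have "\<dots> = 1" using l_inv[OF assms] by (simp add: GL_simps)
  finally show ?thesis by (metis inverse_unique mult.commute)
qed

lemma subgroup_inter_SL:
  assumes G: "subgroup G (GL m)"
  shows "subgroup (G \<inter> SL m) (GL m)"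
proof -
  interpret subgroup G "GL m" by fact
  interpret GL: group "GL m" by (rule group_GL)
  show ?thesis
  proof
    fix x y assume xy: "x \<in> G \<inter> SL m" "y \<in> G \<inter> SL m"
    then have "x \<in> carrier (GL m)" "y \<in> carrier (GL m)" using mem_carrier by auto
    then show "x \<otimes>\<^bsub>GL m\<^esub> y \<in> G \<inter> SL m"
      using xy m_closed[of x y] det_GL_mult[of x m y] by (auto simp: GL_simps SL_def)
  next
    fix x assume x: "x \<in> G \<inter> SL m"
    then have c: "x \<in> carrier (GL m)" using mem_carrier by auto
    then show "inv\<^bsub>GL m\<^esub> x \<in> G \<inter> SL m"
      using x m_inv_closed[of x] det_GL_inv[OF c] GL.inv_closed[OF c] by (auto simp: SL_def carrier_GL)
  qed (use mem_carrier one_closed in \<open>auto simp: GL_simps SL_def\<close>)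
qed

lemma normal_inter_SL:
  assumes G: "subgroup G (GL m)"
  shows "G \<inter> SL m \<lhd> GL_sub m G"
proof -
  interpret group "GL_sub m G" using G by (rule group_GL_sub)
  have c: "x \<in> carrier (GL m)" if "x \<in> G" for x using that subgroup.mem_carrier[OF G] by blast
  have "subgroup (G \<inter> SL m) (GL_sub m G)"
    using group.subgroup_incl[OF group_GL subgroup_inter_SL[OF G] G] by simp
  moreover have "x * h * inv\<^bsub>GL_sub m G\<^esub> x \<in> G \<inter> SL m" if x: "x \<in> G" "h \<in> G \<inter> SL m" for x h
  proof -
    have i: "inv\<^bsub>GL_sub m G\<^esub> x \<in> G" using inv_closed[of x] x by (simp add: carrier_GL_sub)
    have xh: "x * h \<in> G" "x * h * inv\<^bsub>GL_sub m G\<^esub> x \<in> G"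
      using m_closed[of x h] m_closed[of "x * h" "inv\<^bsub>GL_sub m G\<^esub> x"] i x by (simp_all add: carrier_GL_sub mult_GL_sub)
    have "det (x * h * inv\<^bsub>GL_sub m G\<^esub> x) = det x * det h * inverse (det x)"
      using x det_GL_mult[OF c[OF xh(1)] c[OF i]] det_GL_mult[OF c c, of x h]
      by (simp add: inv_GL_sub[OF G] det_GL_inv c)
    then show ?thesis using x xh c[OF x(1)] c[OF xh(2)] by (simp add: SL_def carrier_GL)
  qed
  ultimately show ?thesis
    by (simp add: normal_inv_iff carrier_GL_sub mult_GL_sub)
qed

lemma representation_subgroup:
  assumes "subgroup G (GL m)" "subgroup N (GL m)" "N \<subseteq> G" "representation (GL_sub m G) \<rho>"
  shows "representation (GL_sub m N) \<rho>"
  using assms(4) assms(3)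
  unfolding representation_iff[OF group_GL_sub[OF assms(1)]] representation_iff[OF group_GL_sub[OF assms(2)]]
    carrier_GL_sub mult_GL_sub one_GL_sub
  by blast

section \<open>Twisting by powers of the determinant\<close>

locale mckay_extension =
  fixes m :: nat and G N :: "complex mat set" and S T :: "complex mat rep list"
  assumes G: "subgroup G (GL m)" and fin: "finite G" and N_eq: "N = G \<inter> SL m"
    and ext: "\<And>\<chi>. irreducible_char (GL_sub m N) \<chi> \<Longrightarrow> extendible (GL_sub m G) N \<chi>"
    and S: "complete_irreps (GL_sub m G) S" and T: "complete_irreps (GL_sub m N) T"
begin

abbreviation \<chi>G :: "nat \<Rightarrow> complex mat \<Rightarrow> complex" where
  "\<chi>G i \<equiv> rep_char (GL_sub m G) (S ! i)"

abbreviation \<chi>N :: "nat \<Rightarrow> complex mat \<Rightarrow> complex" where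
  "\<chi>N j \<equiv> rep_char (GL_sub m N) (T ! j)"

lemma N: "subgroup N (GL m)" and N_sub: "N \<subseteq> G" and finN: "finite N"
  using subgroup_inter_SL[OF G] fin by (auto simp: N_eq)

lemma grG: "group (GL_sub m G)" and grN: "group (GL_sub m N)"
  using group_GL_sub G N by blast+

lemma finite_carriers: "finite (carrier (GL_sub m G))" "finite (carrier (GL_sub m N))"
  using fin finN by simp_all

lemma G_GL: "g \<in> G \<Longrightarrow> g \<in> carrier (GL m)"
  using subgroup.mem_carrier[OF G] .

lemma G_mult: "g \<in> G \<Longrightarrow> h \<in> G \<Longrightarrow> g * h \<in> G"
  using subgroup.m_closed[OF G] by (simp add: GL_simps)

lemma one_G: "1\<^sub>m m \<in> G"
  using subgroup.one_closed[OF G] by (simp add: GL_simps)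

lemma N_iff: "g \<in> N \<longleftrightarrow> g \<in> G \<and> det g = 1"
  using G_GL by (auto simp: N_eq SL_def carrier_GL)

lemma card_N_pos: "card N \<noteq> 0"
proof -
  have "1\<^sub>m m \<in> N" using one_G by (simp add: N_iff)
  then show ?thesis using finN by auto
qed

text \<open>As \<open>N\<close> is the kernel of the determinant on \<open>G\<close>, this is the
  order of \<open>G/N\<close>, in accordance with \<open>card_G\<close>.\<close>

definition r :: nat where "r = card (det ` G)"

definition \<zeta> :: complex where "\<zeta> = cis (2 * pi / of_nat r)"

lemma r_pos: "r > 0"
  using fin one_G by (auto simp: r_def card_gt_0_iff)

lemma det_image: "det ` G = {z. z ^ r = 1}"
  unfolding r_def
proof (rule finite_mult_closed_roots_of_unity)
  show "1 \<in> det ` G" using one_G by (metis det_one imageI)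
  show "0 \<notin> det ` G" using G_GL by (auto simp: carrier_GL)
  fix x y assume "x \<in> det ` G" "y \<in> det ` G"
  then obtain g h where "g \<in> G" "x = det g" "h \<in> G" "y = det h" by blast
  then show "x * y \<in> det ` G" using det_GL_mult[OF G_GL G_GL, of g h] G_mult[of g h] by (metis imageI)
qed (use fin in simp)

lemma roots: "bij_betw (\<lambda>k. \<zeta> ^ k) {..<r} (det ` G)"
proof -
  have "\<zeta> ^ k = cis (2 * pi * of_nat k / of_nat r)" for k
    by (simp add: \<zeta>_def DeMoivre algebra_simps)
  then show ?thesis using bij_betw_roots_unity[OF r_pos] by (simp add: det_image)
qed

lemma zeta_r: "\<zeta> ^ r = 1"
proof -
  have "\<zeta> ^ r = cis (2 * pi)" using r_pos by (simp add: \<zeta>_def DeMoivre)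
  then show ?thesis by simp
qed

text \<open>The logarithm of the determinant to the base \<open>\<zeta>\<close>, normalised to lie
  below \<open>r\<close>. It depends on the coset of \<open>N\<close> alone and is additive modulo
  \<open>r\<close> only.\<close>

definition dlog :: "complex mat \<Rightarrow> nat" where
  "dlog g = (SOME k. k < r \<and> det g = \<zeta> ^ k)"

lemma dlog: assumes "g \<in> G" shows "dlog g < r" "det g = \<zeta> ^ dlog g"
proof -
  have "det g \<in> (\<lambda>k. \<zeta> ^ k) ` {..<r}" using bij_betw_imp_surj_on[OF roots] assms by simp
  then have "\<exists>k. k < r \<and> det g = \<zeta> ^ k" by auto
  from someI_ex[OF this] show "dlog g < r" "det g = \<zeta> ^ dlog g" by (simp_all add: dlog_def)
qed

lemma dlog_unique: "g \<in> G \<Longrightarrow> k < r \<Longrightarrow> det g = \<zeta> ^ k \<Longrightarrow> dlog g = k"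
  using dlog[of g] bij_betw_imp_inj_on[OF roots] by (metis inj_onD lessThan_iff)

lemma exists_det_zeta: "\<exists>g\<in>G. det g = \<zeta> ^ k"
proof -
  have "(\<zeta> ^ k) ^ r = 1" using zeta_r by (metis mult.commute power_mult power_one)
  then have "\<zeta> ^ k \<in> det ` G" by (simp add: det_image)
  then show ?thesis by force
qed

text \<open>By this symmetry \<open>det g ^ dlog h\<close>, as a function of \<open>h\<close>, is
  the power of the determinant with exponent \<open>dlog g\<close>, so it is a legitimate
  twist.\<close>

lemma det_power_commute: "g \<in> G \<Longrightarrow> h \<in> G \<Longrightarrow> det g ^ dlog h = det h ^ dlog g"
  using dlog(2)[of g] dlog(2)[of h] by (metis mult.commute power_mult)

section \<open>Comparing inner products over \<open>G\<close> and over \<open>N\<close>\<close>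

lemma sum_det_powers:
  assumes g: "g \<in> G"
  shows "(\<Sum>k<r. det g ^ k) = (if g \<in> N then of_nat r else 0)"
proof (cases "det g = 1")
  case False
  have "det g ^ r = 1" using g det_image by blast
  then have "(\<Sum>k<r. det g ^ k) = 0"
    using False by (subst geometric_sum) auto
  then show ?thesis using False by (simp add: N_iff)
qed (use g in \<open>simp add: N_iff\<close>)

text \<open>After interchanging the sums, the inner geometric sum over the powers of one determinant
  is \<open>r\<close> on \<open>N\<close> and 0 elsewhere. The functions are arbitrary, so constants
  are covered too; \<open>card_G\<close> relies on that.\<close>

lemma inner_twist_sum:
  "(\<Sum>k<r. char_inner (GL_sub m G) \<chi> (\<lambda>g. det g ^ k * \<psi> g)) = of_nat r * char_inner (GL_sub m N) \<chi> \<psi>"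
proof -
  have inv: "inv\<^bsub>GL_sub m G\<^esub> g \<in> G" "det (inv\<^bsub>GL_sub m G\<^esub> g) = inverse (det g)" if "g \<in> G" for g
    using group.inv_closed[OF grG, of g] that inv_GL_sub[OF G that] det_GL_inv[OF G_GL[OF that]]
    by simp_all
  have "(\<Sum>k<r. char_inner (GL_sub m G) \<chi> (\<lambda>g. det g ^ k * \<psi> g)) =
    (\<Sum>g\<in>G. \<chi> g * \<psi> (inv\<^bsub>GL_sub m G\<^esub> g) * (\<Sum>k<r. det (inv\<^bsub>GL_sub m G\<^esub> g) ^ k))"
    unfolding char_inner_def sum_distrib_left by (subst sum.swap) (simp add: mult_ac)
  also have "\<dots> = (\<Sum>g\<in>G. if g \<in> N then of_nat r * (\<chi> g * \<psi> (inv\<^bsub>GL_sub m G\<^esub> g)) else 0)"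
  proof (rule sum.cong[OF refl])
    fix g assume g: "g \<in> G"
    have "inv\<^bsub>GL_sub m G\<^esub> g \<in> N \<longleftrightarrow> g \<in> N" using inv[OF g] g by (auto simp: N_iff)
    then show "\<chi> g * \<psi> (inv\<^bsub>GL_sub m G\<^esub> g) * (\<Sum>k<r. det (inv\<^bsub>GL_sub m G\<^esub> g) ^ k) =
      (if g \<in> N then of_nat r * (\<chi> g * \<psi> (inv\<^bsub>GL_sub m G\<^esub> g)) else 0)"
      unfolding sum_det_powers[OF inv(1)[OF g]] by simp
  qed
  also have "\<dots> = (\<Sum>g\<in>N. of_nat r * (\<chi> g * \<psi> (inv\<^bsub>GL_sub m G\<^esub> g)))"
    using N_sub fin by (simp add: sum.If_cases Int_absorb1)
  also have "\<dots> = (\<Sum>g\<in>N. of_nat r * (\<chi> g * \<psi> (inv\<^bsub>GL_sub m N\<^esub> g)))"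
    using N_sub inv_GL_sub[OF G] inv_GL_sub[OF N] by (intro sum.cong refl) (metis subsetD)
  finally show ?thesis by (simp add: char_inner_def sum_distrib_left)
qed

text \<open>Apply \<open>inner_twist_sum\<close> to the constant 1. For \<open>0 < k < r\<close> the
  sum of \<open>det g ^ k\<close> over \<open>G\<close> vanishes: translation by an element of
  determinant \<open>\<zeta>\<close> multiplies it by \<open>\<zeta> ^ k \<noteq> 1\<close>. Only
  \<open>k = 0\<close> survives and contributes \<open>card G\<close>.\<close>

lemma card_G: "card G = r * card N"
proof -
  have z: "(\<Sum>g\<in>G. det (inv\<^bsub>GL_sub m G\<^esub> g) ^ k) = 0" if k: "0 < k" "k < r" for k
  proof -
    interpret group "GL_sub m G" by (rule grG)
    have bij: "bij_betw (\<lambda>g. inv\<^bsub>GL_sub m G\<^esub> g) G G"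
      using inv_closed inv_inv by (intro bij_betwI[of _ _ _ "\<lambda>g. inv\<^bsub>GL_sub m G\<^esub> g"]) auto
    obtain h where h: "h \<in> G" "det h = \<zeta>" using exists_det_zeta[of 1] by auto
    have "bij_betw (\<lambda>g. h * g) G G"
      using h r_inv[of h] l_inv[of h] inv_closed[of h] m_closed m_assoc[of h "inv\<^bsub>GL_sub m G\<^esub> h"]
        m_assoc[of "inv\<^bsub>GL_sub m G\<^esub> h" h] l_one
      by (intro bij_betwI[of _ _ _ "\<lambda>g. inv\<^bsub>GL_sub m G\<^esub> h * g"]) (auto simp: GL_simps)
    then have "(\<Sum>g\<in>G. det g ^ k) = (\<Sum>g\<in>G. det (h * g) ^ k)"
      by (rule sum.reindex_bij_betw[symmetric])
    also have "\<dots> = \<zeta> ^ k * (\<Sum>g\<in>G. det g ^ k)"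
      using h det_GL_mult[OF G_GL G_GL] by (simp add: sum_distrib_left power_mult_distrib)
    finally have "(1 - \<zeta> ^ k) * (\<Sum>g\<in>G. det g ^ k) = 0" by (simp add: algebra_simps)
    moreover have "\<zeta> ^ k \<noteq> 1"
      using bij_betw_imp_inj_on[OF roots] k r_pos by (auto dest!: inj_onD[of _ _ k 0])
    ultimately have "(\<Sum>g\<in>G. det g ^ k) = 0" by simp
    then show ?thesis using sum.reindex_bij_betw[OF bij, of "\<lambda>g. det g ^ k"] by simp
  qed
  have "(of_nat (r * card N) :: complex) = of_nat r * char_inner (GL_sub m N) (\<lambda>_. 1) (\<lambda>_. 1)"
    by (simp add: char_inner_def)
  also have "\<dots> = (\<Sum>k<r. \<Sum>g\<in>G. det (inv\<^bsub>GL_sub m G\<^esub> g) ^ k)"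
    unfolding inner_twist_sum[symmetric] by (simp add: char_inner_def)
  also have "\<dots> = (\<Sum>k<r. if k = 0 then of_nat (card G) else 0)"
    using z by (intro sum.cong) auto
  also have "\<dots> = of_nat (card G)" using r_pos by simp
  finally show ?thesis by (simp only: of_nat_eq_iff)
qed

lemma twist:
  assumes "irreducible_rep (GL_sub m G) \<rho>"
  shows "irreducible_rep (GL_sub m G) (rep_twist (\<lambda>g. det g ^ k) \<rho>)"
    "\<And>g. g \<in> G \<Longrightarrow> rep_char (GL_sub m G) (rep_twist (\<lambda>g. det g ^ k) \<rho>) g = det g ^ k * rep_char (GL_sub m G) \<rho> g"
proof -
  have mult: "det (g \<otimes>\<^bsub>GL_sub m G\<^esub> h) ^ k = det g ^ k * det h ^ k"
    if "g \<in> carrier (GL_sub m G)" "h \<in> carrier (GL_sub m G)" for g h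
    using that det_GL_mult[OF G_GL G_GL, of g h] by (simp add: GL_simps power_mult_distrib)
  have nz: "det g ^ k \<noteq> 0" if "g \<in> carrier (GL_sub m G)" for g
    using that G_GL by (simp add: carrier_GL)
  show "irreducible_rep (GL_sub m G) (rep_twist (\<lambda>g. det g ^ k) \<rho>)"
    by (rule irreducible_twist[OF grG assms mult nz])
  show "rep_char (GL_sub m G) (rep_twist (\<lambda>g. det g ^ k) \<rho>) g = det g ^ k * rep_char (GL_sub m G) \<rho> g" if "g \<in> G" for g
    using that by (intro rep_char_twist[OF grG assms mult nz]) auto
qed

lemma S_irr: "i < length S \<Longrightarrow> irreducible_rep (GL_sub m G) (S ! i)"
  using S nth_mem unfolding complete_irreps_def by blast

lemma T_irr: "j < length T \<Longrightarrow> irreducible_rep (GL_sub m N) (T ! j)"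
  using T nth_mem unfolding complete_irreps_def by blast

text \<open>If the sum over all twists of \<open>\<sigma>\<close> is nonzero, so is one summand.
  Since that twist is again irreducible, orthogonality over \<open>G\<close> forces it to be
  isomorphic to \<open>\<rho>\<close>.\<close>

lemma eq_twist_of_inner_nonzero:
  assumes \<rho>: "irreducible_rep (GL_sub m G) \<rho>" and \<sigma>: "irreducible_rep (GL_sub m G) \<sigma>"
    and "char_inner (GL_sub m N) (rep_char (GL_sub m G) \<rho>) (rep_char (GL_sub m G) \<sigma>) \<noteq> 0"
  shows "\<exists>k<r. \<forall>g\<in>G. rep_char (GL_sub m G) \<rho> g = det g ^ k * rep_char (GL_sub m G) \<sigma> g"
proof -
  let ?c = "rep_char (GL_sub m G)"
  have "(\<Sum>k<r. char_inner (GL_sub m G) (?c \<rho>) (\<lambda>g. det g ^ k * ?c \<sigma> g)) \<noteq> 0"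
    unfolding inner_twist_sum using assms(3) r_pos by simp
  then obtain k where k: "k < r" "char_inner (GL_sub m G) (?c \<rho>) (\<lambda>g. det g ^ k * ?c \<sigma> g) \<noteq> 0"
    by (elim sum.not_neutral_contains_not_neutral) simp
  let ?t = "rep_twist (\<lambda>g. det g ^ k) \<sigma>"
  have "char_inner (GL_sub m G) (?c \<rho>) (?c ?t) = char_inner (GL_sub m G) (?c \<rho>) (\<lambda>g. det g ^ k * ?c \<sigma> g)"
    unfolding char_inner_def using group.inv_closed[OF grG] by (intro sum.cong refl) (simp add: twist[OF \<sigma>])
  with k(2) have "char_inner (GL_sub m G) (?c \<rho>) (?c ?t) \<noteq> 0" by argo
  then have "rep_iso (GL_sub m G) ?t \<rho>"
    using char_orthogonal[OF grG twist(1)[OF \<sigma>] \<rho>] by blast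
  then have "?c ?t = ?c \<rho>"
    by (rule rep_char_iso[OF grG irreducible_repD(1)[OF twist(1)[OF \<sigma>]] irreducible_repD(1)[OF \<rho>]])
  then have "\<forall>g\<in>G. ?c \<rho> g = det g ^ k * ?c \<sigma> g" using twist(2)[OF \<sigma>, of _ k] by simp
  with k show ?thesis by blast
qed

lemma restriction_irreducible:
  assumes \<rho>: "irreducible_rep (GL_sub m G) \<rho>"
  shows "\<exists>j<length T. \<forall>g\<in>N. rep_char (GL_sub m G) \<rho> g = \<chi>N j g"
proof -
  let ?c = "rep_char (GL_sub m G)" and ?d = "rep_char (GL_sub m N)"
  have cd: "?c \<rho>' g = ?d \<rho>' g" if "g \<in> N" for g \<rho>'
    using that N_sub by (auto simp: rep_char_def)
  have \<rho>N: "representation (GL_sub m N) \<rho>"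
    by (rule representation_subgroup[OF G N N_sub irreducible_repD(1)[OF \<rho>]])
  obtain xs where xs: "\<forall>\<tau>\<in>set xs. irreducible_rep (GL_sub m N) \<tau>" "rep_iso (GL_sub m N) \<rho> (rep_sum xs)"
    using complete_reducibility[OF grN finite_carriers(2) \<rho>N] by blast
  have "xs \<noteq> []"
    using xs(2) irreducible_repD(2)[OF \<rho>] by (auto simp: rep_iso_def rep_sum_Nil)
  then obtain \<tau> where \<tau>: "\<tau> \<in> set xs" using list.set_sel(1) by blast
  have \<tau>i: "irreducible_rep (GL_sub m N) \<tau>" using \<tau> xs by blast
  have xr: "\<And>\<tau>'. \<tau>' \<in> set xs \<Longrightarrow> representation (GL_sub m N) \<tau>'" using xs irreducible_repD(1) by blast
  \<comment> \<open>Recording the inner products as natural numbers excludes cancellation: the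
    contribution of \<open>\<tau>\<close> itself is positive, hence so is the total.\<close>
  define mult where "mult \<tau>' = (if rep_iso (GL_sub m N) \<tau> \<tau>' then card N else 0)" for \<tau>'
  have mult: "char_inner (GL_sub m N) (?d \<tau>') (?d \<tau>) = of_nat (mult \<tau>')" if "\<tau>' \<in> set xs" for \<tau>'
  proof (cases "rep_iso (GL_sub m N) \<tau> \<tau>'")
    case True
    have "?d \<tau>' = ?d \<tau>"
      using rep_char_iso[OF grN xr[OF \<tau>] xr[OF that] True] by simp
    then show ?thesis using char_norm[OF grN \<tau>i] True by (simp add: mult_def)
  next
    case False
    then show ?thesis using char_orthogonal[OF grN \<tau>i _ False] xs that by (simp add: mult_def)
  qed
  have "char_inner (GL_sub m N) (?c \<rho>) (?d \<tau>) = char_inner (GL_sub m N) (\<lambda>g. \<Sum>\<tau>'\<leftarrow>xs. ?d \<tau>' g) (?d \<tau>)"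
  proof (rule char_inner_cong[OF grN _ refl])
    fix h assume h: "h \<in> carrier (GL_sub m N)"
    have "?c \<rho> h = ?d (rep_sum xs) h"
      using cd h rep_char_iso[OF grN \<rho>N representation_sum[OF grN xr] xs(2)] by simp
    then show "?c \<rho> h = (\<Sum>\<tau>'\<leftarrow>xs. ?d \<tau>' h)" using rep_char_sum[OF grN xr h] by simp
  qed
  also have "\<dots> = (\<Sum>\<tau>'\<leftarrow>xs. char_inner (GL_sub m N) (?d \<tau>') (?d \<tau>))"
    by (induction xs) (simp_all add: char_inner_def sum.distrib distrib_right)
  also have "\<dots> = of_nat (\<Sum>\<tau>'\<leftarrow>xs. mult \<tau>')"
    using mult by (induction xs) simp_all
  finally have inner: "char_inner (GL_sub m N) (?c \<rho>) (?d \<tau>) = of_nat (\<Sum>\<tau>'\<leftarrow>xs. mult \<tau>')" .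
  have "mult \<tau> \<noteq> 0" using card_N_pos rep_iso_refl[OF grN xr[OF \<tau>]] by (simp add: mult_def)
  moreover have "mult \<tau> \<le> (\<Sum>\<tau>'\<leftarrow>xs. mult \<tau>')" using \<tau> by (simp add: member_le_sum_list)
  ultimately have nz: "char_inner (GL_sub m N) (?c \<rho>) (?d \<tau>) \<noteq> 0"
    unfolding inner of_nat_eq_0_iff by linarith
  have "irreducible_char (GL_sub m N) (?d \<tau>)" using \<tau>i unfolding irreducible_char_def by blast
  from ext[OF this] obtain \<sigma> where \<sigma>: "irreducible_rep (GL_sub m G) \<sigma>" "restrict (?c \<sigma>) N = ?d \<tau>"
    by (auto simp: extendible_def irreducible_char_def)
  have \<sigma>\<tau>: "?c \<sigma> g = ?d \<tau> g" if "g \<in> N" for g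
    using fun_cong[OF \<sigma>(2), of g] that by simp
  have "char_inner (GL_sub m N) (?c \<rho>) (?c \<sigma>) = char_inner (GL_sub m N) (?c \<rho>) (?d \<tau>)"
    using \<sigma>\<tau> by (intro char_inner_cong[OF grN]) auto
  then obtain k where k: "\<forall>g\<in>G. ?c \<rho> g = det g ^ k * ?c \<sigma> g"
    using eq_twist_of_inner_nonzero[OF \<rho> \<sigma>(1)] nz by auto
  \<comment> \<open>The twisting factor is 1 on \<open>N\<close>, so the constituent
    \<open>\<tau>\<close> already accounts for the whole restriction.\<close>
  have "?c \<rho> g = ?d \<tau> g" if "g \<in> N" for g
    using k that N_sub \<sigma>\<tau> by (auto simp: N_iff)
  moreover obtain j where "j < length T" "?d \<tau> = \<chi>N j"
    using irreducible_char_in_list[OF grN T \<tau>i] by blast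
  ultimately show ?thesis by auto
qed

section \<open>The restriction map on irreducible characters and its fibres\<close>

definition \<pi> :: "nat \<Rightarrow> nat" where
  "\<pi> i = (SOME j. j < length T \<and> (\<forall>g\<in>N. \<chi>G i g = \<chi>N j g))"

lemma \<pi>: assumes "i < length S" shows "\<pi> i < length T" "\<And>g. g \<in> N \<Longrightarrow> \<chi>G i g = \<chi>N (\<pi> i) g"
proof -
  have "\<exists>j. j < length T \<and> (\<forall>g\<in>N. \<chi>G i g = \<chi>N j g)"
    using restriction_irreducible[OF S_irr[OF assms]] by blast
  from someI_ex[OF this, folded \<pi>_def]
  show "\<pi> i < length T" "\<And>g. g \<in> N \<Longrightarrow> \<chi>G i g = \<chi>N (\<pi> i) g"
    by blast+
qed

lemma \<chi>N_inject: "i < length T \<Longrightarrow> j < length T \<Longrightarrow> (\<And>g. g \<in> N \<Longrightarrow> \<chi>N i g = \<chi>N j g) \<Longrightarrow> i = j"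
  using irreps_char_inject[OF grN finite_carriers(2) T] by simp

lemma \<chi>G_inject: "i < length S \<Longrightarrow> j < length S \<Longrightarrow> (\<And>g. g \<in> G \<Longrightarrow> \<chi>G i g = \<chi>G j g) \<Longrightarrow> i = j"
  using irreps_char_inject[OF grG finite_carriers(1) S] by simp

lemma \<pi>_eqI: "i < length S \<Longrightarrow> j < length T \<Longrightarrow> (\<And>g. g \<in> N \<Longrightarrow> \<chi>G i g = \<chi>N j g) \<Longrightarrow> \<pi> i = j"
  using \<pi>[of i] by (intro \<chi>N_inject) auto

text \<open>Surjectivity is extendibility itself: an irreducible extension of
  \<open>\<chi>N j\<close> occurs in \<open>S\<close> up to isomorphism.\<close>

lemma \<pi>_image: "\<pi> ` {..<length S} = {..<length T}"
proof (intro equalityI subsetI)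
  fix j assume "j \<in> {..<length T}"
  then have j: "j < length T" by simp
  have "irreducible_char (GL_sub m N) (\<chi>N j)" using T_irr[OF j] unfolding irreducible_char_def by blast
  from ext[OF this] obtain \<sigma> where \<sigma>: "irreducible_rep (GL_sub m G) \<sigma>"
    "restrict (rep_char (GL_sub m G) \<sigma>) N = \<chi>N j"
    by (auto simp: extendible_def irreducible_char_def)
  obtain i where i: "i < length S" "rep_char (GL_sub m G) \<sigma> = \<chi>G i"
    using irreducible_char_in_list[OF grG S \<sigma>(1)] by blast
  have "\<pi> i = j" using i fun_cong[OF \<sigma>(2)] by (intro \<pi>_eqI[OF i(1) j]) (metis restrict_apply')
  then show "j \<in> \<pi> ` {..<length S}" using i by auto
qed (use \<pi> in auto)

text \<open>Both characters restrict to the same irreducible character of \<open>N\<close>, whose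
  norm is nonzero.\<close>

lemma fibre_twist:
  assumes "i < length S" "i' < length S" "\<pi> i = \<pi> i'"
  shows "\<exists>k<r. \<forall>g\<in>G. \<chi>G i' g = det g ^ k * \<chi>G i g"
proof (rule eq_twist_of_inner_nonzero[OF S_irr S_irr])
  have "char_inner (GL_sub m N) (\<chi>G i') (\<chi>G i) = char_inner (GL_sub m N) (\<chi>N (\<pi> i)) (\<chi>N (\<pi> i))"
    using \<pi> assms by (intro char_inner_cong[OF grN]) auto
  then show "char_inner (GL_sub m N) (\<chi>G i') (\<chi>G i) \<noteq> 0"
    using char_norm[OF grN T_irr[OF \<pi>(1)[OF assms(1)]]] card_N_pos by simp
qed (use assms in auto)

text \<open>The products of \<open>\<chi>G i\<close> with its \<open>r\<close> twists are each 0 or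
  \<open>card G\<close> and add up to \<open>r * card N = card G\<close>. The exponent 0 already
  uses up the total, which leaves no room for a second twist equal to
  \<open>\<chi>G i\<close>.\<close>

lemma twist_free:
  assumes i: "i < length S" and k: "k < r" and eq: "\<And>g. g \<in> G \<Longrightarrow> \<chi>G i g = det g ^ k * \<chi>G i g"
  shows "k = 0"
proof (rule ccontr)
  assume "k \<noteq> 0"
  let ?f = "\<lambda>l. char_inner (GL_sub m G) (\<chi>G i) (\<lambda>g. det g ^ l * \<chi>G i g)"
  have f: "?f l = of_nat (card G) \<or> ?f l = 0" for l
  proof -
    obtain j where j: "j < length S" "rep_char (GL_sub m G) (rep_twist (\<lambda>g. det g ^ l) (S ! i)) = \<chi>G j"
      using irreducible_char_in_list[OF grG S twist(1)[OF S_irr[OF i]]] by blast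
    have "?f l = char_inner (GL_sub m G) (\<chi>G i) (\<chi>G j)"
      unfolding j(2)[symmetric] using twist(2)[OF S_irr[OF i]] by (intro char_inner_cong[OF grG]) auto
    then show ?thesis using char_inner_irreps[OF grG S i j(1)] by simp
  qed
  \<comment> \<open>The same values as natural numbers, where the two terms 0 and \<open>k\<close>
    can be compared with the whole sum.\<close>
  define f' where "f' l = (if ?f l = 0 then 0 else card G)" for l
  have f': "?f l = of_nat (f' l)" for l using f[of l] by (auto simp: f'_def)
  have norm: "char_inner (GL_sub m G) (\<chi>G i) (\<chi>G i) = of_nat (card G)"
    using char_norm[OF grG S_irr[OF i]] by simp
  have "?f k = of_nat (card G)"
    unfolding norm[symmetric] using eq by (intro char_inner_cong[OF grG]) auto
  then have fk: "f' k = card G" using f'[of k] by simp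
  have f0: "f' 0 = card G" using f'[of 0] norm by simp
  have "char_inner (GL_sub m N) (\<chi>G i) (\<chi>G i) = of_nat (card N)"
    using char_norm[OF grN T_irr[OF \<pi>(1)[OF i]]] char_inner_cong[OF grN \<pi>(2)[OF i] \<pi>(2)[OF i]] by simp
  then have "(of_nat (\<Sum>l<r. f' l) :: complex) = of_nat (r * card N)"
    using inner_twist_sum[of "\<chi>G i" "\<chi>G i"] by (simp add: f')
  then have "(\<Sum>l<r. f' l) = card G" unfolding of_nat_eq_iff card_G .
  moreover have "(\<Sum>l\<in>{0, k}. f' l) \<le> (\<Sum>l<r. f' l)" using k r_pos by (intro sum_mono2) auto
  moreover have "card G \<noteq> 0" using fin one_G by auto
  ultimately show False using \<open>k \<noteq> 0\<close> f0 fk by simp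
qed

section \<open>Arrow multiplicities under restriction and twisting\<close>

abbreviation aG :: "nat \<Rightarrow> nat \<Rightarrow> nat" where
  "aG \<equiv> mckay_mult (GL_sub m G) (m, \<lambda>h. h) S"

abbreviation aN :: "nat \<Rightarrow> nat \<Rightarrow> nat" where
  "aN \<equiv> mckay_mult (GL_sub m N) (m, \<lambda>h. h) T"

lemma natural_rep: "representation (GL_sub m G) (m, \<lambda>h. h)" "representation (GL_sub m N) (m, \<lambda>h. h)"
  using G_GL N_sub
  by (auto simp: representation_iff[OF grG] representation_iff[OF grN] GL_simps carrier_GL)

text \<open>Both sides are coefficients of one function on \<open>N\<close>, the product of the
  natural character with \<open>\<chi>G i\<close>. The expansion over \<open>G\<close> is regrouped
  along the fibres of \<open>\<pi>\<close>.\<close>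

lemma aN_eq_sum:
  assumes i: "i < length S" and j: "j < length T"
  shows "aN (\<pi> i) j = (\<Sum>l | l < length S \<and> \<pi> l = j. aG i l)"
proof -
  let ?v = "rep_char (GL_sub m N) (m, \<lambda>h. h)"
  have "(of_nat (aN (\<pi> i) j) :: complex) = of_nat (\<Sum>l | l < length S \<and> \<pi> l = j. aG i l)"
  proof (rule char_coeff_unique[OF grN finite_carriers(2) T _ j])
    fix g assume "g \<in> carrier (GL_sub m N)"
    then have g: "g \<in> N" by simp
    then have gG: "g \<in> G" using N_sub by blast
    have v: "rep_char (GL_sub m G) (m, \<lambda>h. h) g = ?v g" using g gG by (simp add: rep_char_def)
    have "(\<Sum>j<length T. of_nat (aN (\<pi> i) j) * \<chi>N j g) = ?v g * \<chi>N (\<pi> i) g"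
      using mckay_mult_char[OF grN finite_carriers(2) natural_rep(2) T \<pi>(1)[OF i]] g by simp
    also have "\<dots> = (\<Sum>l<length S. of_nat (aG i l) * \<chi>G l g)"
      using mckay_mult_char[OF grG finite_carriers(1) natural_rep(1) S i, of g] gG \<pi>(2)[OF i g] v by simp
    also have "\<dots> = (\<Sum>l<length S. of_nat (aG i l) * \<chi>N (\<pi> l) g)"
      using \<pi>(2)[OF _ g] by (intro sum.cong) auto
    also have "\<dots> = (\<Sum>j<length T. \<Sum>l | l \<in> {..<length S} \<and> \<pi> l = j. of_nat (aG i l) * \<chi>N (\<pi> l) g)"
      using \<pi>_image by (intro sum.group[symmetric]) auto
    also have "\<dots> = (\<Sum>j<length T. of_nat (\<Sum>l | l < length S \<and> \<pi> l = j. aG i l) * \<chi>N j g)"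
      unfolding of_nat_sum sum_distrib_right by (intro sum.cong refl) auto
    finally show "(\<Sum>j<length T. of_nat (aN (\<pi> i) j) * \<chi>N j g) = \<dots>" .
  qed
  then show ?thesis unfolding of_nat_eq_iff .
qed

text \<open>
  \<open>h \<mapsto> det g ^ dlog h\<close> is the character of \<open>G/N\<close> attached to \<open>g\<close>; it is multiplicative in both
  arguments because it equals \<open>\<zeta> ^ (dlog g * dlog h)\<close>.
\<close>

definition act :: "complex mat \<Rightarrow> nat \<Rightarrow> nat" where
  "act g i = (SOME l. l < length S \<and> (\<forall>h\<in>G. \<chi>G l h = det g ^ dlog h * \<chi>G i h))"

lemma act:
  assumes g: "g \<in> G" and i: "i < length S"
  shows "act g i < length S" "\<And>h. h \<in> G \<Longrightarrow> \<chi>G (act g i) h = det g ^ dlog h * \<chi>G i h"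
proof -
  \<comment> \<open>The exponent is \<open>dlog g\<close>; \<open>det_power_commute\<close> turns
    the resulting factor \<open>det h ^ dlog g\<close> into the one used in
    \<open>act_def\<close>.\<close>
  let ?t = "rep_twist (\<lambda>h. det h ^ dlog g) (S ! i)"
  obtain l where "l < length S" "rep_char (GL_sub m G) ?t = \<chi>G l"
    using irreducible_char_in_list[OF grG S twist(1)[OF S_irr[OF i]]] by blast
  then have "\<exists>l. l < length S \<and> (\<forall>h\<in>G. \<chi>G l h = det g ^ dlog h * \<chi>G i h)"
    using twist(2)[OF S_irr[OF i], of _ "dlog g"] det_power_commute[OF g] by (intro exI[of _ l]) simp
  from someI_ex[OF this, folded act_def]
  show "act g i < length S" "\<And>h. h \<in> G \<Longrightarrow> \<chi>G (act g i) h = det g ^ dlog h * \<chi>G i h" by blast+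
qed

lemma act_eqI:
  assumes "g \<in> G" "i < length S" "l < length S" "\<And>h. h \<in> G \<Longrightarrow> \<chi>G l h = det g ^ dlog h * \<chi>G i h"
  shows "act g i = l"
  using act[OF assms(1,2)] assms(3,4) by (intro \<chi>G_inject) simp_all

lemma act_inject:
  assumes g: "g \<in> G" and ij: "i < length S" "j < length S" and eq: "act g i = act g j"
  shows "i = j"
proof (rule \<chi>G_inject[OF ij])
  fix h assume h: "h \<in> G"
  have "det g ^ dlog h * \<chi>G i h = det g ^ dlog h * \<chi>G j h"
    unfolding act(2)[OF g ij(1) h, symmetric] act(2)[OF g ij(2) h, symmetric] eq ..
  moreover have "det g \<noteq> 0" using G_GL[OF g] by (simp add: carrier_GL)
  ultimately show "\<chi>G i h = \<chi>G j h" by simp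
qed

text \<open>Twisting commutes with the tensor product by \<open>V\<close> and permutes the
  irreducible characters, so it permutes the coefficients in the same way.\<close>

lemma aG_act:
  assumes g: "g \<in> G" and i: "i < length S" and j: "j < length S"
  shows "aG (act g i) (act g j) = aG i j"
proof -
  let ?v = "rep_char (GL_sub m G) (m, \<lambda>h. h)"
  \<comment> \<open>The right side is written as a sum over a fibre of \<open>act g\<close>, which
    is what regrouping yields; injectivity of \<open>act g\<close> leaves the single term
    \<open>l = j\<close>.\<close>
  have "(of_nat (aG (act g i) (act g j)) :: complex) = of_nat (\<Sum>l | l < length S \<and> act g l = act g j. aG i l)"
  proof (rule char_coeff_unique[OF grG finite_carriers(1) S _ act(1)[OF g j]])
    fix h assume "h \<in> carrier (GL_sub m G)"
    then have h: "h \<in> G" by simp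
    have "(\<Sum>j<length S. of_nat (aG (act g i) j) * \<chi>G j h) = ?v h * \<chi>G (act g i) h"
      using mckay_mult_char[OF grG finite_carriers(1) natural_rep(1) S act(1)[OF g i]] h by simp
    also have "\<dots> = det g ^ dlog h * (?v h * \<chi>G i h)"
      using act(2)[OF g i h] by simp
    also have "\<dots> = (\<Sum>l<length S. of_nat (aG i l) * (det g ^ dlog h * \<chi>G l h))"
      using mckay_mult_char[OF grG finite_carriers(1) natural_rep(1) S i, of h] h
      by (simp add: sum_distrib_left mult_ac)
    also have "\<dots> = (\<Sum>l<length S. of_nat (aG i l) * \<chi>G (act g l) h)"
      using act(2)[OF g _ h] by (intro sum.cong) auto
    also have "\<dots> = (\<Sum>j<length S. \<Sum>l | l \<in> {..<length S} \<and> act g l = j. of_nat (aG i l) * \<chi>G (act g l) h)"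
      using act(1)[OF g] by (intro sum.group[symmetric]) auto
    also have "\<dots> = (\<Sum>j<length S. of_nat (\<Sum>l | l < length S \<and> act g l = j. aG i l) * \<chi>G j h)"
      unfolding of_nat_sum sum_distrib_right by (intro sum.cong refl) auto
    finally show "(\<Sum>j<length S. of_nat (aG (act g i) j) * \<chi>G j h) = \<dots>" .
  qed
  moreover have "{l. l < length S \<and> act g l = act g j} = {j}" using act_inject[OF g _ j] j by blast
  ultimately show ?thesis by simp
qed

text \<open>Here it pays that \<open>act\<close> is defined through \<open>det g ^ dlog h\<close>:
  multiplicativity of the determinant in \<open>g\<close> is exact, while \<open>dlog\<close> would
  be additive only modulo \<open>r\<close>.\<close>

lemma act_mult:
  assumes g: "g \<in> G" and h: "h \<in> G" and i: "i < length S"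
  shows "act (g * h) i = act g (act h i)"
proof (rule act_eqI[OF G_mult[OF g h] i act(1)[OF g act(1)[OF h i]]])
  fix x assume x: "x \<in> G"
  show "\<chi>G (act g (act h i)) x = det (g * h) ^ dlog x * \<chi>G i x"
    using act(2)[OF g act(1)[OF h i] x] act(2)[OF h i x] det_GL_mult[OF G_GL[OF g] G_GL[OF h]]
    by (simp add: power_mult_distrib)
qed

lemma act_N: "g \<in> N \<Longrightarrow> i < length S \<Longrightarrow> act g i = i"
  by (rule act_eqI) (simp_all add: N_iff)

lemma act_free:
  assumes g: "g \<in> G" and i: "i < length S" and eq: "act g i = i"
  shows "g \<in> N"
proof -
  have "dlog g = 0"
    using act(2)[OF g i] eq det_power_commute[OF g] by (intro twist_free[OF i dlog(1)[OF g]]) simp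
  then show ?thesis using dlog(2)[OF g] g by (simp add: N_iff)
qed

text \<open>The twisting factor is trivial on \<open>N\<close>, so orbits stay inside fibres.
  Conversely, two members of a fibre differ by some power \<open>k\<close> of the determinant, and
  an element of determinant \<open>\<zeta> ^ k\<close> realises this twist.\<close>

lemma act_fibre:
  assumes i: "i < length S"
  shows "(\<lambda>g. act g i) ` G = {l. l < length S \<and> \<pi> l = \<pi> i}"
proof (intro equalityI subsetI)
  fix l assume "l \<in> (\<lambda>g. act g i) ` G"
  then obtain g where g: "g \<in> G" "l = act g i" by blast
  have "\<pi> l = \<pi> i"
  proof (rule \<pi>_eqI)
    fix h assume h: "h \<in> N"
    then have hG: "h \<in> G" using N_sub by blast
    have "det g ^ dlog h = 1" using det_power_commute[OF g(1) hG] h by (simp add: N_iff)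
    then show "\<chi>G l h = \<chi>N (\<pi> i) h" using act(2)[OF g(1) i hG] g \<pi>(2)[OF i h] by simp
  qed (use g act(1)[OF _ i] \<pi>(1)[OF i] in auto)
  then show "l \<in> {l. l < length S \<and> \<pi> l = \<pi> i}" using g act(1)[OF _ i] by simp
next
  fix l assume "l \<in> {l. l < length S \<and> \<pi> l = \<pi> i}"
  then have l: "l < length S" "\<pi> i = \<pi> l" by auto
  obtain k where k: "k < r" "\<And>g. g \<in> G \<Longrightarrow> \<chi>G l g = det g ^ k * \<chi>G i g"
    using fibre_twist[OF i l] by blast
  obtain g where g: "g \<in> G" "det g = \<zeta> ^ k" using exists_det_zeta by blast
  have "act g i = l"
    using k det_power_commute[OF g(1)] dlog_unique[OF g(1) k(1) g(2)] by (intro act_eqI[OF g(1) i l(1)]) simp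
  then show "l \<in> (\<lambda>g. act g i) ` G" using g by blast
qed

lemma mckay_regular_covering:
  "\<exists>\<pi>a. regular_covering (GL_sub m G Mod N) (mckay_quiver m G S) (mckay_quiver m N T) \<pi> \<pi>a"
proof -
  let ?n = "length S"
  have normal: "N \<lhd> GL_sub m G" unfolding N_eq by (rule normal_inter_SL[OF G])
  define \<phi> where "\<phi> g = restrict (act g) {..<?n}" for g
  have "group_action (GL_sub m G) {..<?n} \<phi>"
  proof (rule group_actionI[OF grG])
    fix g h i assume "g \<in> carrier (GL_sub m G)" "h \<in> carrier (GL_sub m G)" "i \<in> {..<?n}"
    then show "\<phi> (g \<otimes>\<^bsub>GL_sub m G\<^esub> h) i = \<phi> g (\<phi> h i)"
      using act_mult[of g h i] act(1)[of h i] by (simp add: \<phi>_def GL_simps)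
  qed (use act act_N[of "1\<^sub>m m"] one_G in \<open>auto simp: \<phi>_def GL_simps N_iff\<close>)
  then interpret \<phi>: group_hom "GL_sub m G" "BijGroup {..<?n}" \<phi>
    by (simp add: group_action_def)
  \<comment> \<open>Since \<open>N\<close> acts trivially, the action of \<open>G\<close> factors
    through the quotient; \<open>act_free\<close> later shows that nothing more acts trivially on
    any vertex.\<close>
  have "N \<subseteq> kernel (GL_sub m G) (BijGroup {..<?n}) \<phi>"
    using N_sub act_N by (auto simp: kernel_def BijGroup_def \<phi>_def intro!: restrict_ext)
  from \<phi>.FactGroup_universal_kernel[OF normal this]
  obtain \<psi> where hom: "\<psi> \<in> hom (GL_sub m G Mod N) (BijGroup {..<?n})"
    and \<psi>: "\<And>g. g \<in> carrier (GL_sub m G) \<Longrightarrow> \<psi> (N #>\<^bsub>GL_sub m G\<^esub> g) = \<phi> g" by blast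
  have grM: "group (GL_sub m G Mod N)" by (rule normal.factorgroup_is_group[OF normal])
  have act_\<psi>: "group_action (GL_sub m G Mod N) {..<?n} \<psi>"
    using grM hom group_BijGroup by (simp add: group_action_def group_hom_def group_hom_axioms_def)
  have coset: "\<exists>g\<in>G. \<gamma> = N #>\<^bsub>GL_sub m G\<^esub> g" if "\<gamma> \<in> carrier (GL_sub m G Mod N)" for \<gamma>
    using that by (auto simp: FactGroup_def RCOSETS_def)
  have coset': "N #>\<^bsub>GL_sub m G\<^esub> g \<in> carrier (GL_sub m G Mod N)" if "g \<in> G" for g
    using that by (auto simp: FactGroup_def RCOSETS_def)
  have \<psi>_act: "\<psi> (N #>\<^bsub>GL_sub m G\<^esub> g) i = act g i" if "g \<in> G" "i < ?n" for g i
    using \<psi>[of g] that by (simp add: \<phi>_def)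
  have "\<exists>\<pi>a. regular_covering (GL_sub m G Mod N) (mult_quiver ?n aG) (mult_quiver (length T) aN) \<pi> \<pi>a"
  proof (rule regular_covering_of_free_action[OF grM act_\<psi>])
    fix \<gamma> i j assume "\<gamma> \<in> carrier (GL_sub m G Mod N)" "i < ?n" "j < ?n"
    then show "aG (\<psi> \<gamma> i) (\<psi> \<gamma> j) = aG i j" using coset[of \<gamma>] \<psi>_act aG_act by auto
  next
    show "\<pi> ` {..<?n} = {..<length T}" by (rule \<pi>_image)
  next
    fix i assume i: "i < ?n"
    have "orbit (GL_sub m G Mod N) \<psi> i = (\<lambda>g. act g i) ` G"
      unfolding orbit_def using coset coset' \<psi>_act[OF _ i] by force
    then show "orbit (GL_sub m G Mod N) \<psi> i = {i'. i' < ?n \<and> \<pi> i' = \<pi> i}"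
      using act_fibre[OF i] by simp
  next
    fix \<gamma> i assume "\<gamma> \<in> carrier (GL_sub m G Mod N)" and i: "i < ?n" and eq: "\<psi> \<gamma> i = i"
    then obtain g where g: "g \<in> G" "\<gamma> = N #>\<^bsub>GL_sub m G\<^esub> g" using coset by blast
    have "g \<in> N" using act_free[OF g(1) i] eq \<psi>_act[OF g(1) i] g by simp
    then have "\<gamma> = N"
      using subgroup.rcos_const[OF normal_imp_subgroup[OF normal] grG] g by simp
    then show "\<gamma> = \<one>\<^bsub>GL_sub m G Mod N\<^esub>" by (simp add: FactGroup_def)
  next
    fix i j' assume "i < ?n" "j' < length T"
    then show "aN (\<pi> i) j' = (\<Sum>j | j < ?n \<and> \<pi> j = j'. aG i j)" by (rule aN_eq_sum)
  qed
  then show ?thesis by (simp add: mckay_quiver_def mult_quiver_def)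
qed

end

theorem theorem1p2:
  fixes m :: nat and G N :: "complex mat set" and S T :: "complex mat rep list"
  assumes "m \<ge> 1"
    and "subgroup G (GL m)" and "finite G"
    and "N = G \<inter> SL m"
    and "\<And>\<chi>. irreducible_char (GL_sub m N) \<chi> \<Longrightarrow> extendible (GL_sub m G) N \<chi>"
    and "complete_irreps (GL_sub m G) S"
    and "complete_irreps (GL_sub m N) T"
  shows "\<exists>\<pi>v \<pi>a. regular_covering (GL_sub m G Mod N) (mckay_quiver m G S) (mckay_quiver m N T) \<pi>v \<pi>a"
proof -
  interpret mckay_extension m G N S T
    using assms(2-7) by (rule mckay_extension.intro)
  show ?thesis using mckay_regular_covering by blast
qed

end
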